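(* Let $k$ be a commutative Noetherian ring and let $\mathcal{T}$ be a $k$-linear approximable triangulated category such that $\operatorname{Hom}_{\mathcal{T}}(X,Y)$ is a finitely generated $k$-module for all $X,Y \in \mathcal{T}^c$. Then $$\mathcal{T}^b_c = \Big\{ t \in \mathcal{T} \ \Big|\ \bigoplus_{i \in \mathbb{Z}} \operatorname{Hom}_{\mathcal{T}}(c,\Sigma^i t) \text{ is a finitely generated } k\text{-module for every } c \in \mathcal{T}^c \Big\}.$$
   Context: Let $\mathcal{T}$ be a triangulated category with (small) coproducts and shift functor $\Sigma$; $\mathcal{T}^c$ denotes its full subcategory of compact objects. Building objects. For $S \subseteq \mathcal{T}$ and an interval $[a,b] \subseteq \mathbb{Z}$: $\overline{\langle S\rangle}_1^{[a,b]}$ consists of all (arbitrary) coproducts of $i$-th shifts, $i\in[a,b]$, of summands of objects of $S$; and $\overline{\langle S\rangle}_n^{[a,b]}$ consists of all summands of objects $X$ fitting in a triangle $X' \to X \to X'' \to \Sigma X'$ with $X' \in \overline{\langle S\rangle}_1^{[a,b]}$ and $X'' \in \overline{\langle S\rangle}_{n-1}^{[a,b]}$. t-structures. For a $t$-structure $(\mathcal{T}^{\leq 0},\mathcal{T}^{\geq 0})$ put $\mathcal{T}^{\leq n} = \Sigma^{-n}\mathcal{T}^{\leq 0}$, $\mathcal{T}^{\geq n} = \Sigma^{-n}\mathcal{T}^{\geq 0}$, $\mathcal{T}^- = \bigcup_n \mathcal{T}^{\leq n}$, $\mathcal{T}^+ = \bigcup_n \mathcal{T}^{\geq n}$, $\mathcal{T}^b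 = \mathcal{T}^-\cap\mathcal{T}^+$. Two $t$-structures $(\mathcal{T}_1^{\leq 0},\mathcal{T}_1^{\geq 0})$ and $(\mathcal{T}_2^{\leq 0},\mathcal{T}_2^{\geq 0})$ are equivalent if there is $N \geq 0$ with $\mathcal{T}_1^{\leq -N} \subseteq \mathcal{T}_2^{\leq 0} \subseteq \mathcal{T}_1^{\leq N}$. Any compact object generates a $t$-structure (whose aisle $\mathcal{T}^{\leq 0}$ is the smallest full subcategory containing the object and closed under $\Sigma$, extensions, coproducts and summands); the $t$-structures generated by different compact generators are equivalent. A $t$-structure is in the preferred equivalence class if it is equivalent to one generated by a compact generator of $\mathcal{T}$. Approximability. $\mathcal{T}$ is approximable if it has a compact generator $G$, a $t$-structure $(\mathcal{T}^{\leq 0},\mathcal{T}^{\geq 0})$ and an integer $A>0$ such that (1) $\Sigma^A G \in \mathcal{T}^{\leq 0}$; (2) $\operatorname{Hom}_{\mathcal{T}}(\Sigma^{-A}G,E)=0$ for all $E \in \mathcal{T}^{\leq 0}$; (3) for every $F \in \mathcal{T}^{\leq 0}$ there is a triangle $E \to F \to D \to \Sigma E$ with $D \in \mathcal{T}^{\leq -1}$ and $E \in \overline{\langle G\rangle}_A^{[-A,A]}$. The subcategory $\mathcal{T}^b_c$. For $\mathcal{T}$ approximable and $(\mathcal{T}^{\leq 0},\mathcal{T}^{\geq 0})$ a $t$-structure in the preferred equivalence class, $\mathcal{T}^-_c$ consists of all $F \in \mathcal{T}$ such that for every $n>0$ there is a triangle $E \to F \to D \to \Sigma E$ with $E \in \mathcal{T}^c$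 and $D \in \mathcal{T}^{\leq -n}$; and $\mathcal{T}^b_c = \mathcal{T}^-_c \cap \mathcal{T}^b$. These do not depend on the choice of $t$-structure in the preferred equivalence class. *)

theory Defs
  imports "HOL-Algebra.Module" "HOL-Algebra.Ring_Divisibility"
begin

unbundle cardinal_syntax

section \<open>Modules\<close>

definition fg_module :: "('k, 'a) ring_scheme \<Rightarrow> ('k, 'm, 'b) module_scheme \<Rightarrow> bool" where
  "fg_module R M \<longleftrightarrow>
     (\<exists>A \<subseteq> carrier M. finite A \<and>
        (\<forall>x \<in> carrier M. \<exists>c \<in> A \<rightarrow> carrier R. x = (\<Oplus>\<^bsub>M\<^esub>a\<in>A. c a \<odot>\<^bsub>M\<^esub> a)))"

text \<open>The record fields for a ring multiplication and its unit play no role for modules.\<close>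

definition direct_sum ::
  "'j set \<Rightarrow> ('j \<Rightarrow> ('k, 'm, 'b) module_scheme) \<Rightarrow> ('k, 'j \<Rightarrow> 'm) module" where
  "direct_sum I M =
     \<lparr> carrier = {s \<in> (\<Pi>\<^sub>E i\<in>I. carrier (M i)). finite {i \<in> I. s i \<noteq> \<zero>\<^bsub>M i\<^esub>}},
       monoid.mult = undefined, monoid.one = undefined,
       ring.zero = (\<lambda>i\<in>I. \<zero>\<^bsub>M i\<^esub>),
       ring.add = (\<lambda>s t. \<lambda>i\<in>I. s i \<oplus>\<^bsub>M i\<^esub> t i),
       module.smult = (\<lambda>r s. \<lambda>i\<in>I. r \<odot>\<^bsub>M i\<^esub> s i) \<rparr>"


section \<open>Linear triangulated categories\<close>

text \<open>\<open>Hom T X Y\<close> is the module of morphisms from \<open>X\<close> to \<open>Y\<close>. Composition and the shift of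
  morphisms are not indexed by objects, as is usual when distinct pairs of objects have disjoint
  sets of morphisms; disjointness itself is never required. \<open>Tri T X Y Z f g h\<close> says that
  \<open>X \<rightarrow> Y \<rightarrow> Z \<rightarrow> \<Sigma>X\<close> with maps \<open>f\<close>, \<open>g\<close>, \<open>h\<close> is a distinguished triangle.\<close>

record ('o, 'm, 'k) tri_data =
  Obj :: "'o set"
  Hom :: "'o \<Rightarrow> 'o \<Rightarrow> ('k, 'm) module"
  Ident :: "'o \<Rightarrow> 'm"
  Comp :: "'m \<Rightarrow> 'm \<Rightarrow> 'm" (infixr \<open>\<bullet>\<index>\<close> 70)
  Shift :: "'o \<Rightarrow> 'o"
  ShiftM :: "'m \<Rightarrow> 'm"
  Tri :: "'o \<Rightarrow> 'o \<Rightarrow> 'o \<Rightarrow> 'm \<Rightarrow> 'm \<Rightarrow> 'm \<Rightarrow> bool"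

abbreviation mor :: "('o, 'm, 'k) tri_data \<Rightarrow> 'o \<Rightarrow> 'o \<Rightarrow> 'm set" where
  "mor T X Y \<equiv> carrier (Hom T X Y)"

definition is_iso :: "('o, 'm, 'k) tri_data \<Rightarrow> 'o \<Rightarrow> 'o \<Rightarrow> 'm \<Rightarrow> bool" where
  "is_iso T X Y f \<longleftrightarrow> f \<in> mor T X Y \<and>
     (\<exists>g \<in> mor T Y X. g \<bullet>\<^bsub>T\<^esub> f = Ident T X \<and> f \<bullet>\<^bsub>T\<^esub> g = Ident T Y)"

definition is_zero_object :: "('o, 'm, 'k) tri_data \<Rightarrow> 'o \<Rightarrow> bool" where
  "is_zero_object T Z \<longleftrightarrow> Z \<in> Obj T \<and>
     (\<forall>X \<in> Obj T. (\<exists>!f. f \<in> mor T Z X) \<and> (\<exists>!f. f \<in> mor T X Z))"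

definition is_coproduct ::
  "('o, 'm, 'k) tri_data \<Rightarrow> 'j set \<Rightarrow> ('j \<Rightarrow> 'o) \<Rightarrow> 'o \<Rightarrow> ('j \<Rightarrow> 'm) \<Rightarrow> bool" where
  "is_coproduct T I F C \<iota> \<longleftrightarrow> C \<in> Obj T \<and>
     (\<forall>i\<in>I. F i \<in> Obj T \<and> \<iota> i \<in> mor T (F i) C) \<and>
     (\<forall>Y \<in> Obj T. \<forall>f. (\<forall>i\<in>I. f i \<in> mor T (F i) Y) \<longrightarrow>
        (\<exists>!h. h \<in> mor T C Y \<and> (\<forall>i\<in>I. h \<bullet>\<^bsub>T\<^esub> \<iota> i = f i)))"

definition is_binary_coproduct ::
  "('o, 'm, 'k) tri_data \<Rightarrow> 'o \<Rightarrow> 'o \<Rightarrow> 'o \<Rightarrow> bool" where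
  "is_binary_coproduct T A B C \<longleftrightarrow>
     (\<exists>\<iota>. is_coproduct T (UNIV :: bool set) (\<lambda>b. if b then A else B) C \<iota>)"

definition summand :: "('o, 'm, 'k) tri_data \<Rightarrow> 'o \<Rightarrow> 'o \<Rightarrow> bool" where
  "summand T A X \<longleftrightarrow> (\<exists>B \<in> Obj T. is_binary_coproduct T A B X)"

locale linear_category =
  fixes k :: "('k, 'a) ring_scheme" and T :: "('o, 'm, 'k) tri_data" (structure)
  assumes Hom_module: "\<lbrakk>X \<in> Obj T; Y \<in> Obj T\<rbrakk> \<Longrightarrow> module k (Hom T X Y)"
    and Ident_closed: "X \<in> Obj T \<Longrightarrow> Ident T X \<in> mor T X X"
    and Comp_closed:
      "\<lbrakk>X \<in> Obj T; Y \<in> Obj T; Z \<in> Obj T; f \<in> mor T X Y; g \<in> mor T Y Z\<rbrakk> \<Longrightarrow> g \<bullet> f \<in> mor T X Z"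
    and Ident_left: "\<lbrakk>X \<in> Obj T; Y \<in> Obj T; f \<in> mor T X Y\<rbrakk> \<Longrightarrow> Ident T Y \<bullet> f = f"
    and Ident_right: "\<lbrakk>X \<in> Obj T; Y \<in> Obj T; f \<in> mor T X Y\<rbrakk> \<Longrightarrow> f \<bullet> Ident T X = f"
    and Comp_assoc:
      "\<lbrakk>W \<in> Obj T; X \<in> Obj T; Y \<in> Obj T; Z \<in> Obj T;
        f \<in> mor T W X; g \<in> mor T X Y; h \<in> mor T Y Z\<rbrakk> \<Longrightarrow> (h \<bullet> g) \<bullet> f = h \<bullet> (g \<bullet> f)"
    and Comp_add_left:
      "\<lbrakk>X \<in> Obj T; Y \<in> Obj T; Z \<in> Obj T; f \<in> mor T X Y; g \<in> mor T Y Z; g' \<in> mor T Y Z\<rbrakk> \<Longrightarrow>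
        (g \<oplus>\<^bsub>Hom T Y Z\<^esub> g') \<bullet> f = (g \<bullet> f) \<oplus>\<^bsub>Hom T X Z\<^esub> (g' \<bullet> f)"
    and Comp_add_right:
      "\<lbrakk>X \<in> Obj T; Y \<in> Obj T; Z \<in> Obj T; f \<in> mor T X Y; f' \<in> mor T X Y; g \<in> mor T Y Z\<rbrakk> \<Longrightarrow>
        g \<bullet> (f \<oplus>\<^bsub>Hom T X Y\<^esub> f') = (g \<bullet> f) \<oplus>\<^bsub>Hom T X Z\<^esub> (g \<bullet> f')"
    and Comp_smult_left:
      "\<lbrakk>X \<in> Obj T; Y \<in> Obj T; Z \<in> Obj T; r \<in> carrier k; f \<in> mor T X Y; g \<in> mor T Y Z\<rbrakk> \<Longrightarrow>
        (r \<odot>\<^bsub>Hom T Y Z\<^esub> g) \<bullet> f = r \<odot>\<^bsub>Hom T X Z\<^esub> (g \<bullet> f)"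
    and Comp_smult_right:
      "\<lbrakk>X \<in> Obj T; Y \<in> Obj T; Z \<in> Obj T; r \<in> carrier k; f \<in> mor T X Y; g \<in> mor T Y Z\<rbrakk> \<Longrightarrow>
        g \<bullet> (r \<odot>\<^bsub>Hom T X Y\<^esub> f) = r \<odot>\<^bsub>Hom T X Z\<^esub> (g \<bullet> f)"

text \<open>The shift is a linear automorphism of the category (not merely an autoequivalence), so that
  its negative powers are defined on the nose.\<close>

locale linear_triangulated_category = linear_category +
  assumes zero_object: "\<exists>Z. is_zero_object T Z"
    and binary_coproduct: "\<lbrakk>X \<in> Obj T; Y \<in> Obj T\<rbrakk> \<Longrightarrow> \<exists>C. is_binary_coproduct T X Y C"
    and Shift_bij: "bij_betw (Shift T) (Obj T) (Obj T)"
    and ShiftM_bij: "\<lbrakk>X \<in> Obj T; Y \<in> Obj T\<rbrakk> \<Longrightarrow>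
      bij_betw (ShiftM T) (mor T X Y) (mor T (Shift T X) (Shift T Y))"
    and ShiftM_Ident: "X \<in> Obj T \<Longrightarrow> ShiftM T (Ident T X) = Ident T (Shift T X)"
    and ShiftM_Comp:
      "\<lbrakk>X \<in> Obj T; Y \<in> Obj T; Z \<in> Obj T; f \<in> mor T X Y; g \<in> mor T Y Z\<rbrakk> \<Longrightarrow>
        ShiftM T (g \<bullet> f) = ShiftM T g \<bullet> ShiftM T f"
    and ShiftM_add:
      "\<lbrakk>X \<in> Obj T; Y \<in> Obj T; f \<in> mor T X Y; f' \<in> mor T X Y\<rbrakk> \<Longrightarrow>
        ShiftM T (f \<oplus>\<^bsub>Hom T X Y\<^esub> f') =
          ShiftM T f \<oplus>\<^bsub>Hom T (Shift T X) (Shift T Y)\<^esub> ShiftM T f'"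
    and ShiftM_smult:
      "\<lbrakk>X \<in> Obj T; Y \<in> Obj T; r \<in> carrier k; f \<in> mor T X Y\<rbrakk> \<Longrightarrow>
        ShiftM T (r \<odot>\<^bsub>Hom T X Y\<^esub> f) = r \<odot>\<^bsub>Hom T (Shift T X) (Shift T Y)\<^esub> ShiftM T f"
    and Tri_closed: "Tri T X Y Z f g h \<Longrightarrow>
      X \<in> Obj T \<and> Y \<in> Obj T \<and> Z \<in> Obj T \<and>
      f \<in> mor T X Y \<and> g \<in> mor T Y Z \<and> h \<in> mor T Z (Shift T X)"
    and TR1_iso:
      "\<lbrakk>Tri T X Y Z f g h; X' \<in> Obj T; Y' \<in> Obj T; Z' \<in> Obj T;
        f' \<in> mor T X' Y'; g' \<in> mor T Y' Z'; h' \<in> mor T Z' (Shift T X');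
        is_iso T X X' u; is_iso T Y Y' v; is_iso T Z Z' w;
        v \<bullet> f = f' \<bullet> u; w \<bullet> g = g' \<bullet> v; ShiftM T u \<bullet> h = h' \<bullet> w\<rbrakk> \<Longrightarrow>
        Tri T X' Y' Z' f' g' h'"
    and TR1_Ident:
      "\<lbrakk>X \<in> Obj T; is_zero_object T Z\<rbrakk> \<Longrightarrow>
        Tri T X X Z (Ident T X) \<zero>\<^bsub>Hom T X Z\<^esub> \<zero>\<^bsub>Hom T Z (Shift T X)\<^esub>"
    and TR1_cone:
      "\<lbrakk>X \<in> Obj T; Y \<in> Obj T; f \<in> mor T X Y\<rbrakk> \<Longrightarrow> \<exists>Z g h. Tri T X Y Z f g h"
    and TR2:
      "\<lbrakk>X \<in> Obj T; Y \<in> Obj T; Z \<in> Obj T;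
        f \<in> mor T X Y; g \<in> mor T Y Z; h \<in> mor T Z (Shift T X)\<rbrakk> \<Longrightarrow>
        Tri T X Y Z f g h \<longleftrightarrow>
        Tri T Y Z (Shift T X) g h (\<ominus>\<^bsub>Hom T (Shift T X) (Shift T Y)\<^esub> ShiftM T f)"
    and TR3:
      "\<lbrakk>Tri T X Y Z f g h; Tri T X' Y' Z' f' g' h';
        u \<in> mor T X X'; v \<in> mor T Y Y'; v \<bullet> f = f' \<bullet> u\<rbrakk> \<Longrightarrow>
        \<exists>w \<in> mor T Z Z'. w \<bullet> g = g' \<bullet> v \<and> ShiftM T u \<bullet> h = h' \<bullet> w"
    and TR4:
      "\<lbrakk>Tri T X Y Z' f a b; Tri T Y Z X' g c d; Tri T X Z Y' (g \<bullet> f) e l\<rbrakk> \<Longrightarrow>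
        \<exists>u \<in> mor T Z' Y'. \<exists>v \<in> mor T Y' X'.
          Tri T Z' Y' X' u v (ShiftM T a \<bullet> d) \<and>
          u \<bullet> a = e \<bullet> g \<and> l \<bullet> u = b \<and> v \<bullet> e = c \<and> d \<bullet> v = ShiftM T f \<bullet> l"

definition shift_pow :: "('o, 'm, 'k) tri_data \<Rightarrow> int \<Rightarrow> 'o \<Rightarrow> 'o" where
  "shift_pow T i =
     (if i \<ge> 0 then Shift T ^^ nat i else inv_into (Obj T) (Shift T) ^^ nat (- i))"


section \<open>Small coproducts and compact objects\<close>

text \<open>Sizes are measured by a cardinal \<open>\<kappa>\<close>: a set is small if it has fewer than \<open>\<kappa>\<close> elements.
  Every small set is equipotent to a subset of the underlying type of \<open>\<kappa>\<close>, so it suffices to index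
  small families by such subsets. Smallness relative to a Grothendieck universe is the case of a
  (strongly inaccessible) cardinal \<open>\<kappa>\<close>. The strong limit property is not demanded: HOL does not
  prove that inaccessible cardinals exist, whereas successor cardinals satisfy what is demanded.\<close>

definition smallness_cardinal :: "'i rel \<Rightarrow> bool" where
  "smallness_cardinal \<kappa> \<longleftrightarrow> Card_order \<kappa> \<and> natLeq <o \<kappa> \<and> regularCard \<kappa>"

definition has_small_coproducts :: "'i rel \<Rightarrow> ('o, 'm, 'k) tri_data \<Rightarrow> bool" where
  "has_small_coproducts \<kappa> T \<longleftrightarrow>
     (\<forall>(I :: 'i set) F. |I| <o \<kappa> \<longrightarrow> F \<in> I \<rightarrow> Obj T \<longrightarrow> (\<exists>C \<iota>. is_coproduct T I F C \<iota>))"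

text \<open>The canonical map from the direct sum of the modules \<open>Hom c (F i)\<close> to \<open>Hom c C\<close>.\<close>

definition coproduct_comparison ::
  "('o, 'm, 'k) tri_data \<Rightarrow> 'o \<Rightarrow> 'j set \<Rightarrow> ('j \<Rightarrow> 'o) \<Rightarrow> 'o \<Rightarrow> ('j \<Rightarrow> 'm) \<Rightarrow> ('j \<Rightarrow> 'm) \<Rightarrow> 'm" where
  "coproduct_comparison T c I F C \<iota> s =
     (\<Oplus>\<^bsub>Hom T c C\<^esub>i\<in>{i \<in> I. s i \<noteq> \<zero>\<^bsub>Hom T c (F i)\<^esub>}. \<iota> i \<bullet>\<^bsub>T\<^esub> s i)"

definition compact_objects :: "'i rel \<Rightarrow> ('o, 'm, 'k) tri_data \<Rightarrow> 'o set" where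
  "compact_objects \<kappa> T =
     {c \<in> Obj T. \<forall>(I :: 'i set) F C \<iota>. |I| <o \<kappa> \<longrightarrow> is_coproduct T I F C \<iota> \<longrightarrow>
        bij_betw (coproduct_comparison T c I F C \<iota>)
          (carrier (direct_sum I (\<lambda>i. Hom T c (F i)))) (mor T c C)}"

text \<open>In a locally small category all sets of morphisms are small. Only those out of compact
  objects are required to be so: with all of them small, the powers \<open>Hom (\<Coprod> c) c\<close> would force
  \<open>\<kappa>\<close> to be inaccessible unless the category is trivial.\<close>

definition locally_small :: "'i rel \<Rightarrow> ('o, 'm, 'k) tri_data \<Rightarrow> bool" where
  "locally_small \<kappa> T \<longleftrightarrow> (\<forall>c \<in> compact_objects \<kappa> T. \<forall>X \<in> Obj T. |mor T c X| <o \<kappa>)"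

definition compact_generator :: "'i rel \<Rightarrow> ('o, 'm, 'k) tri_data \<Rightarrow> 'o \<Rightarrow> bool" where
  "compact_generator \<kappa> T G \<longleftrightarrow> G \<in> compact_objects \<kappa> T \<and>
     (\<forall>X \<in> Obj T. (\<forall>i. mor T (shift_pow T i G) X = {\<zero>\<^bsub>Hom T (shift_pow T i G) X\<^esub>})
        \<longrightarrow> is_zero_object T X)"

text \<open>The building construction is only meaningful for \<open>n \<ge> 1\<close>.\<close>

fun building ::
  "'i rel \<Rightarrow> ('o, 'm, 'k) tri_data \<Rightarrow> 'o set \<Rightarrow> int \<Rightarrow> int \<Rightarrow> nat \<Rightarrow> 'o set" where
  "building \<kappa> T S a b 0 = {}"
| "building \<kappa> T S a b (Suc 0) =
     {X. \<exists>(I :: 'i set) F \<iota>. |I| <o \<kappa> \<and> is_coproduct T I F X \<iota> \<and>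
        (\<forall>j\<in>I. \<exists>i \<in> {a..b}. \<exists>s \<in> S. \<exists>A. summand T A s \<and> F j = shift_pow T i A)}"
| "building \<kappa> T S a b (Suc (Suc n)) =
     {Y. \<exists>X X' X'' f g h. summand T Y X \<and> Tri T X' X X'' f g h \<and>
        X' \<in> building \<kappa> T S a b (Suc 0) \<and> X'' \<in> building \<kappa> T S a b (Suc n)}"


section \<open>t-structures\<close>

text \<open>A t-structure is given by the pair of its subcategories of index \<open>\<le> 0\<close> and \<open>\<ge> 0\<close>.\<close>

type_synonym 'o tstr = "'o set \<times> 'o set"

definition t_le :: "('o, 'm, 'k) tri_data \<Rightarrow> 'o tstr \<Rightarrow> int \<Rightarrow> 'o set" where
  "t_le T \<tau> n = shift_pow T (- n) ` fst \<tau>"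

definition t_ge :: "('o, 'm, 'k) tri_data \<Rightarrow> 'o tstr \<Rightarrow> int \<Rightarrow> 'o set" where
  "t_ge T \<tau> n = shift_pow T (- n) ` snd \<tau>"

definition iso_closed :: "('o, 'm, 'k) tri_data \<Rightarrow> 'o set \<Rightarrow> bool" where
  "iso_closed T S \<longleftrightarrow> (\<forall>X \<in> S. \<forall>Y \<in> Obj T. (\<exists>f. is_iso T X Y f) \<longrightarrow> Y \<in> S)"

definition t_structure :: "('o, 'm, 'k) tri_data \<Rightarrow> 'o tstr \<Rightarrow> bool" where
  "t_structure T \<tau> \<longleftrightarrow>
     fst \<tau> \<subseteq> Obj T \<and> snd \<tau> \<subseteq> Obj T \<and> iso_closed T (fst \<tau>) \<and> iso_closed T (snd \<tau>) \<and>
     t_le T \<tau> (-1) \<subseteq> t_le T \<tau> 0 \<and> t_ge T \<tau> 1 \<subseteq> t_ge T \<tau> 0 \<and>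
     (\<forall>X \<in> t_le T \<tau> 0. \<forall>Y \<in> t_ge T \<tau> 1. mor T X Y = {\<zero>\<^bsub>Hom T X Y\<^esub>}) \<and>
     (\<forall>X \<in> Obj T. \<exists>A \<in> t_le T \<tau> 0. \<exists>B \<in> t_ge T \<tau> 1. \<exists>f g h. Tri T A X B f g h)"

definition t_minus :: "('o, 'm, 'k) tri_data \<Rightarrow> 'o tstr \<Rightarrow> 'o set" where
  "t_minus T \<tau> = (\<Union>n. t_le T \<tau> n)"

definition t_plus :: "('o, 'm, 'k) tri_data \<Rightarrow> 'o tstr \<Rightarrow> 'o set" where
  "t_plus T \<tau> = (\<Union>n. t_ge T \<tau> n)"

definition t_bounded :: "('o, 'm, 'k) tri_data \<Rightarrow> 'o tstr \<Rightarrow> 'o set" where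
  "t_bounded T \<tau> = t_minus T \<tau> \<inter> t_plus T \<tau>"

definition t_equivalent :: "('o, 'm, 'k) tri_data \<Rightarrow> 'o tstr \<Rightarrow> 'o tstr \<Rightarrow> bool" where
  "t_equivalent T \<tau>\<^sub>1 \<tau>\<^sub>2 \<longleftrightarrow>
     (\<exists>N\<ge>0. t_le T \<tau>\<^sub>1 (- N) \<subseteq> t_le T \<tau>\<^sub>2 0 \<and> t_le T \<tau>\<^sub>2 0 \<subseteq> t_le T \<tau>\<^sub>1 N)"

inductive_set generated_aisle :: "'i rel \<Rightarrow> ('o, 'm, 'k) tri_data \<Rightarrow> 'o \<Rightarrow> 'o set"
  for \<kappa> :: "'i rel" and T :: "('o, 'm, 'k) tri_data" and G :: 'o where
  generator: "G \<in> generated_aisle \<kappa> T G"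
| shift: "X \<in> generated_aisle \<kappa> T G \<Longrightarrow> Shift T X \<in> generated_aisle \<kappa> T G"
| extension: "\<lbrakk>Tri T X Y Z f g h; X \<in> generated_aisle \<kappa> T G; Z \<in> generated_aisle \<kappa> T G\<rbrakk>
    \<Longrightarrow> Y \<in> generated_aisle \<kappa> T G"
| coproduct: "\<lbrakk>|I :: 'i set| <o \<kappa>; is_coproduct T I F C \<iota>; \<And>i. i \<in> I \<Longrightarrow> F i \<in> generated_aisle \<kappa> T G\<rbrakk>
    \<Longrightarrow> C \<in> generated_aisle \<kappa> T G"
| summand: "\<lbrakk>summand T A X; X \<in> generated_aisle \<kappa> T G\<rbrakk> \<Longrightarrow> A \<in> generated_aisle \<kappa> T G"

definition preferred_t_structure :: "'i rel \<Rightarrow> ('o, 'm, 'k) tri_data \<Rightarrow> 'o tstr \<Rightarrow> bool" where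
  "preferred_t_structure \<kappa> T \<tau> \<longleftrightarrow> t_structure T \<tau> \<and>
     (\<exists>G \<tau>'. compact_generator \<kappa> T G \<and> t_structure T \<tau>' \<and>
        fst \<tau>' = generated_aisle \<kappa> T G \<and> t_equivalent T \<tau> \<tau>')"


section \<open>Approximability\<close>

definition approximable :: "'i rel \<Rightarrow> ('o, 'm, 'k) tri_data \<Rightarrow> bool" where
  "approximable \<kappa> T \<longleftrightarrow>
     (\<exists>G \<tau> (A :: nat). compact_generator \<kappa> T G \<and> t_structure T \<tau> \<and> A > 0 \<and>
        shift_pow T (int A) G \<in> t_le T \<tau> 0 \<and>
        (\<forall>E \<in> t_le T \<tau> 0.
           mor T (shift_pow T (- int A) G) E = {\<zero>\<^bsub>Hom T (shift_pow T (- int A) G) E\<^esub>}) \<and>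
        (\<forall>F \<in> t_le T \<tau> 0. \<exists>E D f g h. Tri T E F D f g h \<and> D \<in> t_le T \<tau> (-1) \<and>
           E \<in> building \<kappa> T {G} (- int A) (int A) A))"

definition T_minus_c :: "'i rel \<Rightarrow> ('o, 'm, 'k) tri_data \<Rightarrow> 'o tstr \<Rightarrow> 'o set" where
  "T_minus_c \<kappa> T \<tau> =
     {F \<in> Obj T. \<forall>n>0. \<exists>E D f g h. Tri T E F D f g h \<and>
        E \<in> compact_objects \<kappa> T \<and> D \<in> t_le T \<tau> (- n)}"

definition T_b_c :: "'i rel \<Rightarrow> ('o, 'm, 'k) tri_data \<Rightarrow> 'o tstr \<Rightarrow> 'o set" where
  "T_b_c \<kappa> T \<tau> = T_minus_c \<kappa> T \<tau> \<inter> t_bounded T \<tau>"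

end

theory Submission
  imports Defs
begin

text \<open>Let \<open>\<tau>\<close> and \<open>G\<close> witness approximability. A sequence \<open>c \<rightarrow> D\<^sub>0 \<rightarrow> D\<^sub>1 \<rightarrow> \<dots>\<close> with \<open>c\<close> compact,
  such that each shift of \<open>G\<close> has no maps to \<open>D\<^sub>n\<close> for large \<open>n\<close>, has a vanishing composite
  \<open>c \<rightarrow> D\<^sub>n\<close>. Applied to the truncations of \<open>c\<close> this bounds compact objects above with respect to
  \<open>\<tau>\<close> and to every t-structure generated by a compact generator, so the latter are equivalent to \<open>\<tau>\<close>.
  Applied to the approximation sequence of \<open>c\<close> it shows that compact objects have no maps to deep
  enough levels of the aisle. This yields finite generation for objects of \<open>T\<^sup>b\<^sub>c\<close>.

  Conversely, approximation of the truncations of \<open>t\<close> detects boundedness of \<open>t\<close> by the vanishing of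
  \<open>Hom (G, \<Sigma>\<^sup>i t)\<close> for large \<open>|i|\<close>. If \<open>t\<close> lies in the aisle and has finitely generated Hom modules
  from compact objects, then all maps to \<open>t\<close> from objects built from \<open>G\<close> in a bounded way factor
  through a single compact \<open>C \<rightarrow> t\<close>. It need not lie in the aisle, but the fibre \<open>E\<close> of
  the map from \<open>t\<close> to a step of its approximation sequence does, and \<open>C \<rightarrow> t\<close> lifts to \<open>E\<close> up to a
  compact object of the aisle. Up to that object, the cone of the difference between the identity
  and \<open>C \<rightarrow> E \<rightarrow> C\<close> is a compact approximation of \<open>t\<close>. Since Hom modules of the remaining cone are again
  finitely generated, this can be iterated.\<close>

subsection \<open>Finitely generated modules\<close>

text \<open>The obstacle in the converse is that absorbing maps through \<open>C\<close> ->
  \<open>t\<close> does not control the level of its cone. Passing to the cone of the difference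
  does the work of splitting an idempotent: whatever of \<open>C\<close> is visible to the coaisle
  is cancelled except for a correction through \<open>E\<close>, which the coaisle cannot see. So
  the new compact object lies in the aisle, yet \<open>E\<close> -> \<open>t\<close> still factors
  through it, and both facts together bound the level of its cone over \<open>t\<close>. The
  Noetherian hypothesis enters because each absorption replaces \<open>t\<close> by the target of a
  map with compact cone, and finite generation survives this only if submodules inherit it.
  Membership in an aisle is tested throughout by orthogonality to the coaisle. Vanishing of
  composites into long sequences comes from the homotopy colimit, which a compact generator
  recognizes as zero.\<close>

context module
begin

text \<open>An intersection makes minimality and monotonicity immediate; linear combinations are
  only needed for finite sets. If \<open>S\<close> is not contained in the carrier, no submodule
  contains it and the intersection is the whole type, whence the inclusion hypotheses below.\<close>

definition span :: "'c set \<Rightarrow> 'c set" where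
  "span S = \<Inter>{N. submodule N R M \<and> S \<subseteq> N}"

lemma submodule_subset: "submodule N R M \<Longrightarrow> N \<subseteq> carrier M"
  and submodule_zero: "submodule N R M \<Longrightarrow> \<zero>\<^bsub>M\<^esub> \<in> N"
  and submodule_add: "\<lbrakk>submodule N R M; x \<in> N; y \<in> N\<rbrakk> \<Longrightarrow> x \<oplus>\<^bsub>M\<^esub> y \<in> N"
  and submodule_neg: "\<lbrakk>submodule N R M; x \<in> N\<rbrakk> \<Longrightarrow> \<ominus>\<^bsub>M\<^esub> x \<in> N"
  and submodule_smult: "\<lbrakk>submodule N R M; a \<in> carrier R; x \<in> N\<rbrakk> \<Longrightarrow> a \<odot>\<^bsub>M\<^esub> x \<in> N"
  using submoduleE[of N] subgroup.one_closed[OF submodule.axioms(1), of N R M] by auto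

text \<open>Negation is scaling by \<open>\<ominus> \<one>\<close>, so it drops out of the
  conditions to check.\<close>

lemma submoduleI':
  assumes "N \<subseteq> carrier M" "\<zero>\<^bsub>M\<^esub> \<in> N"
    and "\<And>x y. \<lbrakk>x \<in> N; y \<in> N\<rbrakk> \<Longrightarrow> x \<oplus>\<^bsub>M\<^esub> y \<in> N"
    and smult: "\<And>a x. \<lbrakk>a \<in> carrier R; x \<in> N\<rbrakk> \<Longrightarrow> a \<odot>\<^bsub>M\<^esub> x \<in> N"
  shows "submodule N R M"
proof (rule submoduleI)
  fix x assume "x \<in> N"
  then have "x \<in> carrier M" using assms(1) by blast
  then have "\<ominus>\<^bsub>M\<^esub> x = (\<ominus> \<one>) \<odot>\<^bsub>M\<^esub> x" by (simp add: smult_l_minus)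
  then show "\<ominus>\<^bsub>M\<^esub> x \<in> N" using smult[OF _ \<open>x \<in> N\<close>, of "\<ominus> \<one>"] by simp
qed (use assms in auto)

lemma span_submodule:
  assumes "S \<subseteq> carrier M"
  shows "submodule (span S) R M"
proof (rule submoduleI')
  show "span S \<subseteq> carrier M"
    using assms carrier_is_submodule by (auto simp: span_def)
qed (auto simp: span_def submodule_zero submodule_add submodule_smult)

lemma span_superset: "S \<subseteq> span S"
  by (auto simp: span_def)

lemma span_minimal: "\<lbrakk>submodule N R M; S \<subseteq> N\<rbrakk> \<Longrightarrow> span S \<subseteq> N"
  by (auto simp: span_def)

lemma span_mono: "S \<subseteq> S' \<Longrightarrow> span S \<subseteq> span S'"
  by (auto simp: span_def)

lemma submodule_Int:
  assumes "submodule N R M" "submodule N' R M"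
  shows "submodule (N \<inter> N') R M"
  using assms
  by (intro submoduleI') (auto dest: submodule_subset simp: submodule_zero submodule_add
    submodule_smult)

lemma submodule_finsum:
  assumes "submodule N R M" "finite B" "\<And>b. b \<in> B \<Longrightarrow> f b \<in> N"
  shows "(\<Oplus>\<^bsub>M\<^esub>b\<in>B. f b) \<in> N"
  using assms(2,3)
proof (induction B)
  case empty
  then show ?case using assms(1) by (simp add: submodule_zero)
next
  case (insert x F)
  then have "f \<in> F \<rightarrow> carrier M" "f x \<in> carrier M"
    using submodule_subset[OF assms(1)] by auto
  then show ?case using insert assms(1) by (simp add: submodule_add)
qed

lemma span_finite:
  assumes "finite S" "S \<subseteq> carrier M"
  shows "span S = {\<Oplus>\<^bsub>M\<^esub>s\<in>S. c s \<odot>\<^bsub>M\<^esub> s |c. c \<in> S \<rightarrow> carrier R}" (is "_ = ?L")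
proof
  have "submodule ?L R M"
  proof (rule submoduleI')
    show "?L \<subseteq> carrier M" using assms by (auto intro!: M.finsum_closed)
    have "(\<Oplus>\<^bsub>M\<^esub>s\<in>S. \<zero> \<odot>\<^bsub>M\<^esub> s) = \<zero>\<^bsub>M\<^esub>"
      using assms by (intro M.add.finprod_one_eqI) auto
    then show "\<zero>\<^bsub>M\<^esub> \<in> ?L" by (auto intro!: exI[of _ "\<lambda>_. \<zero>"])
  next
    fix x y assume "x \<in> ?L" "y \<in> ?L"
    then obtain c d where c: "c \<in> S \<rightarrow> carrier R" "x = (\<Oplus>\<^bsub>M\<^esub>s\<in>S. c s \<odot>\<^bsub>M\<^esub> s)"
      and d: "d \<in> S \<rightarrow> carrier R" "y = (\<Oplus>\<^bsub>M\<^esub>s\<in>S. d s \<odot>\<^bsub>M\<^esub> s)" by auto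
    have "x \<oplus>\<^bsub>M\<^esub> y = (\<Oplus>\<^bsub>M\<^esub>s\<in>S. c s \<odot>\<^bsub>M\<^esub> s \<oplus>\<^bsub>M\<^esub> d s \<odot>\<^bsub>M\<^esub> s)"
      unfolding c(2) d(2) by (rule M.finsum_addf[symmetric]) (use c d assms in auto)
    also have "\<dots> = (\<Oplus>\<^bsub>M\<^esub>s\<in>S. (c s \<oplus> d s) \<odot>\<^bsub>M\<^esub> s)"
      by (intro M.finsum_cong') (use c d assms in \<open>auto simp: smult_l_distr Pi_iff subset_iff\<close>)
    finally show "x \<oplus>\<^bsub>M\<^esub> y \<in> ?L" using c d by (auto intro!: exI[of _ "\<lambda>s. c s \<oplus> d s"])
  next
    fix a x assume a: "a \<in> carrier R" and "x \<in> ?L"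
    then obtain c where c: "c \<in> S \<rightarrow> carrier R" "x = (\<Oplus>\<^bsub>M\<^esub>s\<in>S. c s \<odot>\<^bsub>M\<^esub> s)" by auto
    have "a \<odot>\<^bsub>M\<^esub> x = (\<Oplus>\<^bsub>M\<^esub>s\<in>S. a \<odot>\<^bsub>M\<^esub> (c s \<odot>\<^bsub>M\<^esub> s))"
      unfolding c(2) by (rule finsum_smult_ldistr) (use a c assms in auto)
    also have "\<dots> = (\<Oplus>\<^bsub>M\<^esub>s\<in>S. (a \<otimes> c s) \<odot>\<^bsub>M\<^esub> s)"
      by (intro M.finsum_cong') (use a c assms in \<open>auto simp: smult_assoc1 Pi_iff subset_iff\<close>)
    finally show "a \<odot>\<^bsub>M\<^esub> x \<in> ?L" using a c by (auto intro!: exI[of _ "\<lambda>s. a \<otimes> c s"])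
  qed
  moreover have "S \<subseteq> ?L"
  proof
    fix x assume x: "x \<in> S"
    have "(\<Oplus>\<^bsub>M\<^esub>s\<in>S. (if x = s then \<one> else \<zero>) \<odot>\<^bsub>M\<^esub> s) = (\<Oplus>\<^bsub>M\<^esub>s\<in>S. if x = s then s else \<zero>\<^bsub>M\<^esub>)"
      by (intro M.finsum_cong') (use assms in \<open>auto simp: subset_iff\<close>)
    also have "\<dots> = x" using x assms by (intro M.finsum_singleton) auto
    finally show "x \<in> ?L" by (auto intro!: exI[of _ "\<lambda>s. if x = s then \<one> else \<zero>"])
  qed
  ultimately show "span S \<subseteq> ?L" by (rule span_minimal)
  show "?L \<subseteq> span S"
  proof clarify
    fix c assume c: "c \<in> S \<rightarrow> carrier R"
    show "(\<Oplus>\<^bsub>M\<^esub>s\<in>S. c s \<odot>\<^bsub>M\<^esub> s) \<in> span S"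
    proof (rule submodule_finsum[OF span_submodule[OF assms(2)] assms(1)])
      fix s assume "s \<in> S"
      then show "c s \<odot>\<^bsub>M\<^esub> s \<in> span S"
        using c span_superset submodule_smult[OF span_submodule[OF assms(2)]] by blast
    qed
  qed
qed

text \<open>From here on finite generation is handled through spans, whose minimality replaces
  computations with coefficient sums.\<close>

lemma fg_module_iff_span:
  "fg_module R M \<longleftrightarrow> (\<exists>S \<subseteq> carrier M. finite S \<and> carrier M \<subseteq> span S)"
  unfolding fg_module_def
proof (intro ex_cong1 conj_cong refl)
  fix S assume "finite S" "S \<subseteq> carrier M"
  then show "(\<forall>x\<in>carrier M. \<exists>c\<in>S \<rightarrow> carrier R. x = (\<Oplus>\<^bsub>M\<^esub>a\<in>S. c a \<odot>\<^bsub>M\<^esub> a)) \<longleftrightarrow> carrier M \<subseteq> span S"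
    by (auto simp: span_finite subset_iff)
qed

lemma span_insert:
  assumes "a \<in> carrier M" "S \<subseteq> carrier M"
  shows "span (insert a S) = {r \<odot>\<^bsub>M\<^esub> a \<oplus>\<^bsub>M\<^esub> y |r y. r \<in> carrier R \<and> y \<in> span S}" (is "_ = ?L")
proof
  note sub = span_submodule[OF assms(2)]
  have sc: "span S \<subseteq> carrier M" by (rule submodule_subset[OF sub])
  have "submodule ?L R M"
  proof (rule submoduleI')
    show "?L \<subseteq> carrier M" using assms sc by auto
    show "\<zero>\<^bsub>M\<^esub> \<in> ?L"
      using assms submodule_zero[OF sub] by (force intro!: exI[of _ \<zero>] exI[of _ "\<zero>\<^bsub>M\<^esub>"])
  next
    fix x y assume "x \<in> ?L" "y \<in> ?L"
    then obtain r u s v where *: "r \<in> carrier R" "u \<in> span S" "x = r \<odot>\<^bsub>M\<^esub> a \<oplus>\<^bsub>M\<^esub> u"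
      "s \<in> carrier R" "v \<in> span S" "y = s \<odot>\<^bsub>M\<^esub> a \<oplus>\<^bsub>M\<^esub> v" by auto
    moreover have "u \<in> carrier M" "v \<in> carrier M" using * sc by auto
    ultimately have "x \<oplus>\<^bsub>M\<^esub> y = (r \<oplus> s) \<odot>\<^bsub>M\<^esub> a \<oplus>\<^bsub>M\<^esub> (u \<oplus>\<^bsub>M\<^esub> v)"
      using assms by (simp add: smult_l_distr M.a_ac)
    then show "x \<oplus>\<^bsub>M\<^esub> y \<in> ?L" using * submodule_add[OF sub] by blast
  next
    fix t x assume t: "t \<in> carrier R" and "x \<in> ?L"
    then obtain r u where *: "r \<in> carrier R" "u \<in> span S" "x = r \<odot>\<^bsub>M\<^esub> a \<oplus>\<^bsub>M\<^esub> u" by auto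
    moreover have "u \<in> carrier M" using * sc by auto
    ultimately have "t \<odot>\<^bsub>M\<^esub> x = (t \<otimes> r) \<odot>\<^bsub>M\<^esub> a \<oplus>\<^bsub>M\<^esub> t \<odot>\<^bsub>M\<^esub> u"
      using assms t by (simp add: smult_r_distr smult_assoc1)
    then show "t \<odot>\<^bsub>M\<^esub> x \<in> ?L" using * t submodule_smult[OF sub] by blast
  qed
  moreover have "insert a S \<subseteq> ?L"
  proof -
    have "a = \<one> \<odot>\<^bsub>M\<^esub> a \<oplus>\<^bsub>M\<^esub> \<zero>\<^bsub>M\<^esub>" using assms by simp
    then have "a \<in> ?L" using submodule_zero[OF sub] by blast
    moreover have "S \<subseteq> ?L"
    proof
      fix x assume "x \<in> S"
      then have "x = \<zero> \<odot>\<^bsub>M\<^esub> a \<oplus>\<^bsub>M\<^esub> x" "x \<in> span S" using assms span_superset by auto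
      then show "x \<in> ?L" by blast
    qed
    ultimately show ?thesis by simp
  qed
  ultimately show "span (insert a S) \<subseteq> ?L" by (rule span_minimal)
  have sub': "submodule (span (insert a S)) R M" using assms by (intro span_submodule) auto
  show "?L \<subseteq> span (insert a S)"
    using submodule_add[OF sub'] submodule_smult[OF sub'] span_superset[of "insert a S"]
      span_mono[of S "insert a S"] by blast
qed

lemma span_insert_coeff:
  assumes "a \<in> carrier M" "S \<subseteq> carrier M" "x \<in> span (insert a S)"
  obtains r y where "r \<in> carrier R" "y \<in> span S" "x = r \<odot>\<^bsub>M\<^esub> a \<oplus>\<^bsub>M\<^esub> y"
  using assms span_insert by auto

text \<open>The leading coefficients with respect to the last generator form an ideal; lifts of its
  generators, together with generators of the part without that coefficient, generate \<open>N\<close>.\<close>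

lemma noetherian_submodule_finite_span:
  assumes "noetherian_ring R" "finite S" "S \<subseteq> carrier M" "submodule N R M" "N \<subseteq> span S"
  shows "\<exists>B. finite B \<and> B \<subseteq> N \<and> N \<subseteq> span B"
  using assms(2-5)
proof (induction S arbitrary: N rule: finite_induct)
  case empty
  have "submodule {\<zero>\<^bsub>M\<^esub>} R M" by (intro submoduleI') auto
  then have "span {} \<subseteq> {\<zero>\<^bsub>M\<^esub>}" by (rule span_minimal) simp
  then have "N \<subseteq> span {}"
    using empty submodule_zero[OF span_submodule, of "{}"] by auto
  then show ?case by (intro exI[of _ "{}"]) auto
next
  case (insert a S)
  note N = \<open>submodule N R M\<close>
  have aS: "a \<in> carrier M" "S \<subseteq> carrier M" using insert.prems by auto
  note sub = span_submodule[OF aS(2)]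
  have Nc: "N \<subseteq> carrier M" by (rule submodule_subset[OF N])
  have sc: "span S \<subseteq> carrier M" by (rule submodule_subset[OF sub])
  \<comment> \<open>\<open>X\<close> stays variable because this ideal is used twice: for
    \<open>N\<close>, to get finitely many leading coefficients, and for \<open>span B1\<close>, to
    see that the lifts already realize all of them.\<close>
  define I where "I X = {r \<in> carrier R. \<exists>y \<in> span S. r \<odot>\<^bsub>M\<^esub> a \<oplus>\<^bsub>M\<^esub> y \<in> X}" for X
  have I: "ideal (I X) R" if X: "submodule X R M" for X
  proof (rule idealI[OF R.ring_axioms])
    have smult: "s \<otimes> r \<in> I X" if rs: "r \<in> I X" "s \<in> carrier R" for r s
    proof -
      obtain y where y: "r \<in> carrier R" "y \<in> span S" "r \<odot>\<^bsub>M\<^esub> a \<oplus>\<^bsub>M\<^esub> y \<in> X"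
        using rs by (auto simp: I_def)
      then have "(s \<otimes> r) \<odot>\<^bsub>M\<^esub> a \<oplus>\<^bsub>M\<^esub> s \<odot>\<^bsub>M\<^esub> y = s \<odot>\<^bsub>M\<^esub> (r \<odot>\<^bsub>M\<^esub> a \<oplus>\<^bsub>M\<^esub> y)"
        using aS sc rs(2) by (auto simp: smult_r_distr smult_assoc1 subset_iff)
      then have "(s \<otimes> r) \<odot>\<^bsub>M\<^esub> a \<oplus>\<^bsub>M\<^esub> s \<odot>\<^bsub>M\<^esub> y \<in> X"
        using y rs submodule_smult[OF X] by simp
      then show ?thesis
        using y rs submodule_smult[OF sub rs(2) y(2)] by (auto simp: I_def)
    qed
    then show "\<And>r s. \<lbrakk>r \<in> I X; s \<in> carrier R\<rbrakk> \<Longrightarrow> s \<otimes> r \<in> I X" .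
    show "r \<otimes> s \<in> I X" if "r \<in> I X" "s \<in> carrier R" for r s
      using smult[OF that] that R.m_comm[of r s] by (simp add: I_def)
    have add: "r \<oplus> s \<in> I X" if rs: "r \<in> I X" "s \<in> I X" for r s
    proof -
      obtain y z where y: "r \<in> carrier R" "y \<in> span S" "r \<odot>\<^bsub>M\<^esub> a \<oplus>\<^bsub>M\<^esub> y \<in> X"
        and z: "s \<in> carrier R" "z \<in> span S" "s \<odot>\<^bsub>M\<^esub> a \<oplus>\<^bsub>M\<^esub> z \<in> X"
        using rs by (auto simp: I_def)
      have "y \<in> carrier M" "z \<in> carrier M" using y z sc by auto
      then have "(r \<oplus> s) \<odot>\<^bsub>M\<^esub> a \<oplus>\<^bsub>M\<^esub> (y \<oplus>\<^bsub>M\<^esub> z) = (r \<odot>\<^bsub>M\<^esub> a \<oplus>\<^bsub>M\<^esub> y) \<oplus>\<^bsub>M\<^esub> (s \<odot>\<^bsub>M\<^esub> a \<oplus>\<^bsub>M\<^esub> z)"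
        using y z aS by (simp add: smult_l_distr M.a_ac)
      then have "(r \<oplus> s) \<odot>\<^bsub>M\<^esub> a \<oplus>\<^bsub>M\<^esub> (y \<oplus>\<^bsub>M\<^esub> z) \<in> X"
        using y z submodule_add[OF X] by simp
      then show ?thesis
        using y z submodule_add[OF sub y(2) z(2)] by (auto simp: I_def)
    qed
    have zero: "\<zero> \<in> I X"
      using aS submodule_zero[OF sub] submodule_zero[OF X]
        by (auto simp: I_def intro!: bexI[of _ "\<zero>\<^bsub>M\<^esub>"])
    have "\<ominus> r \<in> I X" if "r \<in> I X" for r
    proof -
      have "(\<ominus> \<one>) \<otimes> r = \<ominus> r" using that R.l_minus[of \<one> r] by (simp add: I_def)
      then show ?thesis using smult[OF that, of "\<ominus> \<one>"] by simp
    qed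
    then show "subgroup (I X) (add_monoid R)"
      using add zero by (intro R.add.subgroupI) (auto simp: I_def)
  qed
  obtain J where J: "J \<subseteq> carrier R" "finite J" "I N = Idl J"
    using noetherian_ring.finetely_gen[OF assms(1) I[OF N]] by blast
  have "\<forall>r\<in>J. \<exists>y. y \<in> span S \<and> r \<odot>\<^bsub>M\<^esub> a \<oplus>\<^bsub>M\<^esub> y \<in> N"
    using J R.genideal_self[OF J(1)] by (auto simp: I_def)
  then obtain y where y: "\<And>r. r \<in> J \<Longrightarrow> y r \<in> span S \<and> r \<odot>\<^bsub>M\<^esub> a \<oplus>\<^bsub>M\<^esub> y r \<in> N" by metis
  define B1 where "B1 = (\<lambda>r. r \<odot>\<^bsub>M\<^esub> a \<oplus>\<^bsub>M\<^esub> y r) ` J"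
  obtain B2 where B2: "finite B2" "B2 \<subseteq> N \<inter> span S" "N \<inter> span S \<subseteq> span B2"
    using insert.IH[OF aS(2) submodule_Int[OF N sub]] by auto
  have B1: "finite B1" "B1 \<subseteq> N" using J y by (auto simp: B1_def)
  have Bc: "B1 \<union> B2 \<subseteq> carrier M" "B1 \<subseteq> carrier M" using B1 B2 Nc by auto
  note subB = span_submodule[OF Bc(1)] and subB1 = span_submodule[OF Bc(2)]
  have "J \<subseteq> I (span B1)"
    using J y span_superset[of B1] unfolding I_def B1_def by blast
  then have IJ: "I N \<subseteq> I (span B1)"
    unfolding J(3) by (rule R.genideal_minimal[OF I[OF subB1]])
  have "N \<subseteq> span (B1 \<union> B2)"
  proof
    fix x assume x: "x \<in> N"
    then obtain r u where ru: "r \<in> carrier R" "u \<in> span S" "x = r \<odot>\<^bsub>M\<^esub> a \<oplus>\<^bsub>M\<^esub> u"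
      using span_insert_coeff[OF aS] insert.prems by blast
    then have "r \<in> I N" using x by (auto simp: I_def)
    then obtain v where v: "v \<in> span S" "r \<odot>\<^bsub>M\<^esub> a \<oplus>\<^bsub>M\<^esub> v \<in> span B1" using IJ by (auto simp: I_def)
    \<comment> \<open>\<open>?z\<close> has the leading coefficient of \<open>x\<close> and lies in
      \<open>span B1\<close>, so the difference loses the generator \<open>a\<close> and is covered
      by \<open>B2\<close>.\<close>
    let ?z = "r \<odot>\<^bsub>M\<^esub> a \<oplus>\<^bsub>M\<^esub> v"
    have c: "u \<in> carrier M" "v \<in> carrier M" "r \<odot>\<^bsub>M\<^esub> a \<in> carrier M" using ru v sc aS by auto
    have zN: "?z \<in> N" using v span_minimal[OF N B1(2)] by blast
    have eq: "x \<oplus>\<^bsub>M\<^esub> \<ominus>\<^bsub>M\<^esub> ?z = u \<oplus>\<^bsub>M\<^esub> \<ominus>\<^bsub>M\<^esub> v"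
    proof -
      have "x \<oplus>\<^bsub>M\<^esub> \<ominus>\<^bsub>M\<^esub> ?z = (r \<odot>\<^bsub>M\<^esub> a \<oplus>\<^bsub>M\<^esub> \<ominus>\<^bsub>M\<^esub> (r \<odot>\<^bsub>M\<^esub> a)) \<oplus>\<^bsub>M\<^esub> (u \<oplus>\<^bsub>M\<^esub> \<ominus>\<^bsub>M\<^esub> v)"
        using c ru by (simp add: M.minus_add M.a_ac)
      then show ?thesis using c by (simp add: M.r_neg)
    qed
    have "x \<oplus>\<^bsub>M\<^esub> \<ominus>\<^bsub>M\<^esub> ?z \<in> N \<inter> span S"
      using eq submodule_add[OF N x submodule_neg[OF N zN]]
        submodule_add[OF sub ru(2) submodule_neg[OF sub v(1)]] by simp
    then have d: "x \<oplus>\<^bsub>M\<^esub> \<ominus>\<^bsub>M\<^esub> ?z \<in> span (B1 \<union> B2)" using B2(3) span_mono[of B2 "B1 \<union> B2"] by blast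
    have "x = ?z \<oplus>\<^bsub>M\<^esub> (x \<oplus>\<^bsub>M\<^esub> \<ominus>\<^bsub>M\<^esub> ?z)"
      using c x Nc by (simp add: M.a_lcomm M.r_neg subset_iff)
    moreover have "?z \<in> span (B1 \<union> B2)" using v span_mono[of B1 "B1 \<union> B2"] by blast
    ultimately show "x \<in> span (B1 \<union> B2)" using submodule_add[OF subB _ d] by metis
  qed
  then show ?case using B1 B2 by (intro exI[of _ "B1 \<union> B2"]) auto
qed

end

section \<open>Linear maps, and finite generation along exact sequences\<close>

definition linear_map ::
  "('k, 'a) ring_scheme \<Rightarrow> ('k, 'm, 'b) module_scheme \<Rightarrow> ('k, 'n, 'c) module_scheme \<Rightarrow> ('m \<Rightarrow> 'n) \<Rightarrow> bool"
    where
  "linear_map R M N f \<longleftrightarrow> f \<in> carrier M \<rightarrow> carrier N \<and>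
     (\<forall>x\<in>carrier M. \<forall>y\<in>carrier M. f (x \<oplus>\<^bsub>M\<^esub> y) = f x \<oplus>\<^bsub>N\<^esub> f y) \<and>
     (\<forall>r\<in>carrier R. \<forall>x\<in>carrier M. f (r \<odot>\<^bsub>M\<^esub> x) = r \<odot>\<^bsub>N\<^esub> f x)"

lemma linear_map_zero:
  assumes "module R M" "module R N" "linear_map R M N f"
  shows "f \<zero>\<^bsub>M\<^esub> = \<zero>\<^bsub>N\<^esub>"
proof -
  interpret M: module R M by fact
  interpret N: module R N by fact
  have "f (\<zero>\<^bsub>R\<^esub> \<odot>\<^bsub>M\<^esub> \<zero>\<^bsub>M\<^esub>) = \<zero>\<^bsub>R\<^esub> \<odot>\<^bsub>N\<^esub> f \<zero>\<^bsub>M\<^esub>" "f \<zero>\<^bsub>M\<^esub> \<in> carrier N"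
    using assms(3) M.R.zero_closed M.M.zero_closed
      by (auto simp: linear_map_def simp del: M.smult_l_null M.smult_r_null)
  then show ?thesis by simp
qed

lemma linear_map_neg:
  assumes "module R M" "module R N" "linear_map R M N f" "x \<in> carrier M"
  shows "f (\<ominus>\<^bsub>M\<^esub> x) = \<ominus>\<^bsub>N\<^esub> f x"
proof -
  interpret M: module R M by fact
  interpret N: module R N by fact
  have c: "f x \<in> carrier N" "f (\<ominus>\<^bsub>M\<^esub> x) \<in> carrier N" using assms(3,4) by (auto simp: linear_map_def)
  have "f (\<ominus>\<^bsub>M\<^esub> x) \<oplus>\<^bsub>N\<^esub> f x = f (\<ominus>\<^bsub>M\<^esub> x \<oplus>\<^bsub>M\<^esub> x)"
    using assms(3,4) by (simp add: linear_map_def)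
  also have "\<dots> = \<zero>\<^bsub>N\<^esub>" using assms(4) linear_map_zero[OF assms(1-3)] by (simp add: M.M.l_neg)
  finally show ?thesis using c by (metis N.M.minus_equality)
qed

lemma linear_map_compose:
  assumes "linear_map R L M f" "linear_map R M N g"
  shows "linear_map R L N (\<lambda>x. g (f x))"
  using assms unfolding linear_map_def by (simp add: Pi_iff)

lemma linear_map_finsum:
  assumes "module R M" "module R N" "linear_map R M N f" "finite A" "g \<in> A \<rightarrow> carrier M"
  shows "f (\<Oplus>\<^bsub>M\<^esub>a\<in>A. g a) = (\<Oplus>\<^bsub>N\<^esub>a\<in>A. f (g a))"
  using assms(4,5)
proof (induction A)
  case empty
  interpret M: module R M by fact
  interpret N: module R N by fact
  show ?case using linear_map_zero[OF assms(1-3)] by simp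
next
  case (insert x A)
  interpret M: module R M by fact
  interpret N: module R N by fact
  have g: "g x \<in> carrier M" "g \<in> A \<rightarrow> carrier M" using insert.prems by auto
  then have "(\<lambda>a. f (g a)) \<in> A \<rightarrow> carrier N" "f (g x) \<in> carrier N" "(\<Oplus>\<^bsub>M\<^esub>a\<in>A. g a) \<in> carrier M"
    using assms(3) by (auto simp: linear_map_def)
  then show ?case
    using insert g assms(3) by (simp add: linear_map_def)
qed

lemma linear_map_vimage_submodule:
  assumes "module R M" "module R N" "linear_map R M N f" "submodule L R N"
  shows "submodule {x \<in> carrier M. f x \<in> L} R M"
proof -
  interpret M: module R M by fact
  interpret N: module R N by fact
  show ?thesis
    using assms(3,4) linear_map_zero[OF assms(1-3)]
    by (intro M.submoduleI') (auto simp: linear_map_def N.submodule_zero N.submodule_add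
      N.submodule_smult)
qed

lemma linear_map_image_submodule:
  assumes "module R M" "module R N" "linear_map R M N f"
  shows "submodule (f ` carrier M) R N"
proof -
  interpret M: module R M by fact
  interpret N: module R N by fact
  have f: "f x \<in> carrier N" "f (x \<oplus>\<^bsub>M\<^esub> y) = f x \<oplus>\<^bsub>N\<^esub> f y" "f (r \<odot>\<^bsub>M\<^esub> x) = r \<odot>\<^bsub>N\<^esub> f x"
    if "x \<in> carrier M" "y \<in> carrier M" "r \<in> carrier R" for x y r
    using assms(3) that by (auto simp: linear_map_def)
  have "\<zero>\<^bsub>N\<^esub> \<in> f ` carrier M"
    using linear_map_zero[OF assms] by (metis M.M.zero_closed image_eqI)
  moreover have "f ` carrier M \<subseteq> carrier N" using f by blast
  moreover have "f x \<oplus>\<^bsub>N\<^esub> f y \<in> f ` carrier M" if "x \<in> carrier M" "y \<in> carrier M" for x y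
    using f(2)[OF that M.R.one_closed] that by (metis M.M.a_closed image_eqI)
  moreover have "r \<odot>\<^bsub>N\<^esub> f x \<in> f ` carrier M" if "x \<in> carrier M" "r \<in> carrier R" for x r
    using f(3)[OF that(1) that(1) that(2)] that by (metis M.smult_closed image_eqI)
  ultimately show ?thesis by (intro N.submoduleI') auto
qed

text \<open>Here the Noetherian property acts: the image of \<open>g\<close> is a submodule of a
  finitely generated module. Lifts of its generators, with the images of generators of
  \<open>L\<close>, span \<open>M\<close>. The inclusion of the kernel in the image is what weak
  kernels of triangles supply.\<close>

lemma fg_module_exact:
  assumes "noetherian_ring R" "module R L" "module R M" "module R N"
    and f: "linear_map R L M f" and g: "linear_map R M N g"
    and exact: "\<And>y. \<lbrakk>y \<in> carrier M; g y = \<zero>\<^bsub>N\<^esub>\<rbrakk> \<Longrightarrow> y \<in> f ` carrier L"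
    and fg: "fg_module R L" "fg_module R N"
  shows "fg_module R M"
proof -
  interpret L: module R L by fact
  interpret M: module R M by fact
  interpret N: module R N by fact
  obtain A where A: "A \<subseteq> carrier L" "finite A" "carrier L \<subseteq> L.span A"
    using fg(1) L.fg_module_iff_span by auto
  obtain B where B: "B \<subseteq> carrier N" "finite B" "carrier N \<subseteq> N.span B"
    using fg(2) N.fg_module_iff_span by auto
  note im = linear_map_image_submodule[OF assms(3,4) g]
  obtain C where C: "finite C" "C \<subseteq> g ` carrier M" "g ` carrier M \<subseteq> N.span C"
    using N.noetherian_submodule_finite_span[OF assms(1) B(2,1) im] B(3) N.submodule_subset[OF im]
      by auto
  obtain D where D: "D \<subseteq> carrier M" "finite D" "C = g ` D"
    using C(1,2) by (metis finite_subset_image)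
  define S where "S = f ` A \<union> D"
  have S: "S \<subseteq> carrier M" "finite S" using A D f by (auto simp: S_def linear_map_def)
  note sub = M.span_submodule[OF S(1)]
  have "carrier L \<subseteq> {x \<in> carrier L. f x \<in> M.span S}"
    using A M.span_superset[of S]
    by (intro subset_trans[OF A(3)] L.span_minimal[OF linear_map_vimage_submodule[OF assms(2,3) f sub]])
      (auto simp: S_def)
  then have fS: "f x \<in> M.span S" if "x \<in> carrier L" for x using that by blast
  \<comment> \<open>\<open>g\<close> is restricted to the span, regarded as a module of its own, so
    that the image of the span is a submodule of \<open>N\<close> and hence contains
    \<open>N.span C\<close>.\<close>
  have gmap: "linear_map R (M\<lparr>carrier := M.span S\<rparr>) N g"
    using g M.submodule_subset[OF sub] unfolding linear_map_def by (simp add: Pi_iff subset_iff)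
  have "submodule (g ` M.span S) R N"
    using linear_map_image_submodule[OF submodule.submodule_is_module[OF sub assms(3)] assms(4) gmap]
      by simp
  then have "N.span C \<subseteq> g ` M.span S"
    using M.span_superset[of S] by (intro N.span_minimal) (auto simp: D(3) S_def)
  then have gS: "g x \<in> g ` M.span S" if "x \<in> carrier M" for x using C(3) that by blast
  have "carrier M \<subseteq> M.span S"
  proof
    fix x assume x: "x \<in> carrier M"
    then obtain y where y: "y \<in> M.span S" "g x = g y" using gS by blast
    have yc: "y \<in> carrier M" using y M.submodule_subset[OF sub] by blast
    have neg: "\<ominus>\<^bsub>M\<^esub> y = (\<ominus>\<^bsub>R\<^esub> \<one>\<^bsub>R\<^esub>) \<odot>\<^bsub>M\<^esub> y" using yc by (simp add: M.smult_l_minus)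
    have "g (x \<oplus>\<^bsub>M\<^esub> \<ominus>\<^bsub>M\<^esub> y) = g x \<oplus>\<^bsub>N\<^esub> (\<ominus>\<^bsub>R\<^esub> \<one>\<^bsub>R\<^esub>) \<odot>\<^bsub>N\<^esub> g y"
      using g x yc neg by (simp add: linear_map_def)
    also have "\<dots> = g y \<oplus>\<^bsub>N\<^esub> \<ominus>\<^bsub>N\<^esub> g y"
      using g yc y by (simp add: N.smult_l_minus linear_map_def Pi_iff)
    also have "\<dots> = \<zero>\<^bsub>N\<^esub>"
      using g yc by (intro N.M.r_neg) (auto simp: linear_map_def)
    finally have "x \<oplus>\<^bsub>M\<^esub> \<ominus>\<^bsub>M\<^esub> y \<in> M.span S"
      using exact[of "x \<oplus>\<^bsub>M\<^esub> \<ominus>\<^bsub>M\<^esub> y"] x yc fS by auto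
    then have "x \<oplus>\<^bsub>M\<^esub> \<ominus>\<^bsub>M\<^esub> y \<oplus>\<^bsub>M\<^esub> y \<in> M.span S" by (rule M.submodule_add[OF sub _ y(1)])
    then show "x \<in> M.span S" using x yc by (simp add: M.a_assoc M.M.l_neg)
  qed
  then show ?thesis using S M.fg_module_iff_span by blast
qed

lemma fg_module_surj:
  assumes "module R M" "module R N" "linear_map R M N f" "carrier N \<subseteq> f ` carrier M" "fg_module R M"
  shows "fg_module R N"
proof -
  interpret M: module R M by fact
  interpret N: module R N by fact
  obtain A where A: "A \<subseteq> carrier M" "finite A" "carrier M \<subseteq> M.span A"
    using assms(5) M.fg_module_iff_span by auto
  have fA: "f ` A \<subseteq> carrier N" "finite (f ` A)" using A assms(3) by (auto simp: linear_map_def)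
  have "M.span A \<subseteq> {x \<in> carrier M. f x \<in> N.span (f ` A)}"
    using A N.span_superset[of "f ` A"]
    by (intro M.span_minimal[OF linear_map_vimage_submodule[OF assms(1-3) N.span_submodule[OF fA(1)]]])
      auto
  then have "carrier N \<subseteq> N.span (f ` A)" using A assms(4) by blast
  then show ?thesis using fA N.fg_module_iff_span by blast
qed

subsection \<open>Linear categories\<close>

text \<open>Morphisms do not determine their source and target, as hom sets need not be disjoint, so
  every map is carried along with both objects. Bundling their membership in \<open>Obj T\<close>
  lets such facts be chained by \<open>OF\<close>.\<close>

definition (in linear_category) arr :: "'m \<Rightarrow> 'o \<Rightarrow> 'o \<Rightarrow> bool" where
  "arr f X Y \<longleftrightarrow> X \<in> Obj T \<and> Y \<in> Obj T \<and> f \<in> mor T X Y"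

text \<open>Since \<open>arr\<close> includes membership in \<open>Obj T\<close>, this holds
  vacuously as soon as \<open>X\<close> or \<open>Y\<close> is not an object; the conversion to an
  equation of hom sets therefore asks for both memberships.\<close>

definition (in linear_category) hom_zero :: "'o \<Rightarrow> 'o \<Rightarrow> bool" where
  "hom_zero X Y \<longleftrightarrow> (\<forall>f. arr f X Y \<longrightarrow> f = \<zero>\<^bsub>Hom T X Y\<^esub>)"

context linear_category
begin

abbreviation zr :: "'o \<Rightarrow> 'o \<Rightarrow> 'm" where "zr X Y \<equiv> \<zero>\<^bsub>Hom T X Y\<^esub>"

lemma arr_Obj [dest]: "arr f X Y \<Longrightarrow> X \<in> Obj T" "arr f X Y \<Longrightarrow> Y \<in> Obj T"
  by (auto simp: arr_def)

lemma arr_mor [dest]: "arr f X Y \<Longrightarrow> f \<in> mor T X Y"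
  by (auto simp: arr_def)

lemma arr_id [intro]: "X \<in> Obj T \<Longrightarrow> arr (Ident T X) X X"
  by (simp add: arr_def Ident_closed)

lemma arr_comp [intro]: "\<lbrakk>arr f X Y; arr g Y Z\<rbrakk> \<Longrightarrow> arr (g \<bullet> f) X Z"
  unfolding arr_def using Comp_closed by blast

lemma comp_id_left: "arr f X Y \<Longrightarrow> Ident T Y \<bullet> f = f"
  and comp_id_right: "arr f X Y \<Longrightarrow> f \<bullet> Ident T X = f"
  by (auto simp: arr_def intro: Ident_left Ident_right)

lemma comp_assoc: "\<lbrakk>arr f W X; arr g X Y; arr h Y Z\<rbrakk> \<Longrightarrow> (h \<bullet> g) \<bullet> f = h \<bullet> (g \<bullet> f)"
  unfolding arr_def using Comp_assoc by blast

lemma Hom_abelian_group: "\<lbrakk>X \<in> Obj T; Y \<in> Obj T\<rbrakk> \<Longrightarrow> abelian_group (Hom T X Y)"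
  using Hom_module unfolding module_def by blast

lemma arr_zero [intro]: "\<lbrakk>X \<in> Obj T; Y \<in> Obj T\<rbrakk> \<Longrightarrow> arr (zr X Y) X Y"
  using abelian_groupE(2)[OF Hom_abelian_group] by (simp add: arr_def)

lemma arr_neg [intro]: "arr f X Y \<Longrightarrow> arr (\<ominus>\<^bsub>Hom T X Y\<^esub> f) X Y"
  using abelian_group.a_inv_closed[OF Hom_abelian_group] by (auto simp: arr_def)

lemma arr_minus [intro]: "\<lbrakk>arr f X Y; arr g X Y\<rbrakk> \<Longrightarrow> arr (f \<ominus>\<^bsub>Hom T X Y\<^esub> g) X Y"
  using abelian_group.minus_closed[OF Hom_abelian_group] by (auto simp: arr_def)

lemma comp_add_left:
  "\<lbrakk>arr f X Y; arr g Y Z; arr h Y Z\<rbrakk> \<Longrightarrow>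
    (g \<oplus>\<^bsub>Hom T Y Z\<^esub> h) \<bullet> f = (g \<bullet> f) \<oplus>\<^bsub>Hom T X Z\<^esub> (h \<bullet> f)"
  unfolding arr_def using Comp_add_left by blast

lemma comp_add_right:
  "\<lbrakk>arr f X Y; arr g X Y; arr h Y Z\<rbrakk> \<Longrightarrow>
    h \<bullet> (f \<oplus>\<^bsub>Hom T X Y\<^esub> g) = (h \<bullet> f) \<oplus>\<^bsub>Hom T X Z\<^esub> (h \<bullet> g)"
  unfolding arr_def using Comp_add_right by blast

lemma comp_linear_map:
  assumes "arr g Y Z" "X \<in> Obj T"
  shows "linear_map k (Hom T X Y) (Hom T X Z) (\<lambda>f. g \<bullet> f)"
  using assms unfolding linear_map_def arr_def
  by (auto simp: Comp_add_right Comp_smult_right intro: Comp_closed)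

lemma precomp_linear_map:
  assumes "arr f X Y" "Z \<in> Obj T"
  shows "linear_map k (Hom T Y Z) (Hom T X Z) (\<lambda>g. g \<bullet> f)"
  using assms unfolding linear_map_def arr_def
  by (auto simp: Comp_add_left Comp_smult_left intro: Comp_closed)

lemma comp_zero_right: "\<lbrakk>arr g Y Z; X \<in> Obj T\<rbrakk> \<Longrightarrow> g \<bullet> zr X Y = zr X Z"
  using linear_map_zero[OF _ _ comp_linear_map] Hom_module by (auto simp: arr_def)

lemma comp_zero_left: "\<lbrakk>arr f X Y; Z \<in> Obj T\<rbrakk> \<Longrightarrow> zr Y Z \<bullet> f = zr X Z"
  using linear_map_zero[OF _ _ precomp_linear_map] Hom_module by (auto simp: arr_def)

lemma comp_neg_right: "\<lbrakk>arr f X Y; arr g Y Z\<rbrakk> \<Longrightarrow> g \<bullet> (\<ominus>\<^bsub>Hom T X Y\<^esub> f) = \<ominus>\<^bsub>Hom T X Z\<^esub> (g \<bullet> f)"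
  using linear_map_neg[OF _ _ comp_linear_map] Hom_module by (auto simp: arr_def)

lemma comp_neg_left: "\<lbrakk>arr f X Y; arr g Y Z\<rbrakk> \<Longrightarrow> (\<ominus>\<^bsub>Hom T Y Z\<^esub> g) \<bullet> f = \<ominus>\<^bsub>Hom T X Z\<^esub> (g \<bullet> f)"
  using linear_map_neg[OF _ _ precomp_linear_map] Hom_module by (auto simp: arr_def)

lemma comp_minus_right:
  "\<lbrakk>arr f X Y; arr g X Y; arr h Y Z\<rbrakk> \<Longrightarrow>
    h \<bullet> (f \<ominus>\<^bsub>Hom T X Y\<^esub> g) = (h \<bullet> f) \<ominus>\<^bsub>Hom T X Z\<^esub> (h \<bullet> g)"
  by (simp add: a_minus_def comp_add_right[OF _ arr_neg] comp_neg_right)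

lemma comp_minus_left:
  "\<lbrakk>arr f X Y; arr g Y Z; arr h Y Z\<rbrakk> \<Longrightarrow>
    (g \<ominus>\<^bsub>Hom T Y Z\<^esub> h) \<bullet> f = (g \<bullet> f) \<ominus>\<^bsub>Hom T X Z\<^esub> (h \<bullet> f)"
  by (simp add: a_minus_def comp_add_left[OF _ _ arr_neg] comp_neg_left)

lemma minus_eq_zero_iff:
  assumes "arr f X Y" "arr g X Y"
  shows "f \<ominus>\<^bsub>Hom T X Y\<^esub> g = zr X Y \<longleftrightarrow> f = g"
proof -
  interpret abelian_group "Hom T X Y" using assms by (intro Hom_abelian_group) auto
  have "f \<in> mor T X Y" "g \<in> mor T X Y" using assms by auto
  then show ?thesis by (metis a_minus_def add.inv_solve_right' l_zero zero_closed)
qed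

lemma minus_zero_right: "arr f X Y \<Longrightarrow> f \<ominus>\<^bsub>Hom T X Y\<^esub> zr X Y = f"
proof -
  assume f: "arr f X Y"
  interpret abelian_group "Hom T X Y" using f by (intro Hom_abelian_group) auto
  show ?thesis using f by (auto simp: a_minus_def dest!: arr_mor)
qed

lemma neg_eq_zero_iff:
  assumes "arr f X Y"
  shows "\<ominus>\<^bsub>Hom T X Y\<^esub> f = zr X Y \<longleftrightarrow> f = zr X Y"
proof -
  interpret abelian_group "Hom T X Y" using assms by (intro Hom_abelian_group) auto
  show ?thesis using assms by (metis arr_mor add.inv_eq_1_iff)
qed

lemma neg_neg: "arr f X Y \<Longrightarrow> \<ominus>\<^bsub>Hom T X Y\<^esub> (\<ominus>\<^bsub>Hom T X Y\<^esub> f) = f"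
  using abelian_group.minus_minus[OF Hom_abelian_group] by (auto simp: arr_def)

lemma hom_zeroD: "\<lbrakk>hom_zero X Y; arr f X Y\<rbrakk> \<Longrightarrow> f = zr X Y"
  by (auto simp: hom_zero_def)

lemma hom_zero_iff:
  "\<lbrakk>X \<in> Obj T; Y \<in> Obj T\<rbrakk> \<Longrightarrow> hom_zero X Y \<longleftrightarrow> mor T X Y = {zr X Y}"
  using arr_zero[of X Y] by (auto simp: hom_zero_def arr_def)

text \<open>If all endomorphisms of \<open>Z\<close> vanish, its identity is zero, and every map
  into or out of \<open>Z\<close> is its own composite with that identity.\<close>

lemma is_zero_object_iff:
  "is_zero_object T Z \<longleftrightarrow> Z \<in> Obj T \<and> hom_zero Z Z"
proof
  assume "is_zero_object T Z"
  then show "Z \<in> Obj T \<and> hom_zero Z Z"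
    using arr_zero[of Z Z] by (auto simp: is_zero_object_def hom_zero_def arr_def)
next
  assume Z: "Z \<in> Obj T \<and> hom_zero Z Z"
  then have id: "Ident T Z = zr Z Z" by (auto intro: hom_zeroD)
  have "f = zr Z X" if "X \<in> Obj T" "f \<in> mor T Z X" for f X
    using that Z comp_id_right[of f Z X] comp_zero_right[of f Z X Z] by (simp add: id arr_def)
  moreover have "f = zr X Z" if "X \<in> Obj T" "f \<in> mor T X Z" for f X
    using that Z comp_id_left[of f X Z] comp_zero_left[of f X Z Z] by (simp add: id arr_def)
  ultimately show "is_zero_object T Z"
    using Z arr_zero[of Z] arr_zero[of _ Z] unfolding is_zero_object_def arr_def by metis
qed

lemma zero_object_hom_zero:
  assumes "is_zero_object T Z" "X \<in> Obj T"
  shows "hom_zero Z X" "hom_zero X Z"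
  using assms arr_zero[of Z X] arr_zero[of X Z]
  by (auto simp: is_zero_object_def hom_zero_def arr_def)

text \<open>Unlike for \<open>summand\<close>, no complement is part of the data. Retracts come
  directly from triangles with a vanishing map, and they suffice for inheriting
  orthogonality.\<close>

definition retract :: "'o \<Rightarrow> 'o \<Rightarrow> bool" where
  "retract A X \<longleftrightarrow> (\<exists>i p. arr i A X \<and> arr p X A \<and> p \<bullet> i = Ident T A)"

lemma retract_hom_zero:
  assumes "retract A X"
  shows "hom_zero W X \<Longrightarrow> hom_zero W A" "hom_zero X W \<Longrightarrow> hom_zero A W"
proof -
  obtain i p where ip: "arr i A X" "arr p X A" "p \<bullet> i = Ident T A"
    using assms by (auto simp: retract_def)
  { assume "hom_zero W X"
    show "hom_zero W A" unfolding hom_zero_def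
    proof (intro allI impI)
      fix f assume f: "arr f W A"
      then have "i \<bullet> f = zr W X" using \<open>hom_zero W X\<close> ip by (auto intro: hom_zeroD)
      then have "p \<bullet> (i \<bullet> f) = zr W A" using f ip by (auto simp: comp_zero_right)
      then show "f = zr W A" using f ip comp_assoc[OF f ip(1,2)] by (simp add: comp_id_left)
    qed }
  { assume "hom_zero X W"
    show "hom_zero A W" unfolding hom_zero_def
    proof (intro allI impI)
      fix f assume f: "arr f A W"
      then have "f \<bullet> p = zr X W" using \<open>hom_zero X W\<close> ip by (auto intro: hom_zeroD)
      then have "(f \<bullet> p) \<bullet> i = zr A W" using f ip by (auto simp: comp_zero_left)
      then show "f = zr A W" using f ip comp_assoc[OF ip(1,2) f] by (simp add: comp_id_right)
    qed }
qed

lemma coproduct_arr: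
  "\<lbrakk>is_coproduct T I F C \<iota>; i \<in> I\<rbrakk> \<Longrightarrow> arr (\<iota> i) (F i) C"
  by (auto simp: is_coproduct_def arr_def)

lemma coproduct_Obj: "is_coproduct T I F C \<iota> \<Longrightarrow> C \<in> Obj T"
  by (auto simp: is_coproduct_def)

lemma coproduct_copair:
  assumes "is_coproduct T I F C \<iota>" "Y \<in> Obj T" "\<And>i. i \<in> I \<Longrightarrow> arr (f i) (F i) Y"
  obtains h where "arr h C Y" "\<And>i. i \<in> I \<Longrightarrow> h \<bullet> \<iota> i = f i"
proof -
  have "\<exists>!h. h \<in> mor T C Y \<and> (\<forall>i\<in>I. h \<bullet> \<iota> i = f i)"
    using assms unfolding is_coproduct_def arr_def by blast
  then show ?thesis using that coproduct_Obj[OF assms(1)] assms(2) unfolding arr_def by metis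
qed

lemma coproduct_eqI:
  assumes "is_coproduct T I F C \<iota>" "arr g C Y" "arr h C Y" "\<And>i. i \<in> I \<Longrightarrow> g \<bullet> \<iota> i = h \<bullet> \<iota> i"
  shows "g = h"
proof -
  have univ: "\<forall>Y\<in>Obj T. \<forall>f. (\<forall>i\<in>I. f i \<in> mor T (F i) Y) \<longrightarrow>
      (\<exists>!u. u \<in> mor T C Y \<and> (\<forall>i\<in>I. u \<bullet> \<iota> i = f i))"
    using assms(1) by (simp add: is_coproduct_def)
  have "\<forall>i\<in>I. h \<bullet> \<iota> i \<in> mor T (F i) Y"
    using arr_comp[OF coproduct_arr[OF assms(1)] assms(3)] by (simp add: arr_def)
  then have "\<exists>!u. u \<in> mor T C Y \<and> (\<forall>i\<in>I. u \<bullet> \<iota> i = h \<bullet> \<iota> i)"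
    using univ assms(2) by (simp add: arr_def)
  moreover have "g \<in> mor T C Y \<and> (\<forall>i\<in>I. g \<bullet> \<iota> i = h \<bullet> \<iota> i)"
    "h \<in> mor T C Y \<and> (\<forall>i\<in>I. h \<bullet> \<iota> i = h \<bullet> \<iota> i)"
    using assms(2-4) by (simp_all add: arr_def)
  ultimately show ?thesis by blast
qed

lemma coproduct_hom_zero:
  assumes "is_coproduct T I F C \<iota>" "Y \<in> Obj T" "\<And>i. i \<in> I \<Longrightarrow> hom_zero (F i) Y"
  shows "hom_zero C Y"
  unfolding hom_zero_def
proof (intro allI impI)
  fix f assume f: "arr f C Y"
  show "f = zr C Y"
  proof (rule coproduct_eqI[OF assms(1) f])
    show "arr (zr C Y) C Y" using f by auto
    fix i assume i: "i \<in> I"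
    note a = coproduct_arr[OF assms(1) i]
    show "f \<bullet> \<iota> i = zr C Y \<bullet> \<iota> i"
      using hom_zeroD[OF assms(3)[OF i] arr_comp[OF a f]] comp_zero_left[OF a assms(2)] by simp
  qed
qed

lemma coproduct_projection:
  assumes "is_coproduct T I F C \<iota>" "j \<in> I"
  obtains p where "arr p C (F j)" "p \<bullet> \<iota> j = Ident T (F j)"
    "\<And>i. \<lbrakk>i \<in> I; i \<noteq> j\<rbrakk> \<Longrightarrow> p \<bullet> \<iota> i = zr (F i) (F j)"
proof (rule coproduct_copair[OF assms(1)])
  let ?f = "\<lambda>i. if i = j then Ident T (F j) else zr (F i) (F j)"
  have F: "F i \<in> Obj T" if "i \<in> I" for i using coproduct_arr[OF assms(1) that] by auto
  then show "F j \<in> Obj T" using assms(2) .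
  show "arr (?f i) (F i) (F j)" if "i \<in> I" for i
    using F that assms(2) by (auto intro: arr_id arr_zero)
  fix p assume p: "arr p C (F j)" "\<And>i. i \<in> I \<Longrightarrow> p \<bullet> \<iota> i = ?f i"
  show thesis using that[OF p(1)] p(2) assms(2) by simp
qed

lemma summand_retract:
  assumes "summand T A X"
  shows "retract A X"
proof -
  obtain B \<iota> where c: "is_coproduct T (UNIV :: bool set) (\<lambda>b. if b then A else B) X \<iota>"
    using assms by (auto simp: summand_def is_binary_coproduct_def)
  obtain p where "arr p X A" "p \<bullet> \<iota> True = Ident T A"
    using coproduct_projection[OF c, of True] by auto
  then show ?thesis using coproduct_arr[OF c, of True] by (auto simp: retract_def)
qed

lemma is_isoI:
  "\<lbrakk>arr f X Y; arr g Y X; g \<bullet> f = Ident T X; f \<bullet> g = Ident T Y\<rbrakk> \<Longrightarrow> is_iso T X Y f"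
  by (auto simp: is_iso_def arr_def)

text \<open>Coproducts are provided for index sets in the type of \<open>\<kappa>\<close>, whereas
  sequences are indexed by the natural numbers; this carries the one to the other.\<close>

lemma coproduct_reindex:
  assumes "bij_betw b J I" "is_coproduct T I F C \<iota>"
  shows "is_coproduct T J (\<lambda>j. F (b j)) C (\<lambda>j. \<iota> (b j))"
proof -
  have bI: "b j \<in> I" if "j \<in> J" for j using assms(1) that by (auto simp: bij_betw_def)
  define b' where "b' = inv_into J b"
  have b': "b' i \<in> J" "b (b' i) = i" if "i \<in> I" for i
    using assms(1) that by (auto simp: bij_betw_def b'_def inv_into_into f_inv_into_f)
  have bb: "b' (b j) = j" if "j \<in> J" for j
    using assms(1) that by (auto simp: bij_betw_def b'_def)
  have ex: "\<exists>!h. h \<in> mor T C Y \<and> (\<forall>j\<in>J. h \<bullet> \<iota> (b j) = f j)"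
    if Y: "Y \<in> Obj T" and f: "\<forall>j\<in>J. f j \<in> mor T (F (b j)) Y" for Y f
  proof -
    have "\<forall>i\<in>I. f (b' i) \<in> mor T (F i) Y" using f b' by metis
    then have "\<exists>!h. h \<in> mor T C Y \<and> (\<forall>i\<in>I. h \<bullet> \<iota> i = f (b' i))"
      using assms(2) Y by (simp add: is_coproduct_def)
    moreover have "(\<forall>i\<in>I. h \<bullet> \<iota> i = f (b' i)) \<longleftrightarrow> (\<forall>j\<in>J. h \<bullet> \<iota> (b j) = f j)" for h
      using bI b' bb by metis
    ultimately show ?thesis by simp
  qed
  then show ?thesis
    using assms(2) bI unfolding is_coproduct_def by simp
qed

end

subsection \<open>Triangulated categories\<close>

context linear_triangulated_category
begin

lemma Shift_Obj [intro, simp]: "X \<in> Obj T \<Longrightarrow> Shift T X \<in> Obj T"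
  using Shift_bij by (auto simp: bij_betw_def)

lemma Shift_surj:
  assumes "X \<in> Obj T"
  obtains Y where "Y \<in> Obj T" "X = Shift T Y"
  using assms Shift_bij by (auto simp: bij_betw_def)

lemma Shift_inj: "\<lbrakk>X \<in> Obj T; Y \<in> Obj T; Shift T X = Shift T Y\<rbrakk> \<Longrightarrow> X = Y"
  using Shift_bij by (auto simp: bij_betw_def inj_on_def)

lemma arr_shift [intro]: "arr f X Y \<Longrightarrow> arr (ShiftM T f) (Shift T X) (Shift T Y)"
  using ShiftM_bij[of X Y] by (auto simp: arr_def bij_betw_def)

lemma ShiftM_surj:
  assumes "arr g (Shift T X) (Shift T Y)" "X \<in> Obj T" "Y \<in> Obj T"
  obtains f where "arr f X Y" "g = ShiftM T f"
proof -
  have "g \<in> ShiftM T ` mor T X Y" using ShiftM_bij[OF assms(2,3)] assms(1) by (auto simp: bij_betw_def)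
  then show ?thesis using that assms by (auto simp: arr_def)
qed

lemma ShiftM_inj: "\<lbrakk>arr f X Y; arr g X Y; ShiftM T f = ShiftM T g\<rbrakk> \<Longrightarrow> f = g"
  using ShiftM_bij[of X Y] by (auto simp: arr_def bij_betw_def inj_on_def)

lemma ShiftM_comp: "\<lbrakk>arr f X Y; arr g Y Z\<rbrakk> \<Longrightarrow> ShiftM T (g \<bullet> f) = ShiftM T g \<bullet> ShiftM T f"
  unfolding arr_def using ShiftM_Comp by blast

lemma ShiftM_linear_map:
  assumes "X \<in> Obj T" "Y \<in> Obj T"
  shows "linear_map k (Hom T X Y) (Hom T (Shift T X) (Shift T Y)) (ShiftM T)"
  using assms ShiftM_bij[OF assms]
  by (auto simp: linear_map_def ShiftM_add ShiftM_smult bij_betw_def)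

lemma ShiftM_zero:
  assumes "X \<in> Obj T" "Y \<in> Obj T"
  shows "ShiftM T (zr X Y) = zr (Shift T X) (Shift T Y)"
  using linear_map_zero[OF _ _ ShiftM_linear_map] Hom_module assms by auto

lemma ShiftM_neg:
  assumes "arr f X Y"
  shows "ShiftM T (\<ominus>\<^bsub>Hom T X Y\<^esub> f) = \<ominus>\<^bsub>Hom T (Shift T X) (Shift T Y)\<^esub> ShiftM T f"
  using linear_map_neg[OF _ _ ShiftM_linear_map] Hom_module assms by (auto simp: arr_def)

lemma ShiftM_minus:
  assumes "arr f X Y" "arr g X Y"
  shows "ShiftM T (f \<ominus>\<^bsub>Hom T X Y\<^esub> g) = ShiftM T f \<ominus>\<^bsub>Hom T (Shift T X) (Shift T Y)\<^esub> ShiftM T g"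
  using assms ShiftM_add[of X Y f "\<ominus>\<^bsub>Hom T X Y\<^esub> g"] arr_neg[OF assms(2)] ShiftM_neg[OF assms(2)]
  by (simp add: a_minus_def arr_def)

lemma hom_zero_shift_iff:
  assumes "X \<in> Obj T" "Y \<in> Obj T"
  shows "hom_zero (Shift T X) (Shift T Y) \<longleftrightarrow> hom_zero X Y"
proof
  assume *: "hom_zero (Shift T X) (Shift T Y)"
  show "hom_zero X Y" unfolding hom_zero_def
  proof (intro allI impI)
    fix f assume f: "arr f X Y"
    then have "ShiftM T f = ShiftM T (zr X Y)"
      using hom_zeroD[OF * arr_shift[OF f]] assms by (simp add: ShiftM_zero)
    then show "f = zr X Y" using ShiftM_inj[OF f arr_zero] assms by blast
  qed
next
  assume *: "hom_zero X Y"
  show "hom_zero (Shift T X) (Shift T Y)" unfolding hom_zero_def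
  proof (intro allI impI)
    fix g assume "arr g (Shift T X) (Shift T Y)"
    then obtain f where "arr f X Y" "g = ShiftM T f" using assms by (rule ShiftM_surj)
    moreover from this have "f = zr X Y" using hom_zeroD[OF *] by blast
    ultimately show "g = zr (Shift T X) (Shift T Y)" using ShiftM_zero assms by simp
  qed
qed

section \<open>Triangles and the exactness of Hom\<close>

lemma Tri_arr:
  assumes "Tri T X Y Z f g h"
  shows "arr f X Y" "arr g Y Z" "arr h Z (Shift T X)"
  using Tri_closed[OF assms] by (auto simp: arr_def)

lemma Tri_rotate:
  assumes "Tri T X Y Z f g h"
  shows "Tri T Y Z (Shift T X) g h (\<ominus>\<^bsub>Hom T (Shift T X) (Shift T Y)\<^esub> ShiftM T f)"
  using TR2[of X Y Z f g h] Tri_closed[OF assms] assms by blast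

text \<open>The shift is bijective on objects and maps, so the negative of \<open>l\<close> has a
  preimage \<open>u\<close>, which absorbs the sign in \<open>TR2\<close>. This is how fibres are
  obtained from cones.\<close>

lemma Tri_unrotate:
  assumes "Tri T Y Z X g h l" "X' \<in> Obj T" "X = Shift T X'"
  obtains u where "Tri T X' Y Z u g h" "l = \<ominus>\<^bsub>Hom T (Shift T X') (Shift T Y)\<^esub> ShiftM T u"
proof -
  note a = Tri_arr[OF assms(1)]
  have Y: "Y \<in> Obj T" using a by auto
  have l: "arr l (Shift T X') (Shift T Y)" using a assms by simp
  obtain u where u: "arr u X' Y" "\<ominus>\<^bsub>Hom T (Shift T X') (Shift T Y)\<^esub> l = ShiftM T u"
    using ShiftM_surj[OF arr_neg[OF l] assms(2) Y] by blast
  have l_eq: "l = \<ominus>\<^bsub>Hom T (Shift T X') (Shift T Y)\<^esub> ShiftM T u"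
    using u(2) neg_neg[OF l] by simp
  then have "Tri T X' Y Z u g h"
    using TR2[of X' Y Z u g h] a u assms unfolding arr_def by simp
  then show ?thesis using that l_eq by blast
qed

text \<open>The identity of \<open>X\<close> and \<open>f\<close> map the triangle
  \<open>X = X -> 0\<close> to the given one, so \<open>g \<bullet> f\<close> factors through a zero
  object.\<close>

lemma Tri_comp_zero:
  assumes "Tri T X Y Z f g h"
  shows "g \<bullet> f = zr X Z"
proof -
  note a = Tri_arr[OF assms]
  obtain O' where O': "is_zero_object T O'" using zero_object by blast
  have obj: "X \<in> Obj T" "O' \<in> Obj T" using a O' by (auto simp: is_zero_object_def)
  obtain w where "w \<in> mor T O' Z" "w \<bullet> zr X O' = g \<bullet> f"
    using TR3[OF TR1_Ident[OF obj(1) O'] assms, of "Ident T X" f] a(1) arr_id[OF obj(1)]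
    by (auto simp: arr_def)
  then show ?thesis using comp_zero_right[of w O' Z X] obj a by (auto simp: arr_def)
qed

lemma Tri_comp_zero':
  assumes "Tri T X Y Z f g h"
  shows "h \<bullet> g = zr Y (Shift T X)" "ShiftM T f \<bullet> h = zr Z (Shift T Y)"
proof -
  note a = Tri_arr[OF assms] and r = Tri_rotate[OF assms]
  show "h \<bullet> g = zr Y (Shift T X)" by (rule Tri_comp_zero[OF r])
  have "\<ominus>\<^bsub>Hom T Z (Shift T Y)\<^esub> (ShiftM T f \<bullet> h) = zr Z (Shift T Y)"
    using Tri_comp_zero[OF Tri_rotate[OF r]] comp_neg_left[OF a(3) arr_shift[OF a(1)]] by simp
  then show "ShiftM T f \<bullet> h = zr Z (Shift T Y)"
    using neg_eq_zero_iff[OF arr_comp[OF a(3) arr_shift[OF a(1)]]] by simp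
qed

text \<open>A map \<open>u\<close> that kills \<open>f\<close> gives a commutative square into the
  triangle \<open>0 -> W = W\<close>, the unrotation of \<open>W = W -> 0\<close>; completing it by
  \<open>TR3\<close> gives the factorization.\<close>

lemma weak_cokernel:
  assumes t: "Tri T X Y Z f g h" and u: "arr u Y W" "u \<bullet> f = zr X W"
  obtains v where "arr v Z W" "v \<bullet> g = u"
proof -
  note a = Tri_arr[OF t]
  obtain O' where O': "is_zero_object T O'" using zero_object by blast
  have obj: "X \<in> Obj T" "W \<in> Obj T" "Z \<in> Obj T" "O' \<in> Obj T" using a u O'
      by (auto simp: is_zero_object_def)
  obtain P where P: "P \<in> Obj T" "O' = Shift T P" using Shift_surj[OF obj(4)] .
  obtain q where q: "Tri T P W W q (Ident T W) (zr W O')"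
    using Tri_unrotate[OF TR1_Ident[OF obj(2) O'] P] by blast
  have "hom_zero P P"
    using O' P hom_zero_shift_iff by (simp add: is_zero_object_iff)
  then have "is_zero_object T P" using P by (simp add: is_zero_object_iff)
  then have q0: "q = zr P W" using zero_object_hom_zero hom_zeroD Tri_arr(1)[OF q] obj by blast
  have "u \<bullet> f = q \<bullet> zr X P"
    using u q0 comp_zero_right[OF Tri_arr(1)[OF q] obj(1)] by simp
  then obtain v where "v \<in> mor T Z W" "v \<bullet> g = Ident T W \<bullet> u"
    using TR3[OF t q, of "zr X P" u] u(1) arr_zero[OF obj(1) P(1)] by (auto dest: arr_mor)
  then show ?thesis using that obj u comp_id_left[OF u(1)] by (auto simp: arr_def)
qed

text \<open>\<open>TR3\<close> completes only on the right, so the square is placed one step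
  further: the rotated triangle \<open>W -> 0 -> \<Sigma>W\<close> is mapped to the rotation of the
  given one. The two signs cancel, and the shift is undone at the end.\<close>

lemma weak_kernel:
  assumes t: "Tri T X Y Z f g h" and u: "arr u W Y" "g \<bullet> u = zr W Z"
  obtains v where "arr v W X" "f \<bullet> v = u"
proof -
  note a = Tri_arr[OF t]
  obtain O' where O': "is_zero_object T O'" using zero_object by blast
  have obj: "X \<in> Obj T" "W \<in> Obj T" "Z \<in> Obj T" "Y \<in> Obj T" "O' \<in> Obj T"
    using a u O' by (auto simp: is_zero_object_def)
  have t': "Tri T Y Z (Shift T X) g h (\<ominus>\<^bsub>Hom T (Shift T X) (Shift T Y)\<^esub> ShiftM T f)"
    by (rule Tri_rotate[OF t])
  have s: "Tri T W O' (Shift T W) (zr W O') (zr O' (Shift T W))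
      (\<ominus>\<^bsub>Hom T (Shift T W) (Shift T W)\<^esub> ShiftM T (Ident T W))"
    by (rule Tri_rotate[OF TR1_Ident[OF obj(2) O']])
  have "zr O' Z \<bullet> zr W O' = g \<bullet> u"
    using u comp_zero_left[OF arr_zero[OF obj(2,5)] obj(3)] by simp
  then obtain w where w: "w \<in> mor T (Shift T W) (Shift T X)"
    "ShiftM T u \<bullet> (\<ominus>\<^bsub>Hom T (Shift T W) (Shift T W)\<^esub> ShiftM T (Ident T W))
      = (\<ominus>\<^bsub>Hom T (Shift T X) (Shift T Y)\<^esub> ShiftM T f) \<bullet> w"
    using TR3[OF s t', of u "zr O' Z"] u(1) arr_zero[OF obj(5,3)] by (auto dest: arr_mor)
  have "arr w (Shift T W) (Shift T X)" using w obj by (simp add: arr_def)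
  then obtain v where v: "arr v W X" "w = ShiftM T v" using obj by (elim ShiftM_surj)
  note su = arr_shift[OF u(1)] and sfv = arr_shift[OF arr_comp[OF v(1) a(1)]]
  have "\<ominus>\<^bsub>Hom T (Shift T W) (Shift T Y)\<^esub> ShiftM T u = \<ominus>\<^bsub>Hom T (Shift T W) (Shift T Y)\<^esub> ShiftM T (f \<bullet> v)"
    using w(2) comp_neg_right[OF arr_id su] comp_neg_left[OF arr_shift[OF v(1)] arr_shift[OF a(1)]]
      ShiftM_comp[OF v(1) a(1)] comp_id_right[OF su] obj
    by (simp add: v(2) ShiftM_Ident)
  then have "ShiftM T u = ShiftM T (f \<bullet> v)"
    using neg_neg[OF su] neg_neg[OF sfv] by metis
  then have "u = f \<bullet> v" using ShiftM_inj[OF u(1) arr_comp[OF v(1) a(1)]] by simp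
  then show ?thesis using that v by simp
qed

lemma weak_cokernel2:
  assumes "Tri T X Y Z f g h" "arr u Z W" "u \<bullet> g = zr Y W"
  obtains v where "arr v (Shift T X) W" "v \<bullet> h = u"
  using weak_cokernel[OF Tri_rotate[OF assms(1)] assms(2,3)] .

lemma weak_kernel2:
  assumes "Tri T X Y Z f g h" "arr u W Z" "h \<bullet> u = zr W (Shift T X)"
  obtains v where "arr v W Y" "g \<bullet> v = u"
  using weak_kernel[OF Tri_rotate[OF assms(1)] assms(2,3)] .

lemma weak_cokernel3:
  assumes t: "Tri T X Y Z f g h" and u: "arr u (Shift T X) W" "u \<bullet> h = zr Z W"
  obtains v where "arr v (Shift T Y) W" "v \<bullet> ShiftM T f = u"
proof -
  obtain v where v: "arr v (Shift T Y) W"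
    "v \<bullet> (\<ominus>\<^bsub>Hom T (Shift T X) (Shift T Y)\<^esub> ShiftM T f) = u"
    using weak_cokernel2[OF Tri_rotate[OF t] u] .
  note sf = arr_shift[OF Tri_arr(1)[OF t]]
  have "(\<ominus>\<^bsub>Hom T (Shift T Y) W\<^esub> v) \<bullet> ShiftM T f = u"
    using v comp_neg_left[OF sf v(1)] comp_neg_right[OF sf v(1)] by simp
  then show ?thesis using that arr_neg[OF v(1)] by blast
qed

lemma Tri_fibre:
  assumes "arr g Y Z"
  obtains X f h where "Tri T X Y Z f g h"
proof -
  have "Y \<in> Obj T" "Z \<in> Obj T" "g \<in> mor T Y Z" using assms by auto
  then obtain C h l where t: "Tri T Y Z C g h l" using TR1_cone by blast
  then obtain X where "X \<in> Obj T" "C = Shift T X" using Shift_surj Tri_closed by metis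
  then show ?thesis using Tri_unrotate[OF t] that by metis
qed

lemma Tri_cone:
  assumes "arr f X Y"
  obtains Z g h where "Tri T X Y Z f g h"
  using TR1_cone assms unfolding arr_def by blast

lemma hom_zero_Tri:
  assumes "Tri T X Y Z f g h"
  shows "\<lbrakk>hom_zero W X; hom_zero W Z\<rbrakk> \<Longrightarrow> hom_zero W Y"
    and "\<lbrakk>hom_zero X W; hom_zero Z W\<rbrakk> \<Longrightarrow> hom_zero Y W"
proof -
  note a = Tri_arr[OF assms]
  { assume *: "hom_zero W X" "hom_zero W Z"
    show "hom_zero W Y" unfolding hom_zero_def
    proof (intro allI impI)
      fix u assume u: "arr u W Y"
      then have "g \<bullet> u = zr W Z" using * a by (auto intro: hom_zeroD)
      then obtain v where "arr v W X" "f \<bullet> v = u" using weak_kernel[OF assms u] by blast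
      moreover from this have "v = zr W X" using hom_zeroD[OF *(1)] by blast
      ultimately show "u = zr W Y" using comp_zero_right[OF a(1), of W] u by auto
    qed }
  { assume *: "hom_zero X W" "hom_zero Z W"
    show "hom_zero Y W" unfolding hom_zero_def
    proof (intro allI impI)
      fix u assume u: "arr u Y W"
      then have "u \<bullet> f = zr X W" using * a by (auto intro: hom_zeroD)
      then obtain v where "arr v Z W" "v \<bullet> g = u" using weak_cokernel[OF assms u] by blast
      moreover from this have "v = zr Z W" using hom_zeroD[OF *(2)] by blast
      ultimately show "u = zr Y W" using comp_zero_left[OF a(2), of W] u by auto
    qed }
qed

lemma split_fibre:
  assumes t: "Tri T X Y Z f g h" and "f = zr X Y"
  shows "retract Y Z"
proof -
  note a = Tri_arr[OF t]
  have Y: "Y \<in> Obj T" using a by auto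
  have "Ident T Y \<bullet> f = zr X Y" using a assms by (simp add: comp_id_left)
  then obtain v where "arr v Z Y" "v \<bullet> g = Ident T Y" using weak_cokernel[OF t arr_id[OF Y]] by blast
  then show ?thesis using a by (auto simp: retract_def)
qed

lemma split_cofibre:
  assumes t: "Tri T X Y Z f g h" and "g = zr Y Z"
  shows "retract Y X"
proof -
  note a = Tri_arr[OF t]
  have Y: "Y \<in> Obj T" using a by auto
  have "g \<bullet> Ident T Y = zr Y Z" using a assms by (simp add: comp_id_right)
  then obtain v where "arr v Y X" "f \<bullet> v = Ident T Y" using weak_kernel[OF t arr_id[OF Y]] by blast
  then show ?thesis using a by (auto simp: retract_def)
qed

text \<open>Of \<open>TR4\<close> only the triangle formed by the three cones is kept; it exhibits
  the cone of a composite as an extension.\<close>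

lemma octahedron:
  assumes "Tri T X Y C f a b" "Tri T Y Z C' g c d"
  obtains C'' e l u v w where "Tri T X Z C'' (g \<bullet> f) e l" "Tri T C C'' C' u v w"
proof -
  note 1 = Tri_arr[OF assms(1)] and 2 = Tri_arr[OF assms(2)]
  obtain C'' e l where t: "Tri T X Z C'' (g \<bullet> f) e l" using Tri_cone[OF arr_comp[OF 1(1) 2(1)]] .
  then show ?thesis using TR4[OF assms t] that by blast
qed

lemma Tri_shift:
  assumes "Tri T X Y Z f g h"
  obtains f' g' h' where "Tri T (Shift T X) (Shift T Y) (Shift T Z) f' g' h'"
  using Tri_rotate[OF Tri_rotate[OF Tri_rotate[OF assms]]] that by blast

lemma Tri_unshift:
  assumes "Tri T (Shift T X) (Shift T Y) (Shift T Z) f g h" "X \<in> Obj T" "Y \<in> Obj T" "Z \<in> Obj T"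
  obtains f' g' h' where "Tri T X Y Z f' g' h'"
proof -
  obtain u where "Tri T Z (Shift T X) (Shift T Y) u f g" using Tri_unrotate[OF assms(1,4) refl] by blast
  then obtain v where "Tri T Y Z (Shift T X) v u f" using Tri_unrotate[OF _ assms(3) refl] by blast
  then obtain w where "Tri T X Y Z w v u" using Tri_unrotate[OF _ assms(2) refl] by blast
  then show ?thesis using that by blast
qed

text \<open>Every object, and every map between shifts, is a shift in a unique way, so the universal
  property can be tested on shifted objects and families.\<close>

lemma coproduct_shift_iff:
  assumes "\<And>i. i \<in> I \<Longrightarrow> arr (\<iota> i) (F i) C" "C \<in> Obj T"
  shows "is_coproduct T I (\<lambda>i. Shift T (F i)) (Shift T C) (\<lambda>i. ShiftM T (\<iota> i)) \<longleftrightarrow> is_coproduct T I F C \<iota>"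
proof -
  have univ_iff: "(\<exists>!h. h \<in> mor T (Shift T C) (Shift T Y) \<and> (\<forall>i\<in>I. h \<bullet> ShiftM T (\<iota> i)
      = ShiftM T (f i))) \<longleftrightarrow>
      (\<exists>!h. h \<in> mor T C Y \<and> (\<forall>i\<in>I. h \<bullet> \<iota> i = f i))"
    if Y: "Y \<in> Obj T" and f: "\<forall>i\<in>I. f i \<in> mor T (F i) Y" for Y f
  proof -
    let ?P = "\<lambda>h. h \<in> mor T C Y \<and> (\<forall>i\<in>I. h \<bullet> \<iota> i = f i)"
    let ?Q = "\<lambda>h. h \<in> mor T (Shift T C) (Shift T Y) \<and> (\<forall>i\<in>I. h \<bullet> ShiftM T (\<iota> i) = ShiftM T (f i))"
    have b: "bij_betw (ShiftM T) (mor T C Y) (mor T (Shift T C) (Shift T Y))"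
      using ShiftM_bij assms(2) Y by blast
    have PQ: "?Q (ShiftM T h) \<longleftrightarrow> ?P h" if h: "h \<in> mor T C Y" for h
    proof -
      have ah: "arr h C Y" using h assms(2) Y by (simp add: arr_def)
      have "ShiftM T h \<bullet> ShiftM T (\<iota> i) = ShiftM T (f i) \<longleftrightarrow> h \<bullet> \<iota> i = f i" if i: "i \<in> I" for i
      proof -
        have af: "arr (f i) (F i) Y" using f i Y assms(1)[OF i] by (simp add: arr_def)
        show ?thesis
          using ShiftM_inj[OF arr_comp[OF assms(1)[OF i] ah] af] ShiftM_comp[OF assms(1)[OF i] ah]
            by auto
      qed
      then show ?thesis using h b by (auto simp: bij_betw_def)
    qed
    have inj: "inj_on (ShiftM T) (mor T C Y)" and img:
        "ShiftM T ` mor T C Y = mor T (Shift T C) (Shift T Y)"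
      using b by (auto simp: bij_betw_def)
    have "(\<exists>!h. ?Q h) \<longleftrightarrow> (\<exists>!h. h \<in> mor T C Y \<and> ?Q (ShiftM T h))"
    proof
      assume "\<exists>!h. ?Q h"
      then obtain g where g: "?Q g" "\<And>h. ?Q h \<Longrightarrow> h = g" by blast
      then obtain h where h: "h \<in> mor T C Y" "g = ShiftM T h" using img by blast
      show "\<exists>!h. h \<in> mor T C Y \<and> ?Q (ShiftM T h)"
      proof (rule ex1I[of _ h])
        show "h \<in> mor T C Y \<and> ?Q (ShiftM T h)" using g(1) h by simp
        show "h' = h" if "h' \<in> mor T C Y \<and> ?Q (ShiftM T h')" for h'
          using that g(2)[of "ShiftM T h'"] h inj_onD[OF inj, of h' h] by simp
      qed
    next
      assume "\<exists>!h. h \<in> mor T C Y \<and> ?Q (ShiftM T h)"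
      then obtain h where h: "?Q (ShiftM T h)"
        "\<And>h'. h' \<in> mor T C Y \<and> ?Q (ShiftM T h') \<Longrightarrow> h' = h" by blast
      show "\<exists>!h. ?Q h"
      proof (rule ex1I[of _ "ShiftM T h"])
        show "g = ShiftM T h" if g: "?Q g" for g
        proof -
          obtain h' where "h' \<in> mor T C Y" "g = ShiftM T h'" using g img by blast
          then show ?thesis using h(2)[of h'] g by simp
        qed
      qed (rule h(1))
    qed
    also have "\<dots> \<longleftrightarrow> (\<exists>!h. ?P h)"
      by (intro arg_cong[where f = Ex1] ext) (use PQ in blast)
    finally show ?thesis .
  qed
  have F: "F i \<in> Obj T" if "i \<in> I" for i using assms(1)[OF that] by auto
  show ?thesis
  proof
    assume L: "is_coproduct T I (\<lambda>i. Shift T (F i)) (Shift T C) (\<lambda>i. ShiftM T (\<iota> i))"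
    have "\<exists>!h. h \<in> mor T C Y \<and> (\<forall>i\<in>I. h \<bullet> \<iota> i = f i)"
      if Y: "Y \<in> Obj T" and f: "\<forall>i\<in>I. f i \<in> mor T (F i) Y" for Y f
    proof -
      have "\<forall>i\<in>I. ShiftM T (f i) \<in> mor T (Shift T (F i)) (Shift T Y)"
        using f F Y arr_shift[of "f _" "F _" Y] by (auto simp: arr_def)
      then show ?thesis using L Y unfolding univ_iff[OF Y f, symmetric] is_coproduct_def by simp
    qed
    then show "is_coproduct T I F C \<iota>" using assms F by (auto simp: is_coproduct_def arr_def)
  next
    assume R: "is_coproduct T I F C \<iota>"
    have "\<exists>!h. h \<in> mor T (Shift T C) Y \<and> (\<forall>i\<in>I. h \<bullet> ShiftM T (\<iota> i) = f i)"
      if Y: "Y \<in> Obj T" and f: "\<forall>i\<in>I. f i \<in> mor T (Shift T (F i)) Y" for Y f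
    proof -
      obtain Y' where Y': "Y' \<in> Obj T" "Y = Shift T Y'" using Shift_surj[OF Y] .
      have "\<exists>u. arr u (F i) Y' \<and> f i = ShiftM T u" if i: "i \<in> I" for i
        using ShiftM_surj[of "f i" "F i" Y'] F[OF i] Y' f i Y by (auto simp: arr_def)
      then obtain u where u: "\<And>i. i \<in> I \<Longrightarrow> arr (u i) (F i) Y' \<and> f i = ShiftM T (u i)" by metis
      then have um: "\<forall>i\<in>I. u i \<in> mor T (F i) Y'" by auto
      have "\<exists>!h. h \<in> mor T C Y' \<and> (\<forall>i\<in>I. h \<bullet> \<iota> i = u i)"
        using R Y'(1) um unfolding is_coproduct_def by simp
      then show ?thesis using u unfolding univ_iff[OF Y'(1) um, symmetric] Y'(2) by simp
    qed
    moreover have "\<forall>i\<in>I. Shift T (F i) \<in> Obj T \<and> ShiftM T (\<iota> i) \<in> mor T (Shift T (F i)) (Shift T C)"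
      using arr_shift[OF assms(1)] by (auto simp: arr_def)
    ultimately show "is_coproduct T I (\<lambda>i. Shift T (F i)) (Shift T C) (\<lambda>i. ShiftM T (\<iota> i))"
      using assms(2) by (simp add: is_coproduct_def)
  qed
qed

lemma coproduct_unshift:
  assumes "is_coproduct T I (\<lambda>i. Shift T (F i)) (Shift T C) \<iota>" "C \<in> Obj T" "\<And>i. i \<in> I \<Longrightarrow> F i \<in> Obj T"
  obtains \<iota>' where "is_coproduct T I F C \<iota>'" "\<And>i. i \<in> I \<Longrightarrow> \<iota> i = ShiftM T (\<iota>' i)"
proof -
  have "\<exists>u. arr u (F i) C \<and> \<iota> i = ShiftM T u" if "i \<in> I" for i
    using ShiftM_surj[OF coproduct_arr[OF assms(1) that] assms(3)[OF that] assms(2)] by metis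
  then obtain u where u: "\<And>i. i \<in> I \<Longrightarrow> arr (u i) (F i) C \<and> \<iota> i = ShiftM T (u i)" by metis
  have "is_coproduct T I (\<lambda>i. Shift T (F i)) (Shift T C) (\<lambda>i. ShiftM T (u i))"
    using assms(1) u unfolding is_coproduct_def by simp
  then show ?thesis using coproduct_shift_iff[of I u F C] u assms(2) that by simp
qed

subsection \<open>Powers of the shift\<close>

text \<open>Forgetting the maps removes the signs that rotating and shifting introduce; where a map
  matters, \<open>Tri\<close> is used.\<close>

definition tri where
  "tri X Y Z \<longleftrightarrow> (\<exists>f g h. Tri T X Y Z f g h)"

lemma tri_Obj: "tri X Y Z \<Longrightarrow> X \<in> Obj T \<and> Y \<in> Obj T \<and> Z \<in> Obj T"
  using Tri_closed by (auto simp: tri_def)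

lemma tri_hom_zero:
  assumes "tri X Y Z"
  shows "\<lbrakk>hom_zero W X; hom_zero W Z\<rbrakk> \<Longrightarrow> hom_zero W Y"
    and "\<lbrakk>hom_zero X W; hom_zero Z W\<rbrakk> \<Longrightarrow> hom_zero Y W"
  using assms hom_zero_Tri unfolding tri_def by blast+

lemma tri_rotate: "tri X Y Z \<Longrightarrow> tri Y Z (Shift T X)"
  using Tri_rotate unfolding tri_def by blast

lemma shift_pow_0 [simp]: "shift_pow T 0 X = X"
  by (simp add: shift_pow_def)

lemma shift_pow_Obj [intro, simp]:
  assumes "X \<in> Obj T"
  shows "shift_pow T i X \<in> Obj T"
proof -
  have inv: "inv_into (Obj T) (Shift T) Y \<in> Obj T" if "Y \<in> Obj T" for Y
    using Shift_surj[OF that] inv_into_into[of Y "Shift T" "Obj T"] by blast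
  have "(Shift T ^^ n) X \<in> Obj T" "(inv_into (Obj T) (Shift T) ^^ n) X \<in> Obj T" for n
    by (induction n) (simp_all add: assms inv)
  then show ?thesis by (simp add: shift_pow_def)
qed

lemma shift_pow_Suc:
  assumes "X \<in> Obj T"
  shows "shift_pow T (i + 1) X = Shift T (shift_pow T i X)"
proof (cases "i \<ge> 0")
  case True
  then have "nat (i + 1) = Suc (nat i)" by simp
  then show ?thesis using True by (simp add: shift_pow_def)
next
  case False
  define n where "n = nat (- i - 1)"
  let ?U = "inv_into (Obj T) (Shift T)"
  have n: "i = - int n - 1" using False by (simp add: n_def)
  have "shift_pow T (i + 1) X = (?U ^^ n) X" by (simp add: shift_pow_def n)
  moreover have "shift_pow T i X = ?U ((?U ^^ n) X)"
  proof -
    have "nat (- i) = Suc n" by (simp add: n)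
    then show ?thesis using False by (simp add: shift_pow_def)
  qed
  moreover have "Shift T (?U Y) = Y" if "Y \<in> Obj T" for Y
    using Shift_surj[OF that] f_inv_into_f[of Y "Shift T" "Obj T"] by blast
  ultimately show ?thesis using shift_pow_Obj[OF assms, of "i + 1"] by simp
qed

lemma shift_pow_1: "X \<in> Obj T \<Longrightarrow> shift_pow T 1 X = Shift T X"
  using shift_pow_Suc[of X 0] by simp

lemma shift_pow_pred:
  assumes "X \<in> Obj T"
  shows "Shift T (shift_pow T (i - 1) X) = shift_pow T i X"
  using shift_pow_Suc[OF assms, of "i - 1"] by simp

lemma shift_pow_add:
  assumes "X \<in> Obj T"
  shows "shift_pow T i (shift_pow T j X) = shift_pow T (i + j) X"
proof (induction i rule: int_induct[where k = 0])
  case (step1 i)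
  have "shift_pow T (i + 1) (shift_pow T j X) = Shift T (shift_pow T i (shift_pow T j X))"
    by (rule shift_pow_Suc) (use assms in simp)
  then show ?case
    using step1 shift_pow_Suc[OF assms, of "i + j"] by (simp add: algebra_simps)
next
  case (step2 i)
  have "Shift T (shift_pow T (i - 1) (shift_pow T j X)) = Shift T (shift_pow T (i - 1 + j) X)"
    using step2 shift_pow_pred[of "shift_pow T j X" i] shift_pow_pred[OF assms, of "i + j"] assms
    by (simp add: algebra_simps)
  then show ?case by (rule Shift_inj[rotated 2]) (use assms in auto)
qed (simp add: assms)

lemma hom_zero_shift_pow:
  assumes "X \<in> Obj T" "Y \<in> Obj T"
  shows "hom_zero (shift_pow T i X) (shift_pow T i Y) \<longleftrightarrow> hom_zero X Y"
proof (induction i rule: int_induct[where k = 0])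
  case (step1 i)
  then show ?case using assms by (simp add: shift_pow_Suc hom_zero_shift_iff)
next
  case (step2 i)
  then show ?case
    using assms hom_zero_shift_iff[of "shift_pow T (i - 1) X" "shift_pow T (i - 1) Y"]
      by (simp add: shift_pow_pred)
qed simp

lemma hom_zero_shift_left:
  assumes "X \<in> Obj T" "Y \<in> Obj T"
  shows "hom_zero (shift_pow T i X) Y \<longleftrightarrow> hom_zero X (shift_pow T (- i) Y)"
  using hom_zero_shift_pow[OF shift_pow_Obj[OF assms(1), of i] assms(2), of "- i"] assms
  by (simp add: shift_pow_add)

lemma tri_shift_pow:
  assumes "tri X Y Z"
  shows "tri (shift_pow T i X) (shift_pow T i Y) (shift_pow T i Z)"
proof (induction i rule: int_induct[where k = 0])
  case (step1 i)
  then show ?case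
    using tri_Obj[OF assms] by (simp add: shift_pow_Suc) (metis Tri_shift tri_def)
next
  case (step2 i)
  then have "tri (Shift T (shift_pow T (i - 1) X)) (Shift T (shift_pow T (i - 1) Y)) (Shift T (shift_pow
      T (i - 1) Z))"
    using tri_Obj[OF assms] by (simp add: shift_pow_pred)
  then show ?case
    using tri_Obj[OF assms] unfolding tri_def
    by (metis Tri_unshift[OF _ shift_pow_Obj shift_pow_Obj shift_pow_Obj])
qed (simp add: assms)

lemma coproduct_shift_pow:
  assumes "is_coproduct T I F C \<iota>"
  shows "\<exists>\<iota>'. is_coproduct T I (\<lambda>j. shift_pow T i (F j)) (shift_pow T i C) \<iota>'"
proof -
  have F: "F j \<in> Obj T" if "j \<in> I" for j using coproduct_arr[OF assms that] by auto
  have C: "C \<in> Obj T" by (rule coproduct_Obj[OF assms])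
  have cong: "is_coproduct T I F1 C1 \<iota>1 \<longleftrightarrow> is_coproduct T I F2 C1 \<iota>1" if "\<And>j. j \<in> I \<Longrightarrow> F1 j = F2 j"
    for F1 F2 C1 \<iota>1
    using that unfolding is_coproduct_def by simp
  show ?thesis
  proof (induction i rule: int_induct[where k = 0])
    case (step1 i)
    then obtain \<iota>' where c: "is_coproduct T I (\<lambda>j. shift_pow T i (F j)) (shift_pow T i C) \<iota>'" by blast
    then have "is_coproduct T I (\<lambda>j. Shift T (shift_pow T i (F j))) (Shift T (shift_pow T i C)) (\<lambda>j.
        ShiftM T (\<iota>' j))"
      by (subst coproduct_shift_iff) (use coproduct_arr[OF c] C in auto)
    then have "is_coproduct T I (\<lambda>j. shift_pow T (i + 1) (F j)) (Shift T (shift_pow T i C)) (\<lambda>j. ShiftM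
        T (\<iota>' j))"
      by (rule cong[THEN iffD1, rotated]) (simp add: F shift_pow_Suc)
    then show ?case using C by (auto simp: shift_pow_Suc)
  next
    case (step2 i)
    then obtain \<iota>' where "is_coproduct T I (\<lambda>j. shift_pow T i (F j)) (shift_pow T i C) \<iota>'" by blast
    then have "is_coproduct T I (\<lambda>j. shift_pow T i (F j)) (Shift T (shift_pow T (i - 1) C)) \<iota>'"
      using C by (simp add: shift_pow_pred)
    then have "is_coproduct T I (\<lambda>j. Shift T (shift_pow T (i - 1) (F j))) (Shift T (shift_pow T (i - 1)
        C)) \<iota>'"
      by (rule cong[THEN iffD1, rotated]) (simp add: F shift_pow_pred)
    then show ?case by (rule coproduct_unshift) (use C F in auto)
  qed (use assms in auto)
qed

subsection \<open>t-structures\<close>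

text \<open>As \<open>g\<close> vanishes, the identity of \<open>X\<close> lifts to a right inverse
  \<open>s\<close> of \<open>f\<close>. The defect of \<open>s\<close> on the other side is killed
  by \<open>f\<close>, so it factors through the desuspension of \<open>B\<close>, which is
  zero.\<close>

lemma zero_cone_iso:
  assumes "Tri T A X B f g h" "hom_zero B B"
  shows "is_iso T A X f"
proof -
  note a = Tri_arr[OF assms(1)]
  have obj: "A \<in> Obj T" "X \<in> Obj T" "B \<in> Obj T" using a by auto
  have zB: "is_zero_object T B" using obj assms by (simp add: is_zero_object_iff)
  have "g = zr X B" using hom_zeroD[OF zero_object_hom_zero(2)[OF zB obj(2)] a(2)] .
  then have "g \<bullet> Ident T X = zr X B" using comp_id_right[OF a(2)] by simp
  then obtain s where s: "arr s X A" "f \<bullet> s = Ident T X"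
    using weak_kernel[OF assms(1) arr_id[OF obj(2)]] by blast
  obtain B' where B': "B' \<in> Obj T" "B = Shift T B'" using Shift_surj[OF obj(3)] .
  have "hom_zero B' B'" using assms(2) B' by (simp add: hom_zero_shift_iff)
  then have zB': "is_zero_object T B'" using B' by (simp add: is_zero_object_iff)
  obtain u where u: "Tri T B' A X u f g" using Tri_unrotate[OF assms(1) B'] by blast
  let ?d = "(s \<bullet> f) \<ominus>\<^bsub>Hom T A A\<^esub> Ident T A"
  have sf: "arr (s \<bullet> f) A A" using arr_comp[OF a(1) s(1)] .
  have d: "arr ?d A A" using arr_minus[OF sf arr_id[OF obj(1)]] .
  have "f \<bullet> ?d = (f \<bullet> (s \<bullet> f)) \<ominus>\<^bsub>Hom T A X\<^esub> (f \<bullet> Ident T A)"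
    using comp_minus_right[OF sf arr_id[OF obj(1)] a(1)] .
  also have "f \<bullet> (s \<bullet> f) = f"
    using comp_assoc[OF a(1) s(1) a(1)] s(2) comp_id_left[OF a(1)] by simp
  also have "f \<ominus>\<^bsub>Hom T A X\<^esub> (f \<bullet> Ident T A) = zr A X"
    using comp_id_right[OF a(1)] minus_eq_zero_iff[OF a(1) a(1)] by simp
  finally obtain w where w: "arr w A B'" "u \<bullet> w = ?d" using weak_kernel[OF u d] by blast
  have "w = zr A B'" using hom_zeroD[OF zero_object_hom_zero(2)[OF zB' obj(1)] w(1)] .
  then have "?d = zr A A" using w(2) comp_zero_right[OF Tri_arr(1)[OF u] obj(1)] by simp
  then have "s \<bullet> f = Ident T A" using minus_eq_zero_iff[OF sf arr_id[OF obj(1)]] by simp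
  then show ?thesis using is_isoI[OF a(1) s(1) _ s(2)] by simp
qed

lemma tri_iso_closed:
  assumes "iso_closed T S" "tri A X B"
  shows "hom_zero B B \<Longrightarrow> A \<in> S \<Longrightarrow> X \<in> S" "hom_zero A A \<Longrightarrow> B \<in> S \<Longrightarrow> X \<in> S"
proof -
  obtain f g h where t: "Tri T A X B f g h" using assms by (auto simp: tri_def)
  have obj: "A \<in> Obj T" "X \<in> Obj T" using Tri_closed[OF t] by auto
  { assume "hom_zero B B" "A \<in> S"
    then show "X \<in> S" using zero_cone_iso[OF t] assms obj unfolding iso_closed_def by blast }
  { assume "hom_zero A A" "B \<in> S"
    then have "is_iso T X B g" using zero_cone_iso[OF Tri_rotate[OF t]] obj
        by (simp add: hom_zero_shift_iff)
    then have "\<exists>g'. is_iso T B X g'" unfolding is_iso_def by blast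
    then show "X \<in> S" using \<open>B \<in> S\<close> assms obj unfolding iso_closed_def by blast }
qed

lemma shift_pow_image_iff:
  assumes "S \<subseteq> Obj T"
  shows "X \<in> shift_pow T (- n) ` S \<longleftrightarrow> X \<in> Obj T \<and> shift_pow T n X \<in> S"
proof
  assume "X \<in> shift_pow T (- n) ` S"
  then show "X \<in> Obj T \<and> shift_pow T n X \<in> S" using assms by (auto simp: shift_pow_add subset_iff)
next
  assume *: "X \<in> Obj T \<and> shift_pow T n X \<in> S"
  then have "X = shift_pow T (- n) (shift_pow T n X)" by (simp add: shift_pow_add)
  then show "X \<in> shift_pow T (- n) ` S" using * by blast
qed

end

locale t_structured = linear_triangulated_category k T
  for k :: "('k, 'a) ring_scheme" and T :: "('o, 'm, 'k) tri_data" (structure) +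
  fixes \<tau> :: "'o tstr"
  assumes t_str: "t_structure T \<tau>"
begin

abbreviation "L \<equiv> t_le T \<tau>"
abbreviation "R \<equiv> t_ge T \<tau>"

lemma L_iff: "X \<in> L n \<longleftrightarrow> X \<in> Obj T \<and> shift_pow T n X \<in> fst \<tau>"
  and R_iff: "X \<in> R n \<longleftrightarrow> X \<in> Obj T \<and> shift_pow T n X \<in> snd \<tau>"
  using t_str by (auto simp: t_structure_def t_le_def t_ge_def shift_pow_image_iff)

lemma L_Obj: "X \<in> L n \<Longrightarrow> X \<in> Obj T" and R_Obj: "X \<in> R n \<Longrightarrow> X \<in> Obj T"
  by (auto simp: L_iff R_iff)

lemma L_shift: "X \<in> Obj T \<Longrightarrow> shift_pow T i X \<in> L n \<longleftrightarrow> X \<in> L (n + i)"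
  and R_shift: "X \<in> Obj T \<Longrightarrow> shift_pow T i X \<in> R n \<longleftrightarrow> X \<in> R (n + i)"
  by (simp_all add: L_iff R_iff shift_pow_add)

lemma L_mono: "m \<le> n \<Longrightarrow> X \<in> L m \<Longrightarrow> X \<in> L n"
proof (induction n rule: int_ge_induct)
  case (step i)
  then have "X \<in> Obj T" "X \<in> L i" by (auto simp: L_iff)
  then have "shift_pow T (i + 1) X \<in> L (- 1)" by (simp add: L_shift)
  then have "shift_pow T (i + 1) X \<in> L 0" using t_str unfolding t_structure_def by blast
  then show ?case using \<open>X \<in> Obj T\<close> by (simp add: L_shift)
qed

lemma R_antimono: "m \<le> n \<Longrightarrow> X \<in> R n \<Longrightarrow> X \<in> R m"
proof (induction n rule: int_ge_induct)
  case (step i)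
  then have "X \<in> Obj T" by (auto simp: R_iff)
  then have "shift_pow T i X \<in> R 1" using step by (simp add: R_shift add.commute)
  then have "shift_pow T i X \<in> R 0" using t_str unfolding t_structure_def by blast
  then show ?case using \<open>X \<in> Obj T\<close> step by (simp add: R_shift)
qed

lemma orth:
  assumes "X \<in> L n" "Y \<in> R m" "n < m"
  shows "hom_zero X Y"
proof -
  have "Y \<in> R (n + 1)" using R_antimono[of "n + 1" m] assms by simp
  then have obj: "X \<in> Obj T" "Y \<in> Obj T" and "shift_pow T n X \<in> L 0" "shift_pow T n Y \<in> R 1"
    using assms by (simp_all add: L_shift R_shift L_Obj R_Obj add.commute)
  then have "hom_zero (shift_pow T n X) (shift_pow T n Y)"
    using t_str hom_zero_iff unfolding t_structure_def by (simp add: shift_pow_Obj)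
  then show ?thesis using obj hom_zero_shift_pow by simp
qed

lemma truncation:
  assumes "X \<in> Obj T"
  obtains A B where "tri A X B" "A \<in> L n" "B \<in> R (n + 1)"
proof -
  obtain A B where AB: "tri A (shift_pow T n X) B" "A \<in> L 0" "B \<in> R 1"
    using t_str shift_pow_Obj[OF assms, of n] unfolding t_structure_def tri_def by metis
  then have "tri (shift_pow T (- n) A) X (shift_pow T (- n) B)"
    using tri_shift_pow[OF AB(1), of "- n"] assms by (simp add: shift_pow_add)
  moreover have "shift_pow T (- n) A \<in> L n" "shift_pow T (- n) B \<in> R (n + 1)"
    using AB by (simp_all add: L_shift R_shift L_Obj R_Obj)
  ultimately show ?thesis using that by blast
qed

text \<open>In the truncation triangle of \<open>X\<close>, all maps to \<open>B\<close> from
  \<open>X\<close> and from the shift of \<open>A\<close> vanish, hence so does the identity of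
  \<open>B\<close>. Closure of the aisle under extensions, retracts and coproducts is read off from
  this description.\<close>

lemma L_orth_iff: "X \<in> L n \<longleftrightarrow> X \<in> Obj T \<and> (\<forall>Y \<in> R (n + 1). hom_zero X Y)"
proof
  assume *: "X \<in> Obj T \<and> (\<forall>Y \<in> R (n + 1). hom_zero X Y)"
  then obtain A B where AB: "tri A X B" "A \<in> L n" "B \<in> R (n + 1)" using truncation by blast
  have A: "A \<in> Obj T" "B \<in> Obj T" using AB by (auto simp: L_Obj R_Obj)
  have "Shift T A \<in> L (n - 1)" using AB(2) A L_shift[of A 1 "n - 1"] by (simp add: shift_pow_1)
  then have "hom_zero B B"
    using tri_hom_zero(2)[OF tri_rotate[OF AB(1)]] * AB(3) orth[of "Shift T A" "n - 1" B "n + 1"]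
      by simp
  then have "hom_zero (shift_pow T n B) (shift_pow T n B)" using A by (simp add: hom_zero_shift_pow)
  then have "shift_pow T n X \<in> fst \<tau>"
    using tri_iso_closed(1)[OF _ tri_shift_pow[OF AB(1)]] AB(2) t_str
      by (auto simp: L_iff t_structure_def)
  then show "X \<in> L n" using * by (simp add: L_iff)
qed (auto intro: orth simp: L_Obj)

text \<open>Dually, the maps from \<open>A\<close> to \<open>Y\<close> and to the desuspension of
  \<open>B\<close> vanish. This turns comparisons of aisles into comparisons of coaisles.\<close>

lemma R_orth_iff: "Y \<in> R (n + 1) \<longleftrightarrow> Y \<in> Obj T \<and> (\<forall>X \<in> L n. hom_zero X Y)"
proof
  assume *: "Y \<in> Obj T \<and> (\<forall>X \<in> L n. hom_zero X Y)"
  then obtain A B where AB: "tri A Y B" "A \<in> L n" "B \<in> R (n + 1)" using truncation by blast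
  have A: "A \<in> Obj T" "B \<in> Obj T" using AB by (auto simp: L_Obj R_Obj)
  obtain B' where B': "B' \<in> Obj T" "B = Shift T B'" using Shift_surj[OF A(2)] .
  then have "tri B' A Y" using AB(1) Tri_unrotate unfolding tri_def by metis
  moreover have "B' \<in> R (n + 2)" using AB(3) B' R_shift[of B' 1 "n + 1"]
      by (simp add: shift_pow_1 add.commute)
  ultimately have "hom_zero A A" using tri_hom_zero(1) * AB(2) orth[of A n B' "n + 2"] by simp
  then have "hom_zero (shift_pow T (n + 1) A) (shift_pow T (n + 1) A)" using A
      by (simp add: hom_zero_shift_pow)
  then have "shift_pow T (n + 1) Y \<in> snd \<tau>"
    using tri_iso_closed(2)[OF _ tri_shift_pow[OF AB(1)]] AB(3) t_str
      by (auto simp: R_iff t_structure_def)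
  then show "Y \<in> R (n + 1)" using * by (simp add: R_iff)
qed (auto intro: orth simp: R_Obj)

lemma L_extension: "\<lbrakk>tri X Y Z; X \<in> L n; Z \<in> L n\<rbrakk> \<Longrightarrow> Y \<in> L n"
  using tri_hom_zero(2) tri_Obj unfolding L_orth_iff by blast

lemma L_retract: "\<lbrakk>retract A X; X \<in> L n\<rbrakk> \<Longrightarrow> A \<in> L n"
  using retract_hom_zero(2) by (auto simp: L_orth_iff retract_def)

lemma L_coproduct: "\<lbrakk>is_coproduct T I F C \<iota>; \<And>i. i \<in> I \<Longrightarrow> F i \<in> L n\<rbrakk> \<Longrightarrow> C \<in> L n"
  using coproduct_hom_zero[of I F C \<iota>] coproduct_Obj by (simp add: L_orth_iff R_Obj)

lemma L_Shift: "X \<in> L n \<Longrightarrow> Shift T X \<in> L (n - 1)"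
  using L_shift[of X 1 "n - 1"] L_Obj[of X n] by (simp add: shift_pow_1)

end

subsection \<open>Compact objects\<close>

context linear_triangulated_category
begin

text \<open>\<open>e\<close> is the idempotent of \<open>C\<close> that projects onto the summands
  indexed by \<open>J\<close>. The equation \<open>e \<bullet> f = f\<close> says that
  \<open>f\<close> lands in a partial coproduct, without that coproduct being formed.\<close>

definition coproduct_part where
  "coproduct_part I F C \<iota> J e \<longleftrightarrow> arr e C C \<and> (\<forall>i\<in>I. e \<bullet> \<iota> i = (if i \<in> J then \<iota> i else zr (F i) C))"

lemma coproduct_part_ex:
  assumes c: "is_coproduct T I F C \<iota>"
  shows "\<exists>e. coproduct_part I F C \<iota> J e"
proof (rule coproduct_copair[OF c coproduct_Obj[OF c]])
  let ?f = "\<lambda>i. if i \<in> J then \<iota> i else zr (F i) C"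
  show "arr (?f i) (F i) C" if "i \<in> I" for i
    using coproduct_arr[OF c that] by auto
  show "\<exists>e. coproduct_part I F C \<iota> J e" if "arr h C C" "\<And>i. i \<in> I \<Longrightarrow> h \<bullet> \<iota> i = ?f i" for h
    using that unfolding coproduct_part_def by blast
qed

lemma coproduct_part_comp:
  assumes c: "is_coproduct T I F C \<iota>"
    and "coproduct_part I F C \<iota> J e" "coproduct_part I F C \<iota> J' e'" "J \<subseteq> J'"
  shows "e' \<bullet> e = e"
proof (rule coproduct_eqI[OF c])
  have e: "arr e C C" "arr e' C C" using assms by (auto simp: coproduct_part_def)
  then show "arr (e' \<bullet> e) C C" "arr e C C" by auto
  fix i assume i: "i \<in> I"
  note a = coproduct_arr[OF c i]
  have "(e' \<bullet> e) \<bullet> \<iota> i = e' \<bullet> (e \<bullet> \<iota> i)" using comp_assoc[OF a e] .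
  also have "\<dots> = e \<bullet> \<iota> i"
    using assms i a comp_zero_right[OF e(2), of "F i"] by (auto simp: coproduct_part_def)
  finally show "(e' \<bullet> e) \<bullet> \<iota> i = e \<bullet> \<iota> i" .
qed

lemma coproduct_part_eq:
  assumes c: "is_coproduct T I F C \<iota>"
    and "coproduct_part I F C \<iota> J e" "coproduct_part I F C \<iota> J e'"
  shows "e = e'"
  using assms coproduct_eqI[OF c, of e C e'] by (auto simp: coproduct_part_def)

text \<open>A map fixed by the idempotent of a finite part is therefore the sum of its finitely many
  components, which links these idempotents to the comparison map.\<close>

lemma coproduct_part_finsum:
  assumes c: "is_coproduct T I F C \<iota>" and J: "finite J" "J \<subseteq> I"
    and p: "\<And>j. j \<in> J \<Longrightarrow> arr (p j) C (F j)" "\<And>j. j \<in> J \<Longrightarrow> p j \<bullet> \<iota> j = Ident T (F j)"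
      "\<And>i j. \<lbrakk>i \<in> I; j \<in> J; i \<noteq> j\<rbrakk> \<Longrightarrow> p j \<bullet> \<iota> i = zr (F i) (F j)"
  shows "coproduct_part I F C \<iota> J (\<Oplus>\<^bsub>Hom T C C\<^esub>j\<in>J. \<iota> j \<bullet> p j)"
proof -
  have C: "C \<in> Obj T" by (rule coproduct_Obj[OF c])
  have ip: "arr (\<iota> j \<bullet> p j) C C" if "j \<in> J" for j
    using arr_comp[OF p(1)[OF that] coproduct_arr[OF c]] J that by blast
  interpret CC: abelian_group "Hom T C C" by (rule Hom_abelian_group[OF C C])
  have "(\<Oplus>\<^bsub>Hom T C C\<^esub>j\<in>J. \<iota> j \<bullet> p j) \<bullet> \<iota> i = (if i \<in> J then \<iota> i else zr (F i) C)" if i: "i \<in> I" for i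
  proof -
    note a = coproduct_arr[OF c i]
    have Fi: "F i \<in> Obj T" using a by auto
    interpret FC: abelian_group "Hom T (F i) C" by (rule Hom_abelian_group[OF Fi C])
    have "(\<Oplus>\<^bsub>Hom T C C\<^esub>j\<in>J. \<iota> j \<bullet> p j) \<bullet> \<iota> i = (\<Oplus>\<^bsub>Hom T (F i) C\<^esub>j\<in>J. (\<iota> j \<bullet> p j) \<bullet> \<iota> i)"
      using linear_map_finsum[OF Hom_module[OF C C] Hom_module[OF Fi C] precomp_linear_map[OF a C] J(1),
          of "\<lambda>j. \<iota> j \<bullet> p j"] ip by auto
    also have "\<dots> = (\<Oplus>\<^bsub>Hom T (F i) C\<^esub>j\<in>J. if i = j then \<iota> j else zr (F i) C)"
    proof (rule FC.finsum_cong'[OF refl])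
      show "(\<lambda>j. if i = j then \<iota> j else zr (F i) C) \<in> J \<rightarrow> mor T (F i) C" using a by auto
      fix j assume j: "j \<in> J"
      then have jI: "j \<in> I" using J by blast
      note aj = coproduct_arr[OF c jI]
      have "(\<iota> j \<bullet> p j) \<bullet> \<iota> i = \<iota> j \<bullet> (p j \<bullet> \<iota> i)" by (rule comp_assoc[OF a p(1)[OF j] aj])
      then show "(\<iota> j \<bullet> p j) \<bullet> \<iota> i = (if i = j then \<iota> j else zr (F i) C)"
        using p(2)[OF j] p(3)[OF i j] comp_id_right[OF aj] comp_zero_right[OF aj Fi] by auto
    qed
    also have "\<dots> = (if i \<in> J then \<iota> i else zr (F i) C)"
    proof (cases "i \<in> J")
      case True
      have "(\<Oplus>\<^bsub>Hom T (F i) C\<^esub>j\<in>J. if i = j then \<iota> j else zr (F i) C)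
          = (\<Oplus>\<^bsub>Hom T (F i) C\<^esub>j\<in>J. if i = j then \<iota> i else zr (F i) C)"
        by (intro FC.finsum_cong') (use a in auto)
      also have "\<dots> = \<iota> i" using True a by (intro FC.finsum_singleton[OF True J(1)]) auto
      finally show ?thesis using True by simp
    next
      case False
      then show ?thesis by (auto intro!: FC.add.finprod_one_eqI)
    qed
    finally show ?thesis .
  qed
  moreover have "arr (\<Oplus>\<^bsub>Hom T C C\<^esub>j\<in>J. \<iota> j \<bullet> p j) C C"
    using ip C by (auto simp: arr_def intro!: CC.finsum_closed)
  ultimately show ?thesis by (simp add: coproduct_part_def)
qed

lemma coproduct_comparison_part:
  assumes c: "is_coproduct T I F C \<iota>" and s: "s \<in> carrier (direct_sum I (\<lambda>i. Hom T c (F i)))"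
    and obj: "c \<in> Obj T"
  shows "arr (coproduct_comparison T c I F C \<iota> s) c C"
    and "coproduct_part I F C \<iota> {i \<in> I. s i \<noteq> zr c (F i)} e \<Longrightarrow>
      e \<bullet> coproduct_comparison T c I F C \<iota> s = coproduct_comparison T c I F C \<iota> s"
    and "\<lbrakk>j \<in> I; arr p C (F j); p \<bullet> \<iota> j = Ident T (F j);
        \<And>i. \<lbrakk>i \<in> I; i \<noteq> j\<rbrakk> \<Longrightarrow> p \<bullet> \<iota> i = zr (F i) (F j)\<rbrakk> \<Longrightarrow>
      p \<bullet> coproduct_comparison T c I F C \<iota> s = s j"
proof -
  let ?J = "{i \<in> I. s i \<noteq> zr c (F i)}"
  have C: "C \<in> Obj T" by (rule coproduct_Obj[OF c])
  have fin: "finite ?J" and sm: "\<And>i. i \<in> I \<Longrightarrow> s i \<in> mor T c (F i)"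
    using s by (auto simp: direct_sum_def)
  have F: "F i \<in> Obj T" if "i \<in> I" for i using coproduct_arr[OF c that] by auto
  have sa: "arr (s i) c (F i)" if "i \<in> I" for i using sm[OF that] F[OF that] obj by (simp add: arr_def)
  have ia: "arr (\<iota> i \<bullet> s i) c C" if "i \<in> I" for i
      using arr_comp[OF sa[OF that] coproduct_arr[OF c that]] .
  have comp: "q \<bullet> coproduct_comparison T c I F C \<iota> s = (\<Oplus>\<^bsub>Hom T c Y\<^esub>i\<in>?J. q \<bullet> (\<iota> i \<bullet> s i))"
    if q: "arr q C Y" for q Y
  proof -
    have Y: "Y \<in> Obj T" using q by auto
    show ?thesis unfolding coproduct_comparison_def
      using linear_map_finsum[OF Hom_module[OF obj C] Hom_module[OF obj Y] comp_linear_map[OF q obj]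
        fin,
          of "\<lambda>i. \<iota> i \<bullet> s i"] ia by auto
  qed
  interpret cC: abelian_group "Hom T c C" by (rule Hom_abelian_group[OF obj C])
  show "arr (coproduct_comparison T c I F C \<iota> s) c C"
    using ia obj C unfolding coproduct_comparison_def by (auto simp: arr_def intro!: cC.finsum_closed)
  show "e \<bullet> coproduct_comparison T c I F C \<iota> s = coproduct_comparison T c I F C \<iota> s"
    if e: "coproduct_part I F C \<iota> ?J e"
  proof -
    have ea: "arr e C C" using e by (simp add: coproduct_part_def)
    have "e \<bullet> coproduct_comparison T c I F C \<iota> s = (\<Oplus>\<^bsub>Hom T c C\<^esub>i\<in>?J. e \<bullet> (\<iota> i \<bullet> s i))"
        by (rule comp[OF ea])
    also have "\<dots> = (\<Oplus>\<^bsub>Hom T c C\<^esub>i\<in>?J. \<iota> i \<bullet> s i)"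
    proof (rule cC.finsum_cong'[OF refl])
      show "(\<lambda>i. \<iota> i \<bullet> s i) \<in> ?J \<rightarrow> mor T c C" using ia by auto
      fix i assume i: "i \<in> ?J"
      then have iI: "i \<in> I" by simp
      have "e \<bullet> (\<iota> i \<bullet> s i) = (e \<bullet> \<iota> i) \<bullet> s i"
        using comp_assoc[OF sa[OF iI] coproduct_arr[OF c iI] ea] by simp
      also have "e \<bullet> \<iota> i = \<iota> i" using e i unfolding coproduct_part_def by simp
      finally show "e \<bullet> (\<iota> i \<bullet> s i) = \<iota> i \<bullet> s i" .
    qed
    finally show ?thesis by (simp add: coproduct_comparison_def)
  qed
  show "p \<bullet> coproduct_comparison T c I F C \<iota> s = s j"
    if j: "j \<in> I" and p: "arr p C (F j)" "p \<bullet> \<iota> j = Ident T (F j)"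
      "\<And>i. \<lbrakk>i \<in> I; i \<noteq> j\<rbrakk> \<Longrightarrow> p \<bullet> \<iota> i = zr (F i) (F j)"
  proof -
    interpret cF: abelian_group "Hom T c (F j)" by (rule Hom_abelian_group[OF obj F[OF j]])
    have "p \<bullet> coproduct_comparison T c I F C \<iota> s = (\<Oplus>\<^bsub>Hom T c (F j)\<^esub>i\<in>?J. p \<bullet> (\<iota> i \<bullet> s i))"
      by (rule comp[OF p(1)])
    also have "\<dots> = (\<Oplus>\<^bsub>Hom T c (F j)\<^esub>i\<in>?J. if j = i then s j else zr c (F j))"
    proof (rule cF.finsum_cong'[OF refl])
      show "(\<lambda>i. if j = i then s j else zr c (F j)) \<in> ?J \<rightarrow> mor T c (F j)" using sm[OF j] by auto
      fix i assume "i \<in> ?J"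
      then have iI: "i \<in> I" by simp
      have "p \<bullet> (\<iota> i \<bullet> s i) = (p \<bullet> \<iota> i) \<bullet> s i"
        using comp_assoc[OF sa[OF iI] coproduct_arr[OF c iI] p(1)] by simp
      then show "p \<bullet> (\<iota> i \<bullet> s i) = (if j = i then s j else zr c (F j))"
        using p(2) p(3)[OF iI] comp_id_left[OF sa[OF j]] comp_zero_left[OF sa[OF iI] F[OF j]] by auto
    qed
    also have "\<dots> = s j"
    proof (cases "j \<in> ?J")
      case True
      then show ?thesis using cF.finsum_singleton[OF True fin, of "\<lambda>_. s j"] sm[OF j] by simp
    next
      case False
      then have "s j = zr c (F j)" using j by simp
      then show ?thesis by (auto intro!: cF.add.finprod_one_eqI)
    qed
    finally show ?thesis .
  qed
qed

text \<open>Injectivity of the comparison map is automatic, by the projections of a coproduct; its image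
  consists of the maps that are fixed by the idempotent of some finite part.\<close>

lemma compact_objects_iff:
  fixes \<kappa> :: "'i rel"
  shows "c \<in> compact_objects \<kappa> T \<longleftrightarrow> c \<in> Obj T \<and>
    (\<forall>(I :: 'i set) F C \<iota>. |I| <o \<kappa> \<longrightarrow> is_coproduct T I F C \<iota> \<longrightarrow> (\<forall>f. arr f c C \<longrightarrow>
      (\<exists>J e. finite J \<and> J \<subseteq> I \<and> coproduct_part I F C \<iota> J e \<and> e \<bullet> f = f)))"
proof -
  have bij: "bij_betw (coproduct_comparison T c I F C \<iota>) (carrier (direct_sum I (\<lambda>i. Hom T c (F i))))
      (mor T c C)
    \<longleftrightarrow> (\<forall>f. arr f c C \<longrightarrow> (\<exists>J e. finite J \<and> J \<subseteq> I \<and> coproduct_part I F C \<iota> J e \<and> e \<bullet> f = f))"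
    (is "?L \<longleftrightarrow> ?R")
    if obj: "c \<in> Obj T" and c: "is_coproduct T I F C \<iota>" for I :: "'i set" and F C \<iota>
  proof -
    let ?D = "carrier (direct_sum I (\<lambda>i. Hom T c (F i)))"
    let ?\<Phi> = "coproduct_comparison T c I F C \<iota>"
    have C: "C \<in> Obj T" by (rule coproduct_Obj[OF c])
    have F: "F i \<in> Obj T" if "i \<in> I" for i using coproduct_arr[OF c that] by auto
    show ?thesis
    proof
      assume ?L
      show ?R
      proof (intro allI impI)
        fix f assume "arr f c C"
        then have "f \<in> ?\<Phi> ` ?D" using \<open>?L\<close> by (auto simp: bij_betw_def)
        then obtain s where s: "s \<in> ?D" "f = ?\<Phi> s" by blast
        let ?J = "{i \<in> I. s i \<noteq> zr c (F i)}"
        obtain e where e: "coproduct_part I F C \<iota> ?J e" using coproduct_part_ex[OF c] by blast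
        have "finite ?J" using s(1) by (simp add: direct_sum_def)
        moreover have "e \<bullet> f = f" using coproduct_comparison_part(2)[OF c s(1) obj e] s(2) by simp
        ultimately show "\<exists>J e. finite J \<and> J \<subseteq> I \<and> coproduct_part I F C \<iota> J e \<and> e \<bullet> f = f"
          using e by (intro exI[of _ ?J] exI[of _ e]) auto
      qed
    next
      assume ?R
      have inj: "inj_on ?\<Phi> ?D"
      proof (rule inj_onI)
        fix s t assume s: "s \<in> ?D" and t: "t \<in> ?D" and eq: "?\<Phi> s = ?\<Phi> t"
        have "s j = t j" if j: "j \<in> I" for j
        proof (rule coproduct_projection[OF c j])
          fix p assume p: "arr p C (F j)" "p \<bullet> \<iota> j = Ident T (F j)"
            "\<And>i. \<lbrakk>i \<in> I; i \<noteq> j\<rbrakk> \<Longrightarrow> p \<bullet> \<iota> i = zr (F i) (F j)"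
          show "s j = t j"
            using coproduct_comparison_part(3)[OF c s obj j p]
              coproduct_comparison_part(3)[OF c t obj j p] eq
            by simp
        qed
        then show "s = t" using s t by (auto simp: direct_sum_def intro: PiE_ext)
      qed
      have "?\<Phi> ` ?D \<subseteq> mor T c C" using coproduct_comparison_part(1)[OF c _ obj] by auto
      moreover have "f \<in> ?\<Phi> ` ?D" if "f \<in> mor T c C" for f
      proof -
        have f: "arr f c C" using that obj C by (simp add: arr_def)
        then obtain J e where J: "finite J" "J \<subseteq> I" and e: "coproduct_part I F C \<iota> J e" "e \<bullet> f = f"
          using \<open>?R\<close> by blast
        have "\<exists>p. arr p C (F j) \<and> p \<bullet> \<iota> j = Ident T (F j) \<and> (\<forall>i\<in>I. i \<noteq> j \<longrightarrow> p \<bullet> \<iota> i = zr (F i) (F j))"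
          if "j \<in> I" for j
          using coproduct_projection[OF c that] by metis
        then obtain p where p: "\<And>j. j \<in> I \<Longrightarrow> arr (p j) C (F j)" "\<And>j. j \<in> I \<Longrightarrow> p j \<bullet> \<iota> j = Ident T (F j)"
            "\<And>i j. \<lbrakk>i \<in> I; j \<in> I; i \<noteq> j\<rbrakk> \<Longrightarrow> p j \<bullet> \<iota> i = zr (F i) (F j)"
          by metis
        have e_eq: "e = (\<Oplus>\<^bsub>Hom T C C\<^esub>j\<in>J. \<iota> j \<bullet> p j)"
        proof (rule coproduct_part_eq[OF c e(1)])
          show "coproduct_part I F C \<iota> J (\<Oplus>\<^bsub>Hom T C C\<^esub>j\<in>J. \<iota> j \<bullet> p j)"
            using J p by (intro coproduct_part_finsum[OF c J]) auto
        qed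
        interpret cC: abelian_group "Hom T c C" by (rule Hom_abelian_group[OF obj C])
        have ip: "arr (\<iota> j \<bullet> p j) C C" if "j \<in> J" for j
          using arr_comp[OF p(1) coproduct_arr[OF c]] J that by blast
        \<comment> \<open>The preimage has the components of \<open>f\<close> on \<open>J\<close>.
          Some of them can vanish, so the sum over \<open>J\<close> is narrowed to the support of
          \<open>s\<close> below.\<close>
        define s where "s = (\<lambda>i\<in>I. if i \<in> J then p i \<bullet> f else zr c (F i))"
        have s0: "arr (s i) c (F i)" if "i \<in> I" for i
          using that p(1) f F obj by (auto simp: s_def)
        have sJ: "{i \<in> I. s i \<noteq> zr c (F i)} \<subseteq> J" by (auto simp: s_def)
        then have "finite {i \<in> I. s i \<noteq> zr c (F i)}" using J(1) by (rule finite_subset)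
        then have sD: "s \<in> ?D" using s0 by (auto simp: direct_sum_def s_def)
        have "f = (\<Oplus>\<^bsub>Hom T C C\<^esub>j\<in>J. \<iota> j \<bullet> p j) \<bullet> f" using e(2) e_eq by simp
        also have "\<dots> = (\<Oplus>\<^bsub>Hom T c C\<^esub>j\<in>J. (\<iota> j \<bullet> p j) \<bullet> f)"
          using linear_map_finsum[OF Hom_module[OF C C] Hom_module[OF obj C] precomp_linear_map[OF f C]
            J(1),
              of "\<lambda>j. \<iota> j \<bullet> p j"] ip by auto
        also have "\<dots> = (\<Oplus>\<^bsub>Hom T c C\<^esub>j\<in>J. \<iota> j \<bullet> s j)"
        proof (rule cC.finsum_cong'[OF refl])
          show "(\<lambda>j. \<iota> j \<bullet> s j) \<in> J \<rightarrow> mor T c C" using J s0 arr_comp[OF s0 coproduct_arr[OF c]] by auto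
          fix j assume j: "j \<in> J"
          then have jI: "j \<in> I" using J by blast
          show "(\<iota> j \<bullet> p j) \<bullet> f = \<iota> j \<bullet> s j"
            using comp_assoc[OF f p(1)[OF jI] coproduct_arr[OF c jI]] j jI by (simp add: s_def)
        qed
        also have "\<dots> = (\<Oplus>\<^bsub>Hom T c C\<^esub>j\<in>{i \<in> I. s i \<noteq> zr c (F i)}. \<iota> j \<bullet> s j)"
        proof (rule cC.add.finprod_mono_neutral_cong_right[OF J(1) sJ])
          fix i assume "i \<in> J - {i \<in> I. s i \<noteq> zr c (F i)}"
          then show "\<iota> i \<bullet> s i = zr c C"
            using comp_zero_right[OF coproduct_arr[OF c] obj, of i] J by auto
        qed (use arr_comp[OF s0 coproduct_arr[OF c]] in \<open>auto dest!: subsetD[OF J(2)]\<close>)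
        finally have "f = ?\<Phi> s" by (simp add: coproduct_comparison_def)
        then show ?thesis using sD by blast
      qed
      ultimately show ?L using inj unfolding bij_betw_def by blast
    qed
  qed
  show ?thesis
    unfolding compact_objects_def mem_Collect_eq
    by (rule conj_cong[OF refl], intro iff_allI imp_cong refl, rule bij)
qed

lemma compactI:
  fixes \<kappa> :: "'i rel"
  assumes "c \<in> Obj T"
    and "\<And>(I :: 'i set) F C \<iota> f. \<lbrakk>|I| <o \<kappa>; is_coproduct T I F C \<iota>; arr f c C\<rbrakk> \<Longrightarrow>
      \<exists>J e. finite J \<and> J \<subseteq> I \<and> coproduct_part I F C \<iota> J e \<and> e \<bullet> f = f"
  shows "c \<in> compact_objects \<kappa> T"
  unfolding compact_objects_iff by (intro conjI allI impI assms)

lemma compact_Obj: "c \<in> compact_objects \<kappa> T \<Longrightarrow> c \<in> Obj T"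
  by (simp add: compact_objects_def)

lemma compact_part:
  fixes \<kappa> :: "'i rel" and I :: "'i set"
  assumes "c \<in> compact_objects \<kappa> T" "|I| <o \<kappa>" "is_coproduct T I F C \<iota>" "arr f c C"
  obtains J e where "finite J" "J \<subseteq> I" "coproduct_part I F C \<iota> J e" "e \<bullet> f = f"
  using assms compact_objects_iff[of c \<kappa>] by blast

text \<open>Some finite part fixes \<open>f \<bullet> a\<close>, so the remainder of
  \<open>f\<close> after that part kills \<open>a\<close> and factors through the compact
  \<open>Z\<close>. A second finite part fixes this factor, and the union of both fixes
  \<open>f\<close>.\<close>

lemma compact_extension:
  fixes \<kappa> :: "'i rel"
  assumes "tri X Y Z" "X \<in> compact_objects \<kappa> T" "Z \<in> compact_objects \<kappa> T"
  shows "Y \<in> compact_objects \<kappa> T"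
proof -
  obtain a b h where t: "Tri T X Y Z a b h" using assms(1) by (auto simp: tri_def)
  note arrs = Tri_arr[OF t]
  have "\<exists>J e. finite J \<and> J \<subseteq> I \<and> coproduct_part I F C \<iota> J e \<and> e \<bullet> f = f"
    if I: "|I| <o \<kappa>" and c: "is_coproduct T I F C \<iota>" and f: "arr f Y C" for I :: "'i set" and F C \<iota> f
  proof -
    obtain J e where J: "finite J" "J \<subseteq> I" and e: "coproduct_part I F C \<iota> J e" "e \<bullet> (f \<bullet> a) = f \<bullet> a"
      using compact_part[OF assms(2) I c arr_comp[OF arrs(1) f]] by blast
    have ea: "arr e C C" using e by (simp add: coproduct_part_def)
    note ef = arr_comp[OF f ea]
    have "(f \<ominus>\<^bsub>Hom T Y C\<^esub> (e \<bullet> f)) \<bullet> a = zr X C"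
      using comp_minus_left[OF arrs(1) f ef] comp_assoc[OF arrs(1) f ea] e(2)
        minus_eq_zero_iff[OF arr_comp[OF arrs(1) f] arr_comp[OF arrs(1) f]] by simp
    then obtain h where h: "arr h Z C" "h \<bullet> b = f \<ominus>\<^bsub>Hom T Y C\<^esub> (e \<bullet> f)"
      using weak_cokernel[OF t arr_minus[OF f ef]] by blast
    obtain J' e' where J': "finite J'" "J' \<subseteq> I" and e': "coproduct_part I F C \<iota> J' e'" "e' \<bullet> h = h"
      using compact_part[OF assms(3) I c h(1)] by blast
    have ea': "arr e' C C" using e' by (simp add: coproduct_part_def)
    obtain e'' where e'': "coproduct_part I F C \<iota> (J \<union> J') e''" using coproduct_part_ex[OF c] by blast
    have ea'': "arr e'' C C" using e'' by (simp add: coproduct_part_def)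
    have "e'' \<bullet> e = e" "e'' \<bullet> e' = e'" using coproduct_part_comp[OF c _ e''] e e' by blast+
    then have 1: "e'' \<bullet> (e \<bullet> f) = e \<bullet> f" and 2: "e'' \<bullet> h = h"
      using comp_assoc[OF f ea ea''] comp_assoc[OF h(1) ea' ea''] e'(2) by simp_all
    have "e'' \<bullet> (f \<ominus>\<^bsub>Hom T Y C\<^esub> (e \<bullet> f)) = f \<ominus>\<^bsub>Hom T Y C\<^esub> (e \<bullet> f)"
      using comp_assoc[OF arrs(2) h(1) ea''] h(2) 2 by simp
    then have d: "(e'' \<bullet> f) \<ominus>\<^bsub>Hom T Y C\<^esub> (e \<bullet> f) = f \<ominus>\<^bsub>Hom T Y C\<^esub> (e \<bullet> f)"
      using comp_minus_right[OF f ef ea''] 1 by simp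
    have "e'' \<bullet> f = f"
    proof -
      have Y: "Y \<in> Obj T" "C \<in> Obj T" using f by auto
      interpret YC: abelian_group "Hom T Y C" by (rule Hom_abelian_group[OF Y])
      have "e'' \<bullet> f \<in> mor T Y C" "f \<in> mor T Y C" "e \<bullet> f \<in> mor T Y C"
        using arr_comp[OF f ea''] f ef by auto
      then show ?thesis using d YC.add.inv_closed by (simp add: a_minus_def)
    qed
    then show ?thesis using J J' e'' by (intro exI[of _ "J \<union> J'"] exI[of _ e'']) auto
  qed
  moreover have "Y \<in> Obj T" using arrs by auto
  ultimately show ?thesis by (intro compactI)
qed

lemma compact_Shift_iff:
  fixes \<kappa> :: "'i rel"
  assumes "X \<in> Obj T"
  shows "Shift T X \<in> compact_objects \<kappa> T \<longleftrightarrow> X \<in> compact_objects \<kappa> T"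
proof
  assume *: "Shift T X \<in> compact_objects \<kappa> T"
  have "\<exists>J e. finite J \<and> J \<subseteq> I \<and> coproduct_part I F C \<iota> J e \<and> e \<bullet> f = f"
    if I: "|I| <o \<kappa>" and c: "is_coproduct T I F C \<iota>" and f: "arr f X C" for I :: "'i set" and F C \<iota> f
  proof -
    have C: "C \<in> Obj T" using f by auto
    have F: "F i \<in> Obj T" if "i \<in> I" for i using coproduct_arr[OF c that] by auto
    have sc: "is_coproduct T I (\<lambda>i. Shift T (F i)) (Shift T C) (\<lambda>i. ShiftM T (\<iota> i))"
      using coproduct_shift_iff[of I \<iota> F C, OF coproduct_arr[OF c] C] c by simp
    obtain J e where J: "finite J" "J \<subseteq> I"
      and e: "coproduct_part I (\<lambda>i. Shift T (F i)) (Shift T C) (\<lambda>i. ShiftM T (\<iota> i)) J e"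
        "e \<bullet> ShiftM T f = ShiftM T f"
      using compact_part[OF * I sc arr_shift[OF f]] by blast
    have "arr e (Shift T C) (Shift T C)" using e by (simp add: coproduct_part_def)
    then obtain e' where e': "arr e' C C" "e = ShiftM T e'" using C by (elim ShiftM_surj)
    have "e' \<bullet> \<iota> i = (if i \<in> J then \<iota> i else zr (F i) C)" if i: "i \<in> I" for i
    proof (rule ShiftM_inj[OF arr_comp[OF coproduct_arr[OF c i] e'(1)]])
      show "arr (if i \<in> J then \<iota> i else zr (F i) C) (F i) C" using coproduct_arr[OF c i] by auto
      show "ShiftM T (e' \<bullet> \<iota> i) = ShiftM T (if i \<in> J then \<iota> i else zr (F i) C)"
        using e(1) i e'(2) ShiftM_comp[OF coproduct_arr[OF c i] e'(1)] ShiftM_zero[OF F[OF i] C]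
        by (simp add: coproduct_part_def)
    qed
    then have "coproduct_part I F C \<iota> J e'" using e' by (simp add: coproduct_part_def)
    moreover have "e' \<bullet> f = f"
      using e(2) e'(2) ShiftM_comp[OF f e'(1)] ShiftM_inj[OF arr_comp[OF f e'(1)] f] by simp
    ultimately show ?thesis using J by blast
  qed
  then show "X \<in> compact_objects \<kappa> T" by (rule compactI[OF assms])
next
  assume *: "X \<in> compact_objects \<kappa> T"
  have "\<exists>J e. finite J \<and> J \<subseteq> I \<and> coproduct_part I F C \<iota> J e \<and> e \<bullet> f = f"
    if I: "|I| <o \<kappa>" and c: "is_coproduct T I F C \<iota>" and f: "arr f (Shift T X) C" for I :: "'i set"
        and F C \<iota> f
  proof -
    have C: "C \<in> Obj T" using f by auto
    obtain C' where C': "C' \<in> Obj T" "C = Shift T C'" using Shift_surj[OF C] .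
    have F: "F i \<in> Obj T" if "i \<in> I" for i using coproduct_arr[OF c that] by auto
    have "\<exists>G. G \<in> Obj T \<and> F i = Shift T G" if "i \<in> I" for i using Shift_surj[OF F[OF that]] by blast
    then obtain F' where F': "\<And>i. i \<in> I \<Longrightarrow> F' i \<in> Obj T \<and> F i = Shift T (F' i)" by metis
    have "is_coproduct T I (\<lambda>i. Shift T (F' i)) (Shift T C') \<iota>"
      using c F' C' unfolding is_coproduct_def by simp
    then obtain \<iota>' where c': "is_coproduct T I F' C' \<iota>'" and \<iota>: "\<And>i. i \<in> I \<Longrightarrow> \<iota> i = ShiftM T (\<iota>' i)"
      using coproduct_unshift[of I F' C' \<iota>] C' F' by blast
    obtain f' where f': "arr f' X C'" "f = ShiftM T f'"
      using ShiftM_surj[of f X C'] f C' assms by blast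
    obtain J e where J: "finite J" "J \<subseteq> I" and e: "coproduct_part I F' C' \<iota>' J e" "e \<bullet> f' = f'"
      using compact_part[OF * I c' f'(1)] by blast
    have ea: "arr e C' C'" using e by (simp add: coproduct_part_def)
    have "ShiftM T e \<bullet> \<iota> i = (if i \<in> J then \<iota> i else zr (F i) C)" if i: "i \<in> I" for i
    proof -
      have "ShiftM T e \<bullet> \<iota> i = ShiftM T (e \<bullet> \<iota>' i)"
        using ShiftM_comp[OF coproduct_arr[OF c' i] ea] \<iota>[OF i] by simp
      then show ?thesis
        using e(1) i \<iota>[OF i] F'[OF i] C' ShiftM_zero[of "F' i" C'] by (simp add: coproduct_part_def)
    qed
    then have "coproduct_part I F C \<iota> J (ShiftM T e)"
      using arr_shift[OF ea] C'(2) by (simp add: coproduct_part_def)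
    moreover have "ShiftM T e \<bullet> f = f" using ShiftM_comp[OF f'(1) ea] e(2) f'(2) by simp
    ultimately show ?thesis using J by blast
  qed
  then show "Shift T X \<in> compact_objects \<kappa> T" by (rule compactI[OF Shift_Obj[OF assms]])
qed

lemma compact_shift_pow_iff:
  assumes "X \<in> Obj T"
  shows "shift_pow T i X \<in> compact_objects \<kappa> T \<longleftrightarrow> X \<in> compact_objects \<kappa> T"
proof (induction i rule: int_induct[where k = 0])
  case (step1 i)
  then show ?case using assms by (simp add: shift_pow_Suc compact_Shift_iff)
next
  case (step2 i)
  then show ?case
    using assms compact_Shift_iff[of "shift_pow T (i - 1) X" \<kappa>] by (simp add: shift_pow_pred)
qed simp

lemma compact_cone:
  assumes "tri X Y Z" "X \<in> compact_objects \<kappa> T" "Y \<in> compact_objects \<kappa> T"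
  shows "Z \<in> compact_objects \<kappa> T"
  using compact_extension[OF tri_rotate[OF assms(1)] assms(3)] assms tri_Obj compact_Shift_iff by metis

lemma compact_fibre:
  assumes "tri X Y Z" "Y \<in> compact_objects \<kappa> T" "Z \<in> compact_objects \<kappa> T"
  shows "X \<in> compact_objects \<kappa> T"
  using compact_cone[OF tri_rotate[OF assms(1)] assms(2,3)] assms tri_Obj compact_Shift_iff by metis

end

subsection \<open>Maps from compact objects into sequences\<close>

locale cocomplete_triangulated_category = linear_triangulated_category k T
  for k :: "('k, 'a) ring_scheme" and T :: "('o, 'm, 'k) tri_data" (structure) +
  fixes \<kappa> :: "'i rel"
  assumes smallness: "smallness_cardinal \<kappa>"
    and small_coproducts: "has_small_coproducts \<kappa> T"
begin

abbreviation "Cpt \<equiv> compact_objects \<kappa> T"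

lemma countable_index_set:
  obtains I :: "'i set" and b where "|I| <o \<kappa>" "bij_betw b (UNIV :: nat set) I"
proof -
  have \<kappa>: "Card_order \<kappa>" "natLeq <o \<kappa>" using smallness by (auto simp: smallness_cardinal_def)
  have nat: "|UNIV :: nat set| =o natLeq" by (rule card_of_nat)
  then have "|UNIV :: nat set| <o \<kappa>" using \<kappa>(2) by (rule ordIso_ordLess_trans)
  then have "|UNIV :: nat set| \<le>o |Field \<kappa>|"
    using card_of_Field_ordIso[OF \<kappa>(1)] ordIso_symmetric ordLeq_ordIso_trans ordLess_imp_ordLeq by blast
  then obtain b :: "nat \<Rightarrow> 'i" where b: "inj b" using card_of_ordLeq by metis
  then have bij: "bij_betw b UNIV (range b)" by (simp add: bij_betw_def)
  then have "|range b| <o \<kappa>"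
    using \<open>|UNIV :: nat set| <o \<kappa>\<close> card_of_ordIsoI ordIso_symmetric ordIso_ordLess_trans by blast
  then show ?thesis using that bij by blast
qed

text \<open>Compactness speaks of index sets in the type of \<open>\<kappa>\<close>, so the finite
  part is found there and pulled back along the injective \<open>b\<close>.\<close>

lemma countable_coproduct:
  fixes D :: "nat \<Rightarrow> 'o"
  assumes D: "\<And>n. D n \<in> Obj T"
  obtains C \<iota> where "is_coproduct T UNIV D C \<iota>"
    "\<And>c f. \<lbrakk>c \<in> Cpt; arr f c C\<rbrakk> \<Longrightarrow> \<exists>J e. finite J \<and> coproduct_part UNIV D C \<iota> J e \<and> e \<bullet> f = f"
proof -
  obtain I :: "'i set" and b where I: "|I| <o \<kappa>" and b: "bij_betw b (UNIV :: nat set) I"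
    using countable_index_set .
  define F where "F i = D (inv_into UNIV b i)" for i
  have Fb: "F (b n) = D n" for n using b by (simp add: F_def bij_betw_def)
  have "F \<in> I \<rightarrow> Obj T" using D by (simp add: F_def)
  then obtain C \<iota> where c: "is_coproduct T I F C \<iota>"
    using small_coproducts I unfolding has_small_coproducts_def by blast
  then have c': "is_coproduct T UNIV D C (\<lambda>n. \<iota> (b n))"
    using coproduct_reindex[OF b c] by (simp add: Fb)
  have "\<exists>J e. finite J \<and> coproduct_part UNIV D C (\<lambda>n. \<iota> (b n)) J e \<and> e \<bullet> f = f"
    if x: "x \<in> Cpt" and f: "arr f x C" for x f
  proof -
    obtain J e where J: "finite J" "J \<subseteq> I" and e: "coproduct_part I F C \<iota> J e" "e \<bullet> f = f"
      using compact_part[OF x I c f] by blast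
    have bI: "b n \<in> I" for n using b by (auto simp: bij_betw_def)
    have "coproduct_part UNIV D C (\<lambda>n. \<iota> (b n)) (b -` J) e"
      using e(1) bI unfolding coproduct_part_def by (simp add: Fb[symmetric])
    moreover have "finite (b -` J)" using J b by (auto simp: bij_betw_def intro: finite_vimageI)
    ultimately show ?thesis using e(2) by blast
  qed
  then show ?thesis using that c' by blast
qed

lemma generator_zero_object:
  assumes "compact_generator \<kappa> T G" "X \<in> Obj T" "\<And>i. hom_zero (shift_pow T i G) X"
  shows "is_zero_object T X"
proof -
  have G: "G \<in> Obj T" using assms(1) compact_Obj by (auto simp: compact_generator_def)
  have "mor T (shift_pow T i G) X = {zr (shift_pow T i G) X}" for i
    using hom_zero_iff[OF shift_pow_Obj[OF G] assms(2)] assms(3) by simp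
  then show ?thesis using assms(1,2) unfolding compact_generator_def by blast
qed

text \<open>The cone of \<open>1 - s\<close>, where \<open>s\<close> is the shift map of the coproduct of the sequence, vanishes
  since \<open>s\<close> is locally nilpotent on maps from shifts of \<open>G\<close>. Hence the image of the given map in the
  coproduct has the form \<open>(1 - s) y\<close>. The components of \<open>y\<close> are the maps \<open>x n\<close>, and almost all of
  them vanish.\<close>

lemma compact_sequence_eventually_zero:
  assumes G: "compact_generator \<kappa> T G" and c: "c \<in> Cpt"
    and d: "\<And>n. arr (d n) (D n) (D (Suc n))"
    and x: "\<And>n. arr (x n) c (D n)" "\<And>n. x (Suc n) = d n \<bullet> x n"
    and van: "\<And>i. \<exists>N. \<forall>n\<ge>N. hom_zero (shift_pow T i G) (D n)"
  shows "\<exists>n. x n = zr c (D n)"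
proof -
  have D: "D n \<in> Obj T" for n using d[of n] by auto
  obtain C \<iota> where cop: "is_coproduct T UNIV D C \<iota>" and
    part: "\<And>c f. \<lbrakk>c \<in> Cpt; arr f c C\<rbrakk> \<Longrightarrow> \<exists>J e. finite J \<and> coproduct_part UNIV D C \<iota> J e \<and> e \<bullet> f = f"
    using countable_coproduct[of D] D by blast
  have C: "C \<in> Obj T" by (rule coproduct_Obj[OF cop])
  have \<iota>: "arr (\<iota> n) (D n) C" for n by (rule coproduct_arr[OF cop UNIV_I])
  have "\<exists>s. arr s C C \<and> (\<forall>n. s \<bullet> \<iota> n = \<iota> (Suc n) \<bullet> d n)"
    by (rule coproduct_copair[OF cop C arr_comp[OF d \<iota>]]) auto
  then obtain s where s: "arr s C C" "\<And>n. s \<bullet> \<iota> n = \<iota> (Suc n) \<bullet> d n" by blast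
  \<comment> \<open>The cone of this map is the homotopy colimit of the sequence.\<close>
  define m where "m = Ident T C \<ominus>\<^bsub>Hom T C C\<^esub> s"
  have m: "arr m C C" unfolding m_def using arr_minus[OF arr_id[OF C] s(1)] .
  have m_comp: "m \<bullet> y = y \<ominus>\<^bsub>Hom T P C\<^esub> (s \<bullet> y)" if "arr y P C" for y P
    using comp_minus_left[OF that arr_id[OF C] s(1)] comp_id_left[OF that] by (simp add: m_def)
  obtain Z g h where t: "Tri T C C Z m g h" using Tri_cone[OF m] .
  note tarr = Tri_arr[OF t]
  have Z: "Z \<in> Obj T" using tarr by auto
  have "\<exists>p. arr p C (D n) \<and> p \<bullet> \<iota> n = Ident T (D n) \<and> (\<forall>i. i \<noteq> n \<longrightarrow> p \<bullet> \<iota> i = zr (D i) (D n))" for n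
    using coproduct_projection[OF cop UNIV_I[of n]] by (metis UNIV_I)
  then obtain p where p: "\<And>n. arr (p n) C (D n)" "\<And>n. p n \<bullet> \<iota> n = Ident T (D n)"
      "\<And>n i. i \<noteq> n \<Longrightarrow> p n \<bullet> \<iota> i = zr (D i) (D n)" by metis
  define q where "q j = ((\<lambda>f. s \<bullet> f) ^^ j) (Ident T C)" for j
  have q: "arr (q j) C C" for j by (induction j) (auto simp: q_def C s(1))
  have q_Suc: "q (Suc j) \<bullet> y = s \<bullet> (q j \<bullet> y)" and q_0: "q 0 \<bullet> y = y" if "arr y P C" for j y P
    using comp_assoc[OF that q s(1)] comp_id_left[OF that] by (simp_all add: q_def)
  have q_\<iota>: "\<exists>y'. arr y' P (D (n + j)) \<and> q j \<bullet> (\<iota> n \<bullet> y) = \<iota> (n + j) \<bullet> y'" if y: "arr y P (D n)"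
      for y P n j
  proof (induction j)
    case 0
    then show ?case using y q_0[OF arr_comp[OF y \<iota>]] by auto
  next
    case (Suc j)
    then obtain y' where y': "arr y' P (D (n + j))" "q j \<bullet> (\<iota> n \<bullet> y) = \<iota> (n + j) \<bullet> y'" by blast
    then have "q (Suc j) \<bullet> (\<iota> n \<bullet> y) = s \<bullet> (\<iota> (n + j) \<bullet> y')" using q_Suc[OF arr_comp[OF y \<iota>]] by simp
    also have "\<dots> = \<iota> (Suc (n + j)) \<bullet> (d (n + j) \<bullet> y')"
      using comp_assoc[OF y'(1) \<iota> s(1)] comp_assoc[OF y'(1) d \<iota>] s(2) by simp
    finally show ?case using arr_comp[OF y'(1) d] by auto
  qed
  \<comment> \<open>Finitely many components carry \<open>y\<close>, and the \<open>N\<close>-th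
    power of \<open>s\<close> moves the \<open>j\<close>-th one to \<open>D (j + N)\<close>, where
    maps from \<open>P\<close> vanish. The exponent does not depend on the finite part.\<close>
  have nil: "q N \<bullet> y = zr P C"
    if N: "\<forall>n\<ge>N. hom_zero P (D n)" and P: "P \<in> Cpt" and y: "arr y P C" for N P y
  proof -
    obtain J e where J: "finite J" and e: "coproduct_part UNIV D C \<iota> J e" "e \<bullet> y = y"
      using part[OF P y] by blast
    have PO: "P \<in> Obj T" using y by auto
    interpret PC: abelian_group "Hom T P C" by (rule Hom_abelian_group[OF PO C])
    have lin: "linear_map k (Hom T C C) (Hom T P C) (\<lambda>f. q N \<bullet> (f \<bullet> y))"
      by (rule linear_map_compose[OF precomp_linear_map[OF y C] comp_linear_map[OF q PO]])
    have ip: "arr (\<iota> j \<bullet> p j) C C" for j using arr_comp[OF p(1) \<iota>] .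
    have "e = (\<Oplus>\<^bsub>Hom T C C\<^esub>j\<in>J. \<iota> j \<bullet> p j)"
      using coproduct_part_eq[OF cop e(1) coproduct_part_finsum[OF cop J subset_UNIV]] p by auto
    then have "q N \<bullet> y = (\<Oplus>\<^bsub>Hom T P C\<^esub>j\<in>J. q N \<bullet> ((\<iota> j \<bullet> p j) \<bullet> y))"
      using linear_map_finsum[OF Hom_module[OF C C] Hom_module[OF PO C] lin J, of "\<lambda>j. \<iota> j \<bullet> p j"] ip
        e(2)
      by auto
    also have "\<dots> = zr P C"
    proof (rule PC.add.finprod_one_eqI)
      fix j
      obtain y' where y': "arr y' P (D (j + N))" "q N \<bullet> (\<iota> j \<bullet> (p j \<bullet> y)) = \<iota> (j + N) \<bullet> y'"
        using q_\<iota>[OF arr_comp[OF y p(1)]] by blast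
      have "y' = zr P (D (j + N))" using hom_zeroD[OF _ y'(1)] N by simp
      then show "q N \<bullet> ((\<iota> j \<bullet> p j) \<bullet> y) = zr P C"
        using y'(2) comp_assoc[OF y p(1) \<iota>] comp_zero_right[OF \<iota> PO] by simp
    qed
    finally show ?thesis .
  qed
  have GC: "shift_pow T i G \<in> Cpt" for i
    using G compact_shift_pow_iff[OF compact_Obj, of G \<kappa>] by (auto simp: compact_generator_def)
  have gs: "g \<bullet> (s \<bullet> y) = g \<bullet> y" if y: "arr y P C" for y P
  proof -
    have PO: "P \<in> Obj T" using y by auto
    have "g \<bullet> (m \<bullet> y) = zr P Z"
      using comp_assoc[OF y m tarr(2)] Tri_comp_zero[OF t] comp_zero_left[OF y Z] by simp
    then have "(g \<bullet> y) \<ominus>\<^bsub>Hom T P Z\<^esub> (g \<bullet> (s \<bullet> y)) = zr P Z"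
      using m_comp[OF y] comp_minus_right[OF y arr_comp[OF y s(1)] tarr(2)] by simp
    then show ?thesis
      using minus_eq_zero_iff[OF arr_comp[OF y tarr(2)] arr_comp[OF arr_comp[OF y s(1)] tarr(2)]]
        by simp
  qed
  have "hom_zero (shift_pow T i G) Z" for i
    unfolding hom_zero_def
  proof (intro allI impI)
    fix u assume u: "arr u (shift_pow T i G) Z"
    let ?P = "shift_pow T i G" and ?P' = "shift_pow T (i - 1) G"
    have GO: "G \<in> Obj T" using G compact_Obj by (auto simp: compact_generator_def)
    have P: "?P = Shift T ?P'" "?P' \<in> Obj T" "?P \<in> Obj T" using GO by (simp_all add: shift_pow_pred)
    have hu: "arr (h \<bullet> u) (Shift T ?P') (Shift T C)" using arr_comp[OF u tarr(3)] P by simp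
    obtain v where v: "arr v ?P' C" "h \<bullet> u = ShiftM T v" using ShiftM_surj[OF hu P(2) C] .
    have "ShiftM T (m \<bullet> v) = ShiftM T (zr ?P' C)"
      using comp_assoc[OF u tarr(3) arr_shift[OF m]] Tri_comp_zero'(2)[OF t]
        comp_zero_left[OF u Shift_Obj[OF C]]
        ShiftM_comp[OF v(1) m] v(2) ShiftM_zero[OF P(2) C] P(1) by simp
    then have "m \<bullet> v = zr ?P' C" by (rule ShiftM_inj[OF arr_comp[OF v(1) m] arr_zero[OF P(2) C]])
    \<comment> \<open>A map fixed by \<open>s\<close> is fixed by all powers of \<open>s\<close>,
      one of which kills it.\<close>
    then have "s \<bullet> v = v"
      using m_comp[OF v(1)] minus_eq_zero_iff[OF v(1) arr_comp[OF v(1) s(1)]] by simp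
    then have qv: "q j \<bullet> v = v" for j
      by (induction j) (simp_all add: q_Suc[OF v(1)] q_0[OF v(1)])
    obtain N where "\<forall>n\<ge>N. hom_zero ?P' (D n)" using van by blast
    then have "v = zr ?P' C" using nil[OF _ GC v(1)] qv by simp
    then have "h \<bullet> u = zr ?P (Shift T C)" using v(2) ShiftM_zero[OF P(2) C] P(1) by simp
    then obtain y where y: "arr y ?P C" "g \<bullet> y = u" using weak_kernel2[OF t u] by blast
    \<comment> \<open>\<open>g\<close> does not distinguish \<open>y\<close> from its image under
      \<open>s\<close>, so \<open>u\<close> is also \<open>g\<close> applied to a power of
      \<open>s\<close> that kills \<open>y\<close>.\<close>
    have gq: "g \<bullet> (q j \<bullet> y) = u" for j
      by (induction j) (simp_all add: q_Suc[OF y(1)] q_0[OF y(1)] y(2) gs[OF arr_comp[OF y(1) q]])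
    obtain N where "\<forall>n\<ge>N. hom_zero ?P (D n)" using van by blast
    then show "u = zr ?P Z" using nil[OF _ GC y(1)] gq[of N] comp_zero_right[OF tarr(2) P(3)] by simp
  qed
  then have "is_zero_object T Z" by (rule generator_zero_object[OF G Z])
  then have cZ: "hom_zero c Z" using zero_object_hom_zero compact_Obj[OF c] by blast
  have cO: "c \<in> Obj T" using compact_Obj[OF c] .
  note \<iota>x = arr_comp[OF x(1)[of 0] \<iota>]
  obtain y where y: "arr y c C" "m \<bullet> y = \<iota> 0 \<bullet> x 0"
    using weak_kernel[OF t \<iota>x hom_zeroD[OF cZ arr_comp[OF \<iota>x tarr(2)]]] by blast
  have sy: "arr (s \<bullet> y) c C" using arr_comp[OF y(1) s(1)] .
  have p_m: "(p n \<bullet> y) \<ominus>\<^bsub>Hom T c (D n)\<^esub> (p n \<bullet> (s \<bullet> y)) = p n \<bullet> (\<iota> 0 \<bullet> x 0)" for n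
    using m_comp[OF y(1)] y(2) comp_minus_right[OF y(1) sy p(1)] by metis
  have p_s: "p n \<bullet> (s \<bullet> \<iota> i) = (p n \<bullet> \<iota> (Suc i)) \<bullet> d i" for n i
    using comp_assoc[OF d \<iota> p(1)] s(2) by simp
  have ps: "p (Suc n) \<bullet> s = d n \<bullet> p n" for n
  proof (rule coproduct_eqI[OF cop arr_comp[OF s(1) p(1)] arr_comp[OF p(1) d]])
    fix i
    have "(p (Suc n) \<bullet> s) \<bullet> \<iota> i = (p (Suc n) \<bullet> \<iota> (Suc i)) \<bullet> d i"
      using comp_assoc[OF \<iota> s(1) p(1)] p_s by simp
    moreover have "(d n \<bullet> p n) \<bullet> \<iota> i = d n \<bullet> (p n \<bullet> \<iota> i)" using comp_assoc[OF \<iota> p(1) d] .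
    ultimately show "(p (Suc n) \<bullet> s) \<bullet> \<iota> i = (d n \<bullet> p n) \<bullet> \<iota> i"
      using p(2,3) comp_id_left[OF d] comp_id_right[OF d] comp_zero_left[OF d D] comp_zero_right[OF d D]
      by (cases "i = n") auto
  qed
  have ps0: "p 0 \<bullet> s = zr C (D 0)"
  proof (rule coproduct_eqI[OF cop arr_comp[OF s(1) p(1)] arr_zero[OF C D]])
    fix i
    show "(p 0 \<bullet> s) \<bullet> \<iota> i = zr C (D 0) \<bullet> \<iota> i"
      using comp_assoc[OF \<iota> s(1) p(1)] p_s p(3)[of "Suc i" 0] comp_zero_left[OF d D]
        comp_zero_left[OF \<iota> D] by simp
  qed
  \<comment> \<open>Read in components, \<open>m \<bullet> y = \<iota> 0 \<bullet> x 0\<close>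
    starts with \<open>x 0\<close> and continues by \<open>d n\<close>, which is the recursion
    satisfied by \<open>x\<close>.\<close>
  have py: "p n \<bullet> y = x n" for n
  proof (induction n)
    case 0
    have "p 0 \<bullet> (s \<bullet> y) = zr c (D 0)"
      unfolding comp_assoc[OF y(1) s(1) p(1), symmetric] ps0 by (rule comp_zero_left[OF y(1) D])
    moreover have "p 0 \<bullet> (\<iota> 0 \<bullet> x 0) = x 0"
      unfolding comp_assoc[OF x(1) \<iota> p(1), symmetric] p(2) by (rule comp_id_left[OF x(1)])
    ultimately show ?case using p_m[of 0] minus_zero_right[OF arr_comp[OF y(1) p(1)]] by simp
  next
    case (Suc n)
    have "p (Suc n) \<bullet> (\<iota> 0 \<bullet> x 0) = zr c (D (Suc n))"
      unfolding comp_assoc[OF x(1) \<iota> p(1), symmetric] using p(3)[of 0 "Suc n"] comp_zero_left[OF x(1) D]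
        by simp
    then have "p (Suc n) \<bullet> y = p (Suc n) \<bullet> (s \<bullet> y)"
      using p_m[of "Suc n"] minus_eq_zero_iff[OF arr_comp[OF y(1) p(1)] arr_comp[OF sy p(1)]] by simp
    also have "\<dots> = d n \<bullet> (p n \<bullet> y)"
      using comp_assoc[OF y(1) s(1) p(1)[of "Suc n"]] comp_assoc[OF y(1) p(1) d, of n] ps[of n] by simp
    finally show ?case using Suc x(2) by simp
  qed
  obtain J e where J: "finite J" and e: "coproduct_part UNIV D C \<iota> J e" "e \<bullet> y = y"
    using part[OF c y(1)] by blast
  have ea: "arr e C C" using e by (simp add: coproduct_part_def)
  obtain n where n: "n \<notin> J" using J ex_new_if_finite infinite_UNIV_nat by blast
  have pe: "p n \<bullet> e = zr C (D n)"
  proof (rule coproduct_eqI[OF cop arr_comp[OF ea p(1)] arr_zero[OF C D]])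
    fix i
    have "(p n \<bullet> e) \<bullet> \<iota> i = p n \<bullet> (e \<bullet> \<iota> i)" using comp_assoc[OF \<iota> ea p(1)] .
    also have "\<dots> = zr (D i) (D n)"
      using e(1) n p(3)[of i n] comp_zero_right[OF p(1) D] by (auto simp: coproduct_part_def)
    finally show "(p n \<bullet> e) \<bullet> \<iota> i = zr C (D n) \<bullet> \<iota> i" using comp_zero_left[OF \<iota> D] by simp
  qed
  have "p n \<bullet> y = (p n \<bullet> e) \<bullet> y" using comp_assoc[OF y(1) ea p(1)] e(2) by simp
  also have "\<dots> = zr c (D n)" unfolding pe by (rule comp_zero_left[OF y(1) D])
  finally have "p n \<bullet> y = zr c (D n)" .
  then show ?thesis using py by auto
qed

end

locale cocomplete_t_structured = cocomplete_triangulated_category k T \<kappa> + t_structured k T \<tau>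
  for k :: "('k, 'a) ring_scheme" and T :: "('o, 'm, 'k) tri_data" (structure)
    and \<kappa> :: "'i rel" and \<tau> :: "'o tstr"
begin

text \<open>The truncations \<open>c\<^sup>\<ge>\<^sup>n\<close> form a sequence to which the previous lemma applies.\<close>

lemma compact_bounded_above:
  assumes H: "compact_generator \<kappa> T H" "H \<in> L m" and c: "c \<in> Cpt"
  shows "\<exists>n. c \<in> L n"
proof -
  have cO: "c \<in> Obj T" using compact_Obj[OF c] .
  have "\<exists>A B a b h. Tri T A c B a b h \<and> A \<in> L (int n) \<and> B \<in> R (int n + 1)" for n
    by (rule truncation[OF cO, of "int n"]) (unfold tri_def, blast)
  then obtain A B a b h where t: "\<And>n. Tri T (A n) c (B n) (a n) (b n) (h n)"
    and A: "\<And>n. A n \<in> L (int n)" and B: "\<And>n. B n \<in> R (int n + 1)" by metis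
  note arrs = Tri_arr[OF t]
  have "\<exists>d. arr d (B n) (B (Suc n)) \<and> d \<bullet> b n = b (Suc n)" for n
  proof -
    have "hom_zero (A n) (B (Suc n))" using orth[OF A B[of "Suc n"]] by simp
    then show ?thesis
      using weak_cokernel[OF t arrs(2)] hom_zeroD[OF _ arr_comp[OF arrs(1) arrs(2)]] by metis
  qed
  then obtain d where d: "\<And>n. arr (d n) (B n) (B (Suc n))" "\<And>n. b (Suc n) = d n \<bullet> b n" by metis
  have van: "\<exists>N. \<forall>n\<ge>N. hom_zero (shift_pow T i H) (B n)" for i
  proof (intro exI allI impI)
    fix n assume "n \<ge> nat (m - i)"
    moreover have "shift_pow T i H \<in> L (m - i)" using L_shift[OF L_Obj[OF H(2)]] H(2) by simp
    ultimately show "hom_zero (shift_pow T i H) (B n)" using orth[OF _ B] by simp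
  qed
  obtain n where "b n = zr c (B n)"
    using compact_sequence_eventually_zero[OF H(1) c, of d B b] d arrs(2) van by blast
  then have "retract c (A n)" by (rule split_cofibre[OF t])
  then show ?thesis using L_retract A by blast
qed

end

subsection \<open>Approximation by the generator\<close>

context linear_triangulated_category
begin

lemma summand_shift_pow:
  assumes "summand T A X"
  shows "summand T (shift_pow T i A) (shift_pow T i X)"
proof -
  obtain B \<iota> where B: "B \<in> Obj T" and c: "is_coproduct T (UNIV :: bool set) (\<lambda>b. if b then A else B) X
      \<iota>"
    using assms by (auto simp: summand_def is_binary_coproduct_def)
  have "(\<lambda>b. shift_pow T i (if b then A else B)) = (\<lambda>b. if b then shift_pow T i A else shift_pow T i B)"
    by auto
  then show ?thesis
    using coproduct_shift_pow[OF c, of i] shift_pow_Obj[OF B]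
    by (auto simp: summand_def is_binary_coproduct_def)
qed

lemma summand_Obj: "summand T A X \<Longrightarrow> A \<in> Obj T \<and> X \<in> Obj T"
  using summand_retract by (auto simp: retract_def)

text \<open>\<open>P\<close> takes the number of steps as an argument because the two ends of the
  triangle are built in one step and in one step fewer. There is no case for zero steps, where
  nothing is built.\<close>

lemma building_induct_Suc [consumes 1, case_names coproduct extension]:
  fixes \<kappa> :: "'i rel"
  assumes "X \<in> building \<kappa> T S a b n"
    and "\<And>(I :: 'i set) F X \<iota>. \<lbrakk>|I| <o \<kappa>; is_coproduct T I F X \<iota>;
      \<forall>l\<in>I. \<exists>i\<in>{a..b}. \<exists>s\<in>S. \<exists>A. summand T A s \<and> F l = shift_pow T i A\<rbrakk> \<Longrightarrow> P (Suc 0) X"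
    and "\<And>n X Y X' X''. \<lbrakk>summand T X Y; tri X' Y X''; P (Suc 0) X'; P (Suc n) X''\<rbrakk> \<Longrightarrow> P (Suc (Suc n)) X"
  shows "P n X"
proof (cases n)
  case 0
  then show ?thesis using assms(1) by simp
next
  case (Suc m)
  have base: "P (Suc 0) X" if "X \<in> building \<kappa> T S a b (Suc 0)" for X
    using that assms(2) by auto
  have "X \<in> building \<kappa> T S a b (Suc m) \<Longrightarrow> P (Suc m) X" for X
  proof (induction m arbitrary: X)
    case (Suc m)
    then obtain Y X' X'' where "summand T X Y" "tri X' Y X''"
      "X' \<in> building \<kappa> T S a b (Suc 0)" "X'' \<in> building \<kappa> T S a b (Suc m)"
      unfolding building.simps(3) tri_def by blast
    then show ?case using assms(3) base Suc.IH by blast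
  qed (rule base)
  then show ?thesis using assms(1) Suc by simp
qed

lemma building_shift_pow:
  assumes "X \<in> building \<kappa> T S a b n"
  shows "shift_pow T j X \<in> building \<kappa> T S (a + j) (b + j) n"
  using assms
proof (induction rule: building_induct_Suc)
  case (coproduct I F X \<iota>)
  obtain \<iota>' where c': "is_coproduct T I (\<lambda>l. shift_pow T j (F l)) (shift_pow T j X) \<iota>'"
    using coproduct_shift_pow[OF coproduct(2)] by blast
  have "\<forall>l\<in>I. \<exists>i\<in>{a + j..b + j}. \<exists>s\<in>S. \<exists>A. summand T A s \<and> shift_pow T j (F l) = shift_pow T i A"
  proof
    fix l assume l: "l \<in> I"
    obtain i s A where *: "i \<in> {a..b}" "s \<in> S" "summand T A s" "F l = shift_pow T i A"
        using coproduct(3) l by blast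
    then have "shift_pow T j (F l) = shift_pow T (i + j) A"
      using summand_Obj by (simp add: shift_pow_add add.commute)
    moreover have "i + j \<in> {a + j..b + j}" using *(1) by simp
    ultimately show "\<exists>i\<in>{a + j..b + j}. \<exists>s\<in>S. \<exists>A. summand T A s \<and> shift_pow T j (F l) = shift_pow T i A"
      using * by blast
  qed
  then show ?case using coproduct(1) c' unfolding building.simps(2) mem_Collect_eq
    by (intro exI[of _ I] exI[of _ "\<lambda>l. shift_pow T j (F l)"] exI[of _ \<iota>'] conjI)
next
  case (extension n X Y X' X'')
  then have "summand T (shift_pow T j X) (shift_pow T j Y)"
    "tri (shift_pow T j X') (shift_pow T j Y) (shift_pow T j X'')"
    using summand_shift_pow tri_shift_pow by blast+
  then show ?case using extension unfolding building.simps(3) tri_def by blast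
qed

lemma building_hom_zero:
  assumes "X \<in> building \<kappa> T {G} a b n" "Y \<in> Obj T"
      and van: "\<And>i. i \<in> {a..b} \<Longrightarrow> hom_zero (shift_pow T i G) Y"
  shows "hom_zero X Y"
  using assms(1)
proof (induction rule: building_induct_Suc)
  case (coproduct I F X \<iota>)
  show ?case
  proof (rule coproduct_hom_zero[OF coproduct(2) assms(2)])
    fix l assume "l \<in> I"
    then obtain i A where *: "i \<in> {a..b}" "summand T A G" "F l = shift_pow T i A" using coproduct(3)
        by blast
    have obj: "A \<in> Obj T" "G \<in> Obj T" using summand_Obj[OF *(2)] by auto
    have "hom_zero G (shift_pow T (- i) Y)" using van[OF *(1)] hom_zero_shift_left obj assms(2) by simp
    then have "hom_zero A (shift_pow T (- i) Y)"
        by (rule retract_hom_zero(2)[OF summand_retract[OF *(2)]])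
    then show "hom_zero (F l) Y" using *(3) hom_zero_shift_left obj assms(2) by simp
  qed
next
  case (extension n X Y' X' X'')
  then show ?case using retract_hom_zero(2)[OF summand_retract] tri_hom_zero(2) by blast
qed

lemma tri_unrotate:
  assumes "tri X Y Z"
  obtains Z' where "Z' \<in> Obj T" "Z = Shift T Z'" "tri Z' X Y"
proof -
  obtain Z' where Z': "Z' \<in> Obj T" "Z = Shift T Z'" using Shift_surj tri_Obj[OF assms] by blast
  then have "tri Z' X Y" using assms Tri_unrotate unfolding tri_def by metis
  then show ?thesis using that Z' by blast
qed

end

context t_structured
begin

text \<open>The fibre is an extension of \<open>Y\<close> by the desuspension of \<open>Z\<close>,
  which costs one level; hence the index \<open>n - 1\<close>.\<close>

lemma L_fibre: "\<lbrakk>tri X Y Z; Y \<in> L n; Z \<in> L (n - 1)\<rbrakk> \<Longrightarrow> X \<in> L n"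
proof -
  assume t: "tri X Y Z" and YZ: "Y \<in> L n" "Z \<in> L (n - 1)"
  obtain Z' where Z': "Z' \<in> Obj T" "Z = Shift T Z'" "tri Z' X Y" using tri_unrotate[OF t] .
  then have "Z' \<in> L n" using YZ L_shift[of Z' 1 "n - 1"] by (simp add: shift_pow_1)
  then show "X \<in> L n" using L_extension Z'(3) YZ(1) by blast
qed

end

text \<open>Here \<open>\<tau>\<close> is the t-structure that comes with approximability, not the
  preferred one of the theorem; the two are compared once compact objects are known to be bounded
  above.\<close>

locale approximable_category = cocomplete_t_structured k T \<kappa> \<tau>
  for k :: "('k, 'a) ring_scheme" and T :: "('o, 'm, 'k) tri_data" (structure)
    and \<kappa> :: "'i rel" and \<tau> :: "'o tstr" +
  fixes G :: 'o and A :: nat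
  assumes generator: "compact_generator \<kappa> T G"
    and generator_shift: "shift_pow T (int A) G \<in> t_le T \<tau> 0"
    and generator_orth: "E \<in> t_le T \<tau> 0 \<Longrightarrow> hom_zero (shift_pow T (- int A) G) E"
    and approximation: "F \<in> t_le T \<tau> 0 \<Longrightarrow>
      \<exists>E D. tri E F D \<and> D \<in> t_le T \<tau> (-1) \<and> E \<in> building \<kappa> T {G} (- int A) (int A) A"
begin

lemma G_Cpt: "G \<in> Cpt" and G_Obj: "G \<in> Obj T"
  using generator compact_Obj by (auto simp: compact_generator_def)

lemma G_shift_L: "int A - i \<le> n \<Longrightarrow> shift_pow T i G \<in> L n"
  using generator_shift L_mono[of "int A" "n + i" G] by (simp add: L_shift G_Obj)

lemma G_shift_Cpt: "shift_pow T i G \<in> Cpt"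
  using compact_shift_pow_iff[OF G_Obj] G_Cpt by blast

lemma G_shift_hom_zero:
  assumes "E \<in> L n" "n \<le> - int A - i"
  shows "hom_zero (shift_pow T i G) E"
proof -
  have E: "E \<in> Obj T" using L_Obj assms by blast
  have "shift_pow T (- int A - i) E \<in> L 0" using L_mono[OF assms(2,1)] E by (simp add: L_shift)
  then have "hom_zero (shift_pow T (- int A - i) (shift_pow T i G)) (shift_pow T (- int A - i) E)"
    using generator_orth[of "shift_pow T (- int A - i) E"] by (simp add: shift_pow_add G_Obj)
  then show ?thesis using E by (simp add: hom_zero_shift_pow G_Obj)
qed

lemma approximation_at:
  assumes "F \<in> L m"
  obtains E D where "tri E F D" "D \<in> L (m - 1)" "E \<in> building \<kappa> T {G} (- m - int A) (- m + int A) A"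
proof -
  have F: "F \<in> Obj T" using assms L_Obj by blast
  then have "shift_pow T m F \<in> L 0" using assms by (simp add: L_shift)
  then obtain E D where ED: "tri E (shift_pow T m F) D" "D \<in> L (- 1)"
      "E \<in> building \<kappa> T {G} (- int A) (int A) A"
    using approximation by blast
  have "tri (shift_pow T (- m) E) F (shift_pow T (- m) D)"
    using tri_shift_pow[OF ED(1), of "- m"] F by (simp add: shift_pow_add)
  moreover have "shift_pow T (- m) D \<in> L (m - 1)"
    using L_shift[of D "- m" "m - 1"] ED(2) L_Obj by auto
  moreover have "shift_pow T (- m) E \<in> building \<kappa> T {G} (- m - int A) (- m + int A) A"
    using building_shift_pow[OF ED(3), of "- m"] by (simp add: algebra_simps)
  ultimately show ?thesis using that by blast
qed

lemma approximation_chain: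
  assumes "F \<in> L 0"
  obtains D E e d h where "D 0 = F"
    "\<And>n. Tri T (E n) (D n) (D (Suc n)) (e n) (d n) (h n)" "\<And>n. D n \<in> L (- int n)"
    "\<And>n. E n \<in> building \<kappa> T {G} (int n - int A) (int n + int A) A"
proof -
  \<comment> \<open>The choice principle produces only the objects; \<open>Q\<close> records that
    some \<open>E\<close> exists, which is chosen afterwards together with the maps. The clause for
    \<open>n = 0\<close> in \<open>?P\<close> pins the start of the chain.\<close>
  define Q where "Q n D D' = (\<exists>E. tri E D D' \<and> E \<in> building \<kappa> T {G} (int n - int A) (int n + int A) A)"
      for n D D'
  let ?P = "\<lambda>n X. X \<in> L (- int n) \<and> (n = 0 \<longrightarrow> X = F)"
  have "\<exists>D. \<forall>n. ?P n (D n) \<and> Q n (D n) (D (Suc n))"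
  proof (rule dependent_nat_choice)
    show "\<exists>X. ?P 0 X" using assms by simp
  next
    fix X n assume "?P n X"
    then have "X \<in> L (- int n)" by blast
    then obtain E D where ED: "tri E X D" "D \<in> L (- int n - 1)"
      "E \<in> building \<kappa> T {G} (- (- int n) - int A) (- (- int n) + int A) A" by (rule approximation_at)
    have "- int (Suc n) = - int n - 1" by simp
    then have "D \<in> L (- int (Suc n))" using ED(2) by (simp only:)
    then show "\<exists>Y. ?P (Suc n) Y \<and> Q n X Y"
      using ED unfolding Q_def by (intro exI[of _ D]) auto
  qed
  then obtain D where D: "\<And>n. D n \<in> L (- int n)" "D 0 = F" "\<And>n. Q n (D n) (D (Suc n))" by blast
  have "\<exists>E e d h. Tri T E (D n) (D (Suc n)) e d h
      \<and> E \<in> building \<kappa> T {G} (int n - int A) (int n + int A) A" for n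
    using D(3)[of n] unfolding Q_def tri_def by blast
  then obtain E e d h where "\<And>n. Tri T (E n) (D n) (D (Suc n)) (e n) (d n) (h n) \<and>
      E n \<in> building \<kappa> T {G} (int n - int A) (int n + int A) A"
    by metis
  then show ?thesis using that D(1,2) by blast
qed

lemma chain_composite:
  assumes "\<And>n. arr (d n) (D n) (D (Suc n))"
  obtains \<delta> where "\<delta> 0 = Ident T (D 0)" "\<And>n. \<delta> (Suc n) = d n \<bullet> \<delta> n" "\<And>n. arr (\<delta> n) (D 0) (D n)"
proof -
  define \<delta> where "\<delta> = rec_nat (Ident T (D 0)) (\<lambda>n x. d n \<bullet> x)"
  have "\<delta> 0 = Ident T (D 0)" "\<And>n. \<delta> (Suc n) = d n \<bullet> \<delta> n" by (simp_all add: \<delta>_def)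
  moreover have "arr (\<delta> n) (D 0) (D n)" for n
    using assms assms[of 0] by (induction n) (auto simp: \<delta>_def)
  ultimately show ?thesis using that by blast
qed

lemma compact_L: "c \<in> Cpt \<Longrightarrow> \<exists>n. c \<in> L n"
  using compact_bounded_above[OF generator G_shift_L[of 0 "int A", simplified]] by simp

text \<open>After a shift of \<open>c\<close> into the aisle, the map from it to \<open>D N\<close>
  vanishes for some \<open>N\<close>, while a map to a deep enough \<open>Y\<close> extends
  successively over \<open>D 1\<close>, ..., \<open>D N\<close>, since no \<open>E n\<close> with
  \<open>n < N\<close> has maps to \<open>Y\<close>.\<close>

lemma compact_orth:
  assumes c: "c \<in> Cpt"
  shows "\<exists>n. \<forall>Y \<in> L n. hom_zero c Y"
proof -
  have cO: "c \<in> Obj T" using compact_Obj[OF c] .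
  obtain m where m: "c \<in> L m" using compact_L[OF c] by blast
  let ?c = "shift_pow T m c"
  have c': "?c \<in> L 0" "?c \<in> Cpt" using m c cO by (simp_all add: L_shift compact_shift_pow_iff)
  obtain D E e d h where D0: "D 0 = ?c" and t: "\<And>n. Tri T (E n) (D n) (D (Suc n)) (e n) (d n) (h n)"
    and D: "\<And>n. D n \<in> L (- int n)" and E: "\<And>n. E n \<in> building \<kappa> T {G} (int n - int A) (int n + int A) A"
    by (rule approximation_chain[OF c'(1)]) (rule that)
  note arrs = Tri_arr[OF t]
  obtain \<delta> where \<delta>: "\<delta> 0 = Ident T (D 0)" "\<And>n. \<delta> (Suc n) = d n \<bullet> \<delta> n" "\<And>n. arr (\<delta> n) (D 0) (D n)"
    by (rule chain_composite[of d D, OF arrs(2)]) (rule that)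
  have van: "\<exists>N. \<forall>n\<ge>N. hom_zero (shift_pow T i G) (D n)" for i
  proof (intro exI allI impI)
    fix n assume "n \<ge> nat (int A + i)"
    then show "hom_zero (shift_pow T i G) (D n)" by (intro G_shift_hom_zero[OF D]) simp
  qed
  have "D 0 \<in> Cpt" using c'(2) D0 by simp
  then obtain N where N: "\<delta> N = zr (D 0) (D N)"
    using compact_sequence_eventually_zero[of G "D 0" d D \<delta>, OF generator _ arrs(2) \<delta>(3,2) van] by blast
  \<comment> \<open>For \<open>n < N\<close> the object \<open>E n\<close> involves shifts of
    \<open>G\<close> of order at most \<open>N + A\<close>; the second \<open>A\<close> comes from
    \<open>G_shift_hom_zero\<close>.\<close>
  have "hom_zero ?c Y" if Y: "Y \<in> L (- int N - 2 * int A)" for Y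
    unfolding hom_zero_def
  proof (intro allI impI)
    fix g assume g: "arr g ?c Y"
    have YO: "Y \<in> Obj T" using g by auto
    have "n \<le> N \<Longrightarrow> \<exists>g'. arr g' (D n) Y \<and> g' \<bullet> \<delta> n = g" for n
    proof (induction n)
      case 0
      then show ?case using g \<delta>(1) comp_id_right[OF g] D0 by auto
    next
      case (Suc n)
      then obtain g' where g': "arr g' (D n) Y" "g' \<bullet> \<delta> n = g" by auto
      have "hom_zero (E n) Y"
        using Suc.prems by (intro building_hom_zero[OF E YO] G_shift_hom_zero[OF Y]) auto
      then have "g' \<bullet> e n = zr (E n) Y" using hom_zeroD arr_comp[OF arrs(1) g'(1)] by blast
      then obtain g'' where "arr g'' (D (Suc n)) Y" "g'' \<bullet> d n = g'" using weak_cokernel[OF t g'(1)]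
          by blast
      then show ?case using g' comp_assoc[OF \<delta>(3) arrs(2)] \<delta>(2) by metis
    qed
    then obtain g' where "arr g' (D N) Y" "g' \<bullet> \<delta> N = g" by blast
    then show "g = zr ?c Y" using N comp_zero_right[of g' "D N" Y "D 0"] D0 shift_pow_Obj[OF cO] by simp
  qed
  then have "hom_zero c Y" if "Y \<in> L (m - int N - 2 * int A)" for Y
    using that L_shift[of Y m "- int N - 2 * int A"] hom_zero_shift_pow[of c Y m] cO L_Obj
    by (simp add: algebra_simps)
  then show ?thesis by blast
qed

section \<open>Levels of the t-structure detected by maps from shifts of the generator\<close>

lemma truncation_step:
  assumes t: "tri X t Y" "X \<in> L n" "Y \<in> R (n + 1)"
    and van: "\<And>i. i \<in> {- n - int A..- n + int A} \<Longrightarrow> hom_zero (shift_pow T i G) t"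
  shows "X \<in> L (n - 1)"
proof -
  \<comment> \<open>Every map from \<open>E\<close> to \<open>X\<close> is zero: \<open>E\<close>
    has no maps to \<open>t\<close> by \<open>van\<close>, and none to the desuspension of
    \<open>Y\<close>. So \<open>X\<close> is a retract of \<open>D\<close>, one level
    deeper.\<close>
  obtain E D where ED: "tri E X D" "D \<in> L (n - 1)" "E \<in> building \<kappa> T {G} (- n - int A) (- n + int A) A"
    using approximation_at[OF t(2)] .
  have E: "E \<in> L n" using L_fibre[OF ED(1) t(2) ED(2)] .
  obtain Y' where Y': "Y' \<in> Obj T" "Y = Shift T Y'" "tri Y' X t" using tri_unrotate[OF t(1)] .
  have "Y' \<in> R (n + 2)" using t(3) Y' R_shift[of Y' 1 "n + 1"] by (simp add: shift_pow_1 add.commute)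
  then have "hom_zero E Y'" using orth[OF E] by simp
  moreover have "hom_zero E t" using building_hom_zero[OF ED(3) _ van] tri_Obj[OF t(1)] by blast
  ultimately have 0: "hom_zero E X" using tri_hom_zero(1)[OF Y'(3)] by blast
  obtain f g h where f: "Tri T E X D f g h" using ED(1) unfolding tri_def by blast
  have "f = zr E X" using hom_zeroD[OF 0 Tri_arr(1)[OF f]] .
  then show ?thesis using L_retract[OF split_fibre[OF f] ED(2)] by blast
qed

text \<open>From level \<open>n\<close> downwards, the window of shifts used by
  \<open>truncation_step\<close> stays at or above \<open>m\<close>. So the truncation
  \<open>X\<close> sinks through all levels, receives no maps from shifts of \<open>G\<close>, and
  is zero.\<close>

lemma detect_R:
  assumes t: "t \<in> Obj T" and van: "\<And>i. i \<ge> m \<Longrightarrow> hom_zero (shift_pow T i G) t"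
  shows "t \<in> R (- m - int A + 1)"
proof -
  define n where "n = - m - int A"
  obtain X Y where XY: "tri X t Y" "X \<in> L n" "Y \<in> R (n + 1)" using truncation[OF t] .
  have "X \<in> L i" if "i \<le> n" for i
    using that
  proof (induction i rule: int_le_induct)
    case (step i)
    have "Y \<in> R (i + 1)" using R_antimono[OF _ XY(3)] step by simp
    then show ?case using truncation_step[OF XY(1)] step van by (simp add: n_def)
  qed (rule XY(2))
  then have "hom_zero (shift_pow T i G) X" for i
    using G_shift_hom_zero[of X "min n (- int A - i)" i] by simp
  then have "is_zero_object T X" using generator_zero_object[OF generator] XY(2) L_Obj by blast
  then have "hom_zero Z t" if "Z \<in> L n" for Z
    using tri_hom_zero(1)[OF XY(1)] zero_object_hom_zero(2) orth[OF that XY(3)] L_Obj[OF that] by simp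
  then show ?thesis using t R_orth_iff[of t n] by (simp add: n_def)
qed

text \<open>The truncations of \<open>t\<close> from level \<open>n\<close> upwards all sink to
  \<open>L n\<close>, but \<open>t\<close> is not yet known to be bounded above. So
  \<open>Y\<close>, the part of \<open>t\<close> above level \<open>n\<close>, is shown to be a
  retract of the parts above higher levels, to which a given shift of \<open>G\<close> has no maps
  once the level is high.\<close>

lemma detect_L:
  assumes t: "t \<in> Obj T" and van: "\<And>i. i \<le> m \<Longrightarrow> hom_zero (shift_pow T i G) t"
  shows "t \<in> L (int A - m)"
proof -
  define n where "n = int A - m"
  have desc: "X \<in> L n" if "n \<le> n'" "tri X t Y" "X \<in> L n'" "Y \<in> R (n' + 1)" for X Y n'
    using that
  proof (induction n' rule: int_ge_induct)
    case (step i)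
    have "X \<in> L i" using truncation_step[OF step.prems] step van by (simp add: n_def)
    moreover have "Y \<in> R (i + 1)" using R_antimono[OF _ step.prems(3)] by simp
    ultimately show ?case using step by blast
  qed
  obtain X Y where XY: "tri X t Y" "X \<in> L n" "Y \<in> R (n + 1)" using truncation[OF t] .
  obtain a b c where abc: "Tri T X t Y a b c" using XY(1) unfolding tri_def by blast
  note arrs = Tri_arr[OF abc]
  have YO: "Y \<in> Obj T" using arrs by auto
  have "hom_zero (shift_pow T i G) Y" for i
    unfolding hom_zero_def
  proof (intro allI impI)
    fix x assume x: "arr x (shift_pow T i G) Y"
    \<comment> \<open>High enough for the \<open>i\<close>-th shift of \<open>G\<close> to lie in
      \<open>L n'\<close>, so that it has no maps to \<open>Y'\<close>.\<close>
    define n' where "n' = max n (int A - i)"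
    obtain X' Y' where XY': "tri X' t Y'" "X' \<in> L n'" "Y' \<in> R (n' + 1)" using truncation[OF t] .
    obtain a' b' c' where abc': "Tri T X' t Y' a' b' c'" using XY'(1) unfolding tri_def by blast
    note arrs' = Tri_arr[OF abc']
    have X': "X' \<in> L n" using desc[OF _ XY'] by (simp add: n'_def)
    have "hom_zero X Y'" using orth[OF XY(2) XY'(3)] by (simp add: n'_def)
    then obtain p where p: "arr p Y Y'" "p \<bullet> b = b'"
      using weak_cokernel[OF abc arrs'(2)] hom_zeroD arr_comp[OF arrs(1) arrs'(2)] by blast
    have "hom_zero X' Y" using orth[OF X' XY(3)] by simp
    then obtain p' where p': "arr p' Y' Y" "p' \<bullet> b' = b"
      using weak_cokernel[OF abc' arrs(2)] hom_zeroD arr_comp[OF arrs'(1) arrs(2)] by blast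
    \<comment> \<open>Both truncations lie in \<open>L n\<close>, so each of the maps
      \<open>b\<close> and \<open>b'\<close> factors through the other. The composite of the two
      factors differs from the identity of \<open>Y\<close> by a map through the shift of
      \<open>X\<close>, which has no maps to \<open>Y\<close>.\<close>
    have pp: "arr (p' \<bullet> p) Y Y" using arr_comp[OF p(1) p'(1)] .
    let ?\<Delta> = "(p' \<bullet> p) \<ominus>\<^bsub>Hom T Y Y\<^esub> Ident T Y"
    have \<Delta>: "arr ?\<Delta> Y Y" using arr_minus[OF pp arr_id[OF YO]] .
    have "(p' \<bullet> p) \<bullet> b = Ident T Y \<bullet> b"
      using comp_assoc[OF arrs(2) p(1) p'(1)] p p' comp_id_left[OF arrs(2)] by simp
    then have "?\<Delta> \<bullet> b = zr t Y"
      using comp_minus_left[OF arrs(2) pp arr_id[OF YO]]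
        minus_eq_zero_iff[OF arr_comp[OF arrs(2) pp] arr_comp[OF arrs(2) arr_id[OF YO]]]
      by simp
    then obtain v where v: "arr v (Shift T X) Y" "v \<bullet> c = ?\<Delta>" using weak_cokernel2[OF abc \<Delta>] by blast
    have "hom_zero (Shift T X) Y" using orth[OF L_Shift[OF XY(2)] XY(3)] by simp
    then have "v = zr (Shift T X) Y" using v(1) by (rule hom_zeroD)
    then have "p' \<bullet> p = Ident T Y"
      using v(2) comp_zero_left[OF arrs(3) YO] minus_eq_zero_iff[OF pp arr_id[OF YO]] by simp
    moreover have "hom_zero (shift_pow T i G) Y'"
      using orth[OF G_shift_L[of i n'] XY'(3)] by (simp add: n'_def)
    then have "p \<bullet> x = zr (shift_pow T i G) Y'" using hom_zeroD arr_comp[OF x p(1)] by blast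
    ultimately show "x = zr (shift_pow T i G) Y"
      using comp_assoc[OF x p(1) p'(1)] comp_id_left[OF x]
        comp_zero_right[OF p'(1) shift_pow_Obj[OF G_Obj]] by simp
  qed
  then have "is_zero_object T Y" using generator_zero_object[OF generator YO] by blast
  then have "hom_zero t Z" if "Z \<in> R (n + 1)" for Z
    using tri_hom_zero(2)[OF XY(1)] zero_object_hom_zero(1) orth[OF XY(2) that] R_Obj[OF that] by simp
  then show ?thesis using t L_orth_iff[of t n] by (simp add: n_def)
qed

end

subsection \<open>Comparison of t-structures\<close>

context linear_triangulated_category
begin

lemma t_le_subset_shift:
  assumes "t_structure T \<tau>\<^sub>1" "t_structure T \<tau>\<^sub>2" "t_le T \<tau>\<^sub>1 a \<subseteq> t_le T \<tau>\<^sub>2 b"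
  shows "t_le T \<tau>\<^sub>1 (n + a) \<subseteq> t_le T \<tau>\<^sub>2 (n + b)"
proof
  interpret S1: t_structured k T \<tau>\<^sub>1 by unfold_locales (rule assms)
  interpret S2: t_structured k T \<tau>\<^sub>2 by unfold_locales (rule assms)
  fix X assume X: "X \<in> t_le T \<tau>\<^sub>1 (n + a)"
  then have XO: "X \<in> Obj T" by (rule S1.L_Obj)
  then have "shift_pow T n X \<in> t_le T \<tau>\<^sub>1 a" using X by (simp add: S1.L_shift add.commute)
  then have "shift_pow T n X \<in> t_le T \<tau>\<^sub>2 b" using assms(3) by blast
  then show "X \<in> t_le T \<tau>\<^sub>2 (n + b)" using XO by (simp add: S2.L_shift add.commute)
qed

text \<open>One half of equivalence, uniform in the level; bounds then simply add up under
  composition.\<close>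

definition t_near where
  "t_near \<tau>\<^sub>1 \<tau>\<^sub>2 \<longleftrightarrow> (\<exists>N\<ge>0. \<forall>n. t_le T \<tau>\<^sub>1 n \<subseteq> t_le T \<tau>\<^sub>2 (n + N))"

lemma t_nearI:
  assumes "t_structure T \<tau>\<^sub>1" "t_structure T \<tau>\<^sub>2" "t_le T \<tau>\<^sub>1 a \<subseteq> t_le T \<tau>\<^sub>2 b"
  shows "t_near \<tau>\<^sub>1 \<tau>\<^sub>2"
proof -
  interpret S2: t_structured k T \<tau>\<^sub>2 by unfold_locales (rule assms)
  have "t_le T \<tau>\<^sub>1 n \<subseteq> t_le T \<tau>\<^sub>2 (n + max 0 (b - a))" for n
  proof
    fix X assume "X \<in> t_le T \<tau>\<^sub>1 n"
    then have "X \<in> t_le T \<tau>\<^sub>2 (n - a + b)" using t_le_subset_shift[OF assms, of "n - a"] by auto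
    then show "X \<in> t_le T \<tau>\<^sub>2 (n + max 0 (b - a))" by (rule S2.L_mono[rotated]) simp
  qed
  then show ?thesis unfolding t_near_def by (intro exI[of _ "max 0 (b - a)"]) simp
qed

lemma t_near_trans:
  assumes "t_near \<tau>\<^sub>1 \<tau>\<^sub>2" "t_near \<tau>\<^sub>2 \<tau>\<^sub>3"
  shows "t_near \<tau>\<^sub>1 \<tau>\<^sub>3"
proof -
  obtain N M where NM: "N \<ge> 0" "\<And>n. t_le T \<tau>\<^sub>1 n \<subseteq> t_le T \<tau>\<^sub>2 (n + N)"
    "M \<ge> 0" "\<And>n. t_le T \<tau>\<^sub>2 n \<subseteq> t_le T \<tau>\<^sub>3 (n + M)"
    using assms unfolding t_near_def by blast
  then have "t_le T \<tau>\<^sub>1 n \<subseteq> t_le T \<tau>\<^sub>3 (n + (N + M))" for n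
    using NM(2)[of n] NM(4)[of "n + N"] by (simp add: add.assoc) blast
  then show ?thesis unfolding t_near_def using NM by (intro exI[of _ "N + M"]) simp
qed

lemma t_equivalent_near:
  assumes "t_structure T \<tau>\<^sub>1" "t_structure T \<tau>\<^sub>2" "t_equivalent T \<tau>\<^sub>1 \<tau>\<^sub>2"
  shows "t_near \<tau>\<^sub>1 \<tau>\<^sub>2" "t_near \<tau>\<^sub>2 \<tau>\<^sub>1"
  using assms t_nearI unfolding t_equivalent_def by blast+

text \<open>The first comparison carries over the compact approximations and the upper bound. The
  lower bound needs the second one, since passing to orthogonals reverses inclusions.\<close>

lemma T_b_c_subset:
  assumes t: "t_structure T \<tau>\<^sub>1" "t_structure T \<tau>\<^sub>2" and near: "t_near \<tau>\<^sub>1 \<tau>\<^sub>2" "t_near \<tau>\<^sub>2 \<tau>\<^sub>1"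
  shows "T_b_c \<kappa> T \<tau>\<^sub>1 \<subseteq> T_b_c \<kappa> T \<tau>\<^sub>2"
proof -
  interpret S1: t_structured k T \<tau>\<^sub>1 by unfold_locales (rule t)
  interpret S2: t_structured k T \<tau>\<^sub>2 by unfold_locales (rule t)
  obtain N where N: "N \<ge> 0" "\<And>n. t_le T \<tau>\<^sub>1 n \<subseteq> t_le T \<tau>\<^sub>2 (n + N)" using near(1) unfolding t_near_def
      by blast
  obtain M where M: "M \<ge> 0" "\<And>n. t_le T \<tau>\<^sub>2 n \<subseteq> t_le T \<tau>\<^sub>1 (n + M)" using near(2) unfolding t_near_def
      by blast
  have ge: "t_ge T \<tau>\<^sub>1 n \<subseteq> t_ge T \<tau>\<^sub>2 (n - M)" for n
  proof
    fix Y assume Y: "Y \<in> t_ge T \<tau>\<^sub>1 n"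
    have "hom_zero X Y" if "X \<in> t_le T \<tau>\<^sub>2 (n - M - 1)" for X
      using S1.orth[of X "n - 1" Y n] M(2)[of "n - M - 1"] that Y by auto
    then show "Y \<in> t_ge T \<tau>\<^sub>2 (n - M)" using S2.R_orth_iff[of Y "n - M - 1"] S1.R_Obj[OF Y] by simp
  qed
  show ?thesis
  proof
    fix F assume F: "F \<in> T_b_c \<kappa> T \<tau>\<^sub>1"
    have "F \<in> T_minus_c \<kappa> T \<tau>\<^sub>2"
      unfolding T_minus_c_def mem_Collect_eq
    proof (intro conjI allI impI)
      show "F \<in> Obj T" using F by (simp add: T_b_c_def T_minus_c_def)
      fix n :: int assume "n > 0"
      then have "n + N > 0" using N by simp
      then obtain E D f g h where "Tri T E F D f g h" "E \<in> compact_objects \<kappa> T"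
          "D \<in> t_le T \<tau>\<^sub>1 (- (n + N))"
        using F unfolding T_b_c_def T_minus_c_def by blast
      moreover from this have "D \<in> t_le T \<tau>\<^sub>2 (- n)" using N(2)[of "- (n + N)"] by auto
      ultimately show "\<exists>E D f g h. Tri T E F D f g h \<and> E \<in> compact_objects \<kappa> T \<and> D \<in> t_le T \<tau>\<^sub>2 (- n)"
        by blast
    qed
    moreover have "F \<in> t_bounded T \<tau>\<^sub>2"
      using F N(2) ge unfolding T_b_c_def t_bounded_def t_minus_def t_plus_def by blast
    ultimately show "F \<in> T_b_c \<kappa> T \<tau>\<^sub>2" by (simp add: T_b_c_def)
  qed
qed

end

context approximable_category
begin

text \<open>The aisle generated by \<open>H\<close> stays in \<open>L m\<close> because
  \<open>H\<close> does. Conversely \<open>G\<close> is bounded above for the generated t-structure,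
  so objects of its coaisle receive no maps from high shifts of \<open>G\<close>;
  \<open>detect_R\<close> places them in a coaisle of \<open>\<tau>\<close>, and orthogonality gives
  the inclusion of aisles.\<close>

lemma generated_near:
  assumes H: "compact_generator \<kappa> T H" and t: "t_structure T \<sigma>" "fst \<sigma> = generated_aisle \<kappa> T H"
  shows "t_near \<tau> \<sigma>" "t_near \<sigma> \<tau>"
proof -
  interpret S: cocomplete_t_structured k T \<kappa> \<sigma> by unfold_locales (rule t)
  have HC: "H \<in> Cpt" using H by (simp add: compact_generator_def)
  have S0: "S.L 0 = generated_aisle \<kappa> T H" using t by (auto simp: t_le_def)
  obtain m where m: "H \<in> L m" using compact_L[OF HC] by blast
  have "X \<in> L m" if "X \<in> generated_aisle \<kappa> T H" for X
    using that
  proof induction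
    case (shift X)
    show ?case using L_mono[OF _ L_Shift[OF shift.IH]] by simp
  next
    case (extension X Y Z f g h)
    then show ?case using L_extension[of X Y Z] unfolding tri_def by blast
  next
    case (coproduct I F C \<iota>)
    then show ?case using L_coproduct by blast
  next
    case (summand A X)
    then show ?case using L_retract[OF summand_retract] by blast
  qed (rule m)
  then have "S.L 0 \<subseteq> L m" using S0 by blast
  then show "t_near \<sigma> \<tau>" by (rule t_nearI[OF t(1) t_str])
  have H0: "H \<in> S.L 0" unfolding S0 by (rule generated_aisle.generator)
  then obtain p where p: "G \<in> S.L p" using S.compact_bounded_above[OF H H0 G_Cpt] by blast
  have R: "Y \<in> R (- p - int A + 1)" if Y: "Y \<in> S.R 1" for Y
  proof (rule detect_R[OF S.R_Obj[OF Y]])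
    fix i assume "i \<ge> p"
    moreover have "shift_pow T i G \<in> S.L (p - i)" using p by (simp add: S.L_shift G_Obj)
    ultimately show "hom_zero (shift_pow T i G) Y" using S.orth[OF _ Y] by simp
  qed
  have "L (- p - int A) \<subseteq> S.L 0"
  proof
    fix X assume X: "X \<in> L (- p - int A)"
    then have "hom_zero X Y" if "Y \<in> S.R 1" for Y using orth[OF X R[OF that]] by simp
    then show "X \<in> S.L 0" using S.L_orth_iff[of X 0] L_Obj[OF X] by simp
  qed
  then show "t_near \<tau> \<sigma>" by (rule t_nearI[OF t_str t(1)])
qed

lemma T_b_c_preferred:
  assumes "preferred_t_structure \<kappa> T \<sigma>"
  shows "T_b_c \<kappa> T \<sigma> = T_b_c \<kappa> T \<tau>"
proof -
  obtain H \<rho> where \<sigma>: "t_structure T \<sigma>" and H: "compact_generator \<kappa> T H" and \<rho>: "t_structure T \<rho>"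
    "fst \<rho> = generated_aisle \<kappa> T H" and eq: "t_equivalent T \<sigma> \<rho>"
    using assms unfolding preferred_t_structure_def by blast
  have "t_near \<sigma> \<tau>" "t_near \<tau> \<sigma>"
    using t_near_trans t_equivalent_near[OF \<sigma> \<rho>(1) eq] generated_near[OF H \<rho>] by blast+
  then show ?thesis using T_b_c_subset[OF \<sigma> t_str] T_b_c_subset[OF t_str \<sigma>] by blast
qed

end

subsection \<open>Finitely generated direct sums\<close>

lemma direct_sum_simps:
  "carrier (direct_sum I M) = {s \<in> (\<Pi>\<^sub>E i\<in>I. carrier (M i)). finite {i \<in> I. s i \<noteq> \<zero>\<^bsub>M i\<^esub>}}"
  "\<zero>\<^bsub>direct_sum I M\<^esub> = (\<lambda>i\<in>I. \<zero>\<^bsub>M i\<^esub>)"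
  "s \<oplus>\<^bsub>direct_sum I M\<^esub> t = (\<lambda>i\<in>I. s i \<oplus>\<^bsub>M i\<^esub> t i)"
  "r \<odot>\<^bsub>direct_sum I M\<^esub> s = (\<lambda>i\<in>I. r \<odot>\<^bsub>M i\<^esub> s i)"
  by (simp_all add: direct_sum_def)

lemma direct_sum_module:
  assumes "cring R" and M: "\<And>i. i \<in> I \<Longrightarrow> module R (M i)"
  shows "module R (direct_sum I M)"
proof -
  let ?D = "direct_sum I M"
  have ab: "abelian_group (M i)" if "i \<in> I" for i using M[OF that] by (simp add: module_def)
  note grp = abelian_groupE(1,2)[OF ab]
  have fin: "finite {i \<in> I. (\<lambda>i\<in>I. u i) i \<noteq> \<zero>\<^bsub>M i\<^esub>}"
    if "finite {i \<in> I. s i \<noteq> \<zero>\<^bsub>M i\<^esub>}" "\<And>i. \<lbrakk>i \<in> I; s i = \<zero>\<^bsub>M i\<^esub>\<rbrakk> \<Longrightarrow> u i = \<zero>\<^bsub>M i\<^esub>" for s u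
    by (rule finite_subset[OF _ that(1)]) (use that(2) in auto)
  have fin2: "finite {i \<in> I. (\<lambda>i\<in>I. s i \<oplus>\<^bsub>M i\<^esub> t i) i \<noteq> \<zero>\<^bsub>M i\<^esub>}"
    if "finite {i \<in> I. s i \<noteq> \<zero>\<^bsub>M i\<^esub>}" "finite {i \<in> I. t i \<noteq> \<zero>\<^bsub>M i\<^esub>}" for s t
    by (rule finite_subset[of _ "{i \<in> I. s i \<noteq> \<zero>\<^bsub>M i\<^esub>} \<union> {i \<in> I. t i \<noteq> \<zero>\<^bsub>M i\<^esub>}"])
      (use that grp(2) abelian_groupE(5)[OF ab] in auto)
  show ?thesis
  proof (rule moduleI)
    show "cring R" by fact
    show "abelian_group ?D"
    proof (rule abelian_groupI)
      show "\<zero>\<^bsub>?D\<^esub> \<in> carrier ?D" using grp(2) by (auto simp: direct_sum_simps)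
      show "s \<oplus>\<^bsub>?D\<^esub> t \<in> carrier ?D" if "s \<in> carrier ?D" "t \<in> carrier ?D" for s t
        using that grp(1) fin2[of s t] by (auto simp: direct_sum_simps PiE_iff)
      show "s \<oplus>\<^bsub>?D\<^esub> t \<oplus>\<^bsub>?D\<^esub> u = s \<oplus>\<^bsub>?D\<^esub> (t \<oplus>\<^bsub>?D\<^esub> u)"
        if "s \<in> carrier ?D" "t \<in> carrier ?D" "u \<in> carrier ?D" for s t u
        using that abelian_groupE(3)[OF ab] by (auto simp: direct_sum_simps PiE_iff fun_eq_iff
          restrict_def)
      show "s \<oplus>\<^bsub>?D\<^esub> t = t \<oplus>\<^bsub>?D\<^esub> s" if "s \<in> carrier ?D" "t \<in> carrier ?D" for s t
        using that abelian_groupE(4)[OF ab] by (auto simp: direct_sum_simps PiE_iff fun_eq_iff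
          restrict_def)
      show "\<zero>\<^bsub>?D\<^esub> \<oplus>\<^bsub>?D\<^esub> s = s" if "s \<in> carrier ?D" for s
        using that abelian_groupE(5)[OF ab]
        by (auto simp: direct_sum_simps PiE_iff fun_eq_iff restrict_def extensional_def)
      show "\<exists>t\<in>carrier ?D. t \<oplus>\<^bsub>?D\<^esub> s = \<zero>\<^bsub>?D\<^esub>" if s: "s \<in> carrier ?D" for s
      proof (rule bexI)
        let ?t = "\<lambda>i\<in>I. \<ominus>\<^bsub>M i\<^esub> s i"
        have si: "s i \<in> carrier (M i)" if "i \<in> I" for i using s that by (auto simp: direct_sum_simps)
        have "\<ominus>\<^bsub>M i\<^esub> \<zero>\<^bsub>M i\<^esub> = \<zero>\<^bsub>M i\<^esub>" if "i \<in> I" for i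
        proof -
          interpret abelian_group "M i" by (rule ab[OF that])
          show ?thesis by simp
        qed
        then show "?t \<in> carrier ?D"
          using s si abelian_group.a_inv_closed[OF ab] fin[of s "\<lambda>i. \<ominus>\<^bsub>M i\<^esub> s i"]
          by (auto simp: direct_sum_simps)
        show "?t \<oplus>\<^bsub>?D\<^esub> s = \<zero>\<^bsub>?D\<^esub>"
          using si abelian_group.l_neg[OF ab] by (auto simp: direct_sum_simps fun_eq_iff restrict_def)
      qed
    qed
    show "r \<odot>\<^bsub>?D\<^esub> s \<in> carrier ?D" if "r \<in> carrier R" "s \<in> carrier ?D" for r s
      using that module.smult_closed[OF M] module.smult_r_null[OF M] fin[of s "\<lambda>i. r \<odot>\<^bsub>M i\<^esub> s i"]
      by (auto simp: direct_sum_simps PiE_iff)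
  qed (use module.smult_l_distr[OF M] module.smult_r_distr[OF M] module.smult_assoc1[OF M]
      module.smult_one[OF M]
      in \<open>auto simp: direct_sum_simps PiE_iff fun_eq_iff restrict_def extensional_def\<close>)
qed

definition direct_sum_single :: "'j set \<Rightarrow> ('j \<Rightarrow> ('k, 'm, 'b) module_scheme) \<Rightarrow> 'j \<Rightarrow> 'm \<Rightarrow> 'j \<Rightarrow> 'm" where
  "direct_sum_single I M i x = (\<lambda>j\<in>I. if j = i then x else \<zero>\<^bsub>M j\<^esub>)"

lemma direct_sum_single_linear:
  assumes M: "\<And>i. i \<in> I \<Longrightarrow> module R (M i)" and i: "i \<in> I"
  shows "linear_map R (M i) (direct_sum I M) (direct_sum_single I M i)"
proof -
  have ab: "abelian_group (M j)" if "j \<in> I" for j using M[OF that] by (simp add: module_def)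
  have "finite {j \<in> I. (\<lambda>j\<in>I. if j = i then x else \<zero>\<^bsub>M j\<^esub>) j \<noteq> \<zero>\<^bsub>M j\<^esub>}" for x
    by (rule finite_subset[of _ "{i}"]) auto
  then show ?thesis
    unfolding linear_map_def direct_sum_single_def
    using abelian_groupE(2,5)[OF ab] module.smult_r_null[OF M]
    by (auto simp: direct_sum_simps fun_eq_iff restrict_def)
qed

lemma direct_sum_component_linear:
  assumes "i \<in> I"
  shows "linear_map R (direct_sum I M) (M i) (\<lambda>s. s i)"
  using assms by (auto simp: linear_map_def direct_sum_simps)

lemma fg_direct_sum_component:
  assumes R: "cring R" and M: "\<And>i. i \<in> I \<Longrightarrow> module R (M i)" and fg: "fg_module R (direct_sum I M)"
      and i: "i \<in> I"
  shows "fg_module R (M i)"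
proof (rule fg_module_surj[OF direct_sum_module[of R I M, OF R M] M[OF i] direct_sum_component_linear[OF
    i] _ fg])
  show "carrier (M i) \<subseteq> (\<lambda>s. s i) ` carrier (direct_sum I M)"
  proof
    fix x assume "x \<in> carrier (M i)"
    then have "direct_sum_single I M i x \<in> carrier (direct_sum I M)"
      using direct_sum_single_linear[of I R M, OF M i] by (auto simp: linear_map_def)
    moreover have "x = direct_sum_single I M i x i" using i by (simp add: direct_sum_single_def)
    ultimately show "x \<in> (\<lambda>s. s i) ` carrier (direct_sum I M)" by blast
  qed
qed

text \<open>The supports of finitely many generators have a finite union \<open>J\<close>, and the
  elements supported in \<open>J\<close> form a submodule, which is then everything. Elements
  concentrated at a single index test the components outside \<open>J\<close>.\<close>

lemma fg_direct_sum_support: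
  assumes R: "cring R" and M: "\<And>i. i \<in> I \<Longrightarrow> module R (M i)" and fg: "fg_module R (direct_sum I M)"
  shows "finite {i \<in> I. carrier (M i) \<noteq> {\<zero>\<^bsub>M i\<^esub>}}"
proof -
  let ?D = "direct_sum I M"
  interpret D: module R ?D by (rule direct_sum_module[of R I M, OF R M])
  obtain S where S: "S \<subseteq> carrier ?D" "finite S" "carrier ?D \<subseteq> D.span S"
    using fg D.fg_module_iff_span by auto
  define J where "J = (\<Union>s\<in>S. {i \<in> I. s i \<noteq> \<zero>\<^bsub>M i\<^esub>})"
  have J: "finite J" using S by (auto simp: J_def direct_sum_simps)
  define N where "N = {s \<in> carrier ?D. \<forall>i\<in>I - J. s i = \<zero>\<^bsub>M i\<^esub>}"
  have "submodule N R ?D"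
  proof (rule D.submoduleI')
    show "\<zero>\<^bsub>?D\<^esub> \<in> N" using D.M.zero_closed by (auto simp: N_def direct_sum_simps(2))
    have ab: "abelian_group (M j)" if "j \<in> I" for j using M[OF that] by (simp add: module_def)
    show "s \<oplus>\<^bsub>?D\<^esub> t \<in> N" if "s \<in> N" "t \<in> N" for s t
      using that D.M.a_closed[of s t] abelian_groupE(2,5)[OF ab]
        by (auto simp: N_def direct_sum_simps(3))
    show "r \<odot>\<^bsub>?D\<^esub> s \<in> N" if "r \<in> carrier R" "s \<in> N" for r s
      using that D.smult_closed[of r s] module.smult_r_null[OF M]
        by (auto simp: N_def direct_sum_simps(4))
  qed (auto simp: N_def)
  moreover have "S \<subseteq> N" using S(1) by (auto simp: N_def J_def)
  ultimately have DN: "carrier ?D \<subseteq> N" using S(3) D.span_minimal by blast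
  have "{i \<in> I. carrier (M i) \<noteq> {\<zero>\<^bsub>M i\<^esub>}} \<subseteq> J"
  proof (rule subsetI, rule ccontr)
    fix i assume "i \<in> {i \<in> I. carrier (M i) \<noteq> {\<zero>\<^bsub>M i\<^esub>}}" and iJ: "i \<notin> J"
    then have i: "i \<in> I" "carrier (M i) \<noteq> {\<zero>\<^bsub>M i\<^esub>}" by auto
    have "x = \<zero>\<^bsub>M i\<^esub>" if x: "x \<in> carrier (M i)" for x
    proof -
      have "direct_sum_single I M i x \<in> N"
        using direct_sum_single_linear[of I R M, OF M i(1)] x DN by (auto simp: linear_map_def)
      then have "direct_sum_single I M i x i = \<zero>\<^bsub>M i\<^esub>" using i(1) iJ by (simp add: N_def)
      then show ?thesis using i(1) by (simp add: direct_sum_single_def)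
    qed
    moreover have "\<zero>\<^bsub>M i\<^esub> \<in> carrier (M i)" using M[OF i(1)] abelian_groupE(2) by (auto simp: module_def)
    ultimately show False using i by blast
  qed
  then show ?thesis using J finite_subset by blast
qed

lemma fg_direct_sum:
  assumes R: "cring R" and M: "\<And>i. i \<in> I \<Longrightarrow> module R (M i)" and fg: "\<And>i. i \<in> I \<Longrightarrow> fg_module R (M i)"
    and fin: "finite {i \<in> I. carrier (M i) \<noteq> {\<zero>\<^bsub>M i\<^esub>}}"
  shows "fg_module R (direct_sum I M)"
proof -
  let ?D = "direct_sum I M" and ?J = "{i \<in> I. carrier (M i) \<noteq> {\<zero>\<^bsub>M i\<^esub>}}"
  interpret D: module R ?D by (rule direct_sum_module[of R I M, OF R M])
  have ab: "abelian_group (M j)" if "j \<in> I" for j using M[OF that] by (simp add: module_def)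
  have "\<exists>S. S \<subseteq> carrier (M i) \<and> finite S \<and> carrier (M i) \<subseteq> module.span R (M i) S" if "i \<in> I" for i
    using fg[OF that] module.fg_module_iff_span[OF M[OF that]] by blast
  then obtain S where S: "\<And>i. i \<in> I \<Longrightarrow> S i \<subseteq> carrier (M i) \<and> finite (S i)
      \<and> carrier (M i) \<subseteq> module.span R (M i) (S i)"
    by metis
  define B where "B = (\<Union>i\<in>?J. direct_sum_single I M i ` S i)"
  have single: "direct_sum_single I M i x \<in> carrier ?D" if "i \<in> I" "x \<in> carrier (M i)" for i x
    using direct_sum_single_linear[of I R M, OF M that(1)] that(2) by (auto simp: linear_map_def)
  have "direct_sum_single I M i ` S i \<subseteq> carrier ?D" "finite (direct_sum_single I M i ` S i)" if "i \<in> I"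
      for i
    using S[OF that] single[OF that] by auto
  then have B: "B \<subseteq> carrier ?D" "finite B" using fin by (auto simp only: B_def intro!: finite_UN_I)
  note sub = D.span_submodule[OF B(1)]
  have gen: "direct_sum_single I M i x \<in> D.span B" if i: "i \<in> ?J" and x: "x \<in> carrier (M i)" for i x
  proof -
    have iI: "i \<in> I" using i by simp
    interpret Mi: module R "M i" by (rule M[OF iI])
    have "Mi.span (S i) \<subseteq> {x \<in> carrier (M i). direct_sum_single I M i x \<in> D.span B}"
      using S[OF iI] i D.span_superset[of B]
      by (intro Mi.span_minimal[OF linear_map_vimage_submodule[OF M[OF iI] D.module_axioms
        direct_sum_single_linear[of I R M, OF M iI] sub]])
        (auto simp: B_def)
    then show ?thesis using x S[OF iI] by blast
  qed
  \<comment> \<open>Induction over a finite set that contains the support, one component being split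
    off at a time.\<close>
  have "s \<in> D.span B" if "finite K" "K \<subseteq> ?J" "s \<in> carrier ?D" "\<And>i. i \<in> I - K \<Longrightarrow> s i = \<zero>\<^bsub>M i\<^esub>" for K s
    using that
  proof (induction K arbitrary: s rule: finite_induct)
    case empty
    then have "s = \<zero>\<^bsub>?D\<^esub>" by (auto simp: direct_sum_simps fun_eq_iff restrict_def PiE_iff
        extensional_def)
    then show ?case using D.submodule_zero[OF sub] by simp
  next
    case (insert i K)
    have iI: "i \<in> I" "i \<in> ?J" using insert.prems by auto
    have s: "s j \<in> carrier (M j)" if "j \<in> I" for j using insert.prems(2) that
        by (auto simp: direct_sum_simps)
    define t where "t = (\<lambda>j\<in>I. if j = i then \<zero>\<^bsub>M j\<^esub> else s j)"
    have "finite {j \<in> I. s j \<noteq> \<zero>\<^bsub>M j\<^esub>}" using insert.prems(2) by (simp add: direct_sum_simps)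
    then have "finite {j \<in> I. t j \<noteq> \<zero>\<^bsub>M j\<^esub>}" by (rule rev_finite_subset) (auto simp: t_def)
    then have "t \<in> carrier ?D" using s abelian_groupE(2)[OF ab] by (auto simp: direct_sum_simps t_def)
    moreover have "t j = \<zero>\<^bsub>M j\<^esub>" if "j \<in> I - K" for j
      using that insert.prems(3)[of j] by (auto simp: t_def)
    ultimately have t: "t \<in> D.span B" using insert.IH insert.prems by blast
    have "s = direct_sum_single I M i (s i) \<oplus>\<^bsub>?D\<^esub> t"
    proof
      fix j
      show "s j = (direct_sum_single I M i (s i) \<oplus>\<^bsub>?D\<^esub> t) j"
      proof (cases "j \<in> I")
        case True
        interpret Mj: abelian_group "M j" by (rule ab[OF True])
        interpret Mi: abelian_group "M i" by (rule ab[OF iI(1)])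
        show ?thesis using s[OF True] True by (cases "j = i")
            (simp_all add: direct_sum_simps direct_sum_single_def t_def)
      next
        case False
        then show ?thesis using insert.prems(2) by (auto simp: direct_sum_simps PiE_iff extensional_def)
      qed
    qed
    then show ?case using D.submodule_add[OF sub gen[OF iI(2) s[OF iI(1)]] t] by simp
  qed
  moreover have "s i = \<zero>\<^bsub>M i\<^esub>" if "s \<in> carrier ?D" "i \<in> I - ?J" for s i
    using that by (auto simp: direct_sum_simps)
  ultimately have "carrier ?D \<subseteq> D.span B" using fin by blast
  then show ?thesis using B D.fg_module_iff_span by blast
qed

subsection \<open>Objects with finitely generated Hom modules\<close>

locale noetherian_approximable_category = approximable_category k T \<kappa> \<tau> G A
  for k :: "('k, 'a) ring_scheme" and T :: "('o, 'm, 'k) tri_data" (structure)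
    and \<kappa> :: "'i rel" and \<tau> :: "'o tstr" and G :: 'o and A :: nat +
  assumes k_cring: "cring k" and k_noetherian: "noetherian_ring k"
    and compact_homs_fg: "\<lbrakk>X \<in> compact_objects \<kappa> T; Y \<in> compact_objects \<kappa> T\<rbrakk> \<Longrightarrow> fg_module k (Hom T X Y)"
begin

text \<open>Compact objects are closed under shifts, so this covers the maps to all shifts of
  \<open>t\<close>. Their vanishing for large shifts is kept separate and serves for
  boundedness.\<close>

definition hom_finite :: "'o \<Rightarrow> bool" where
  "hom_finite t \<longleftrightarrow> t \<in> Obj T \<and> (\<forall>c \<in> Cpt. fg_module k (Hom T c t))"

text \<open>Compact objects over \<open>X\<close> are represented by maps out of \<open>X\<close>
  with compact cone: a map killed by \<open>g\<close> factors through the fibre of \<open>g\<close>,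
  which is compact as well. In this form successive absorptions compose.\<close>

definition compact_cone_map :: "'m \<Rightarrow> 'o \<Rightarrow> 'o \<Rightarrow> bool" where
  "compact_cone_map g X Y \<longleftrightarrow> (\<exists>Q a b. Q \<in> Cpt \<and> Tri T X Y Q g a b)"

lemma compact_cone_map_arr: "compact_cone_map g X Y \<Longrightarrow> arr g X Y"
  unfolding compact_cone_map_def using Tri_arr by blast

lemma compact_cone_map_comp:
  assumes "compact_cone_map g X Y" "compact_cone_map g' Y Z"
  shows "compact_cone_map (g' \<bullet> g) X Z"
proof -
  obtain C a b C' a' b' where 1: "C \<in> Cpt" "Tri T X Y C g a b" and 2: "C' \<in> Cpt" "Tri T Y Z C' g' a' b'"
    using assms unfolding compact_cone_map_def by blast
  obtain C'' e l u v w where t: "Tri T X Z C'' (g' \<bullet> g) e l" "Tri T C C'' C' u v w"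
    using octahedron[OF 1(2) 2(2)] .
  have "tri C C'' C'" using t(2) by (auto simp: tri_def)
  then have "C'' \<in> Cpt" using compact_extension 1 2 by blast
  then show ?thesis using t(1) unfolding compact_cone_map_def by blast
qed

lemma compact_cone_map_id:
  assumes "X \<in> Obj T"
  shows "compact_cone_map (Ident T X) X X"
proof -
  obtain Z where Z: "is_zero_object T Z" using zero_object by blast
  have "tri G G Z" using TR1_Ident[OF G_Obj Z] unfolding tri_def by blast
  then have "Z \<in> Cpt" using compact_cone[OF _ G_Cpt G_Cpt] by blast
  then show ?thesis using TR1_Ident[OF assms Z] unfolding compact_cone_map_def by blast
qed

text \<open>Maps from a compact object make the triangle exact at \<open>Y\<close>, between finitely
  generated modules; the one at \<open>Q\<close> consists of maps between compact objects.\<close>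

lemma hom_finite_compact_cone:
  assumes "compact_cone_map g X Y" "hom_finite X"
  shows "hom_finite Y"
proof -
  obtain Q a b where Q: "Q \<in> Cpt" and t: "Tri T X Y Q g a b" using assms(1)
      unfolding compact_cone_map_def by blast
  note arrs = Tri_arr[OF t]
  have obj: "X \<in> Obj T" "Y \<in> Obj T" "Q \<in> Obj T" using arrs by auto
  have "fg_module k (Hom T c Y)" if c: "c \<in> Cpt" for c
  proof -
    have cO: "c \<in> Obj T" using compact_Obj[OF c] .
    show ?thesis
    proof (rule fg_module_exact[OF k_noetherian Hom_module[OF cO obj(1)] Hom_module[OF cO obj(2)]
          Hom_module[OF cO obj(3)] comp_linear_map[OF arrs(1) cO] comp_linear_map[OF arrs(2) cO]])
      fix y assume y: "y \<in> mor T c Y" "a \<bullet> y = zr c Q"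
      then have "arr y c Y" using cO obj by (simp add: arr_def)
      then obtain v where "arr v c X" "g \<bullet> v = y" using weak_kernel[OF t _ y(2)] by blast
      then show "y \<in> (\<lambda>f. g \<bullet> f) ` mor T c X" by auto
    qed (use assms(2) c Q compact_homs_fg in \<open>auto simp: hom_finite_def\<close>)
  qed
  then show ?thesis using obj by (simp add: hom_finite_def)
qed

text \<open>Each map is killed by passing to the cone of its current image; the cone of that passage
  is the shift of \<open>c\<close>, hence compact.\<close>

lemma kill_finite_set:
  assumes "finite S" "hom_finite t" "c \<in> Cpt" "\<And>x. x \<in> S \<Longrightarrow> arr x c t"
  shows "\<exists>t' g. compact_cone_map g t t' \<and> (\<forall>x\<in>S. g \<bullet> x = zr c t')"
  using assms(1,4)
proof (induction S rule: finite_induct)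
  case empty
  then show ?case using compact_cone_map_id assms(2) unfolding hom_finite_def by blast
next
  case (insert x S)
  then obtain t' g where g: "compact_cone_map g t t'" "\<forall>x\<in>S. g \<bullet> x = zr c t'" by blast
  note ga = compact_cone_map_arr[OF g(1)]
  have xa: "arr x c t" using insert.prems by simp
  have cO: "c \<in> Obj T" using compact_Obj[OF assms(3)] .
  obtain t'' g' h where t: "Tri T c t' t'' (g \<bullet> x) g' h" using Tri_cone[OF arr_comp[OF xa ga]] .
  have g': "compact_cone_map g' t' t''"
    using Tri_rotate[OF t] compact_Shift_iff[OF cO] assms(3) unfolding compact_cone_map_def by blast
  note ga' = compact_cone_map_arr[OF g']
  have "(g' \<bullet> g) \<bullet> y = zr c t''" if y: "y \<in> insert x S" for y
  proof -
    have "(g' \<bullet> g) \<bullet> y = g' \<bullet> (g \<bullet> y)" using comp_assoc[OF insert.prems[OF y] ga ga'] .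
    also have "\<dots> = zr c t''"
      using y g(2) Tri_comp_zero[OF t] comp_zero_right[OF ga' cO] by auto
    finally show ?thesis .
  qed
  then show ?case using compact_cone_map_comp[OF g(1) g'] by blast
qed

text \<open>The maps killed by \<open>g\<close> form a submodule, so it is enough to kill finitely
  many generators.\<close>

lemma kill_compact:
  assumes "hom_finite t" "c \<in> Cpt"
  shows "\<exists>t' g. compact_cone_map g t t' \<and> (\<forall>x. arr x c t \<longrightarrow> g \<bullet> x = zr c t')"
proof -
  have obj: "c \<in> Obj T" "t \<in> Obj T" using assms compact_Obj by (auto simp: hom_finite_def)
  interpret M: module k "Hom T c t" by (rule Hom_module[OF obj])
  obtain S where S: "S \<subseteq> mor T c t" "finite S" "mor T c t \<subseteq> M.span S"
    using assms M.fg_module_iff_span unfolding hom_finite_def by blast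
  have "arr x c t" if "x \<in> S" for x using S(1) that obj by (auto simp: arr_def)
  then obtain t' g where g: "compact_cone_map g t t'" "\<forall>x\<in>S. g \<bullet> x = zr c t'"
    using kill_finite_set[OF S(2) assms] by blast
  note ga = compact_cone_map_arr[OF g(1)]
  have t': "t' \<in> Obj T" using ga by auto
  interpret N: module k "Hom T c t'" by (rule Hom_module[OF obj(1) t'])
  have "submodule {zr c t'} k (Hom T c t')" by (intro N.submoduleI') auto
  then have "submodule {x \<in> mor T c t. g \<bullet> x \<in> {zr c t'}} k (Hom T c t)"
    by (rule linear_map_vimage_submodule[OF M.module_axioms N.module_axioms comp_linear_map[OF ga
      obj(1)]])
  then have "M.span S \<subseteq> {x \<in> mor T c t. g \<bullet> x \<in> {zr c t'}}" using S(1) g(2)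
      by (intro M.span_minimal) auto
  then have "\<forall>x. arr x c t \<longrightarrow> g \<bullet> x = zr c t'" using S(3) by blast
  then show ?thesis using g(1) by blast
qed

lemma kill_shifts:
  assumes "finite J" "hom_finite t"
  shows "\<exists>t' g. compact_cone_map g t t' \<and> (\<forall>i\<in>J. \<forall>x. arr x (shift_pow T i G) t \<longrightarrow> g \<bullet> x
      = zr (shift_pow T i G) t')"
  using assms(1)
proof (induction J rule: finite_induct)
  case empty
  then show ?case using compact_cone_map_id assms(2) unfolding hom_finite_def by blast
next
  case (insert j J)
  then obtain t' g where g: "compact_cone_map g t t'"
    "\<forall>i\<in>J. \<forall>x. arr x (shift_pow T i G) t \<longrightarrow> g \<bullet> x = zr (shift_pow T i G) t'" by blast
  obtain t'' g' where g': "compact_cone_map g' t' t''"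
    "\<forall>x. arr x (shift_pow T j G) t' \<longrightarrow> g' \<bullet> x = zr (shift_pow T j G) t''"
    using kill_compact[OF hom_finite_compact_cone[OF g(1) assms(2)] G_shift_Cpt] by blast
  note ga = compact_cone_map_arr[OF g(1)] and ga' = compact_cone_map_arr[OF g'(1)]
  have "(g' \<bullet> g) \<bullet> x = zr (shift_pow T i G) t''" if i: "i \<in> insert j J"
      and x: "arr x (shift_pow T i G) t" for i x
  proof -
    have "(g' \<bullet> g) \<bullet> x = g' \<bullet> (g \<bullet> x)" using comp_assoc[OF x ga ga'] .
    also have "\<dots> = zr (shift_pow T i G) t''"
    proof (cases "i = j")
      case True
      then show ?thesis using g'(2) arr_comp[OF x ga] by simp
    next
      case False
      then have "g \<bullet> x = zr (shift_pow T i G) t'" using i g(2) x by simp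
      then show ?thesis using comp_zero_right[OF ga' shift_pow_Obj[OF G_Obj]] by simp
    qed
    finally show ?thesis .
  qed
  then show ?case using compact_cone_map_comp[OF g(1) g'(1)] by blast
qed

lemma retract_kill:
  assumes "retract X Y" "arr g t t'" "\<And>y. arr y Y t \<Longrightarrow> g \<bullet> y = zr Y t'" "arr x X t"
  shows "g \<bullet> x = zr X t'"
proof -
  obtain i p where ip: "arr i X Y" "arr p Y X" "p \<bullet> i = Ident T X" using assms(1)
      by (auto simp: retract_def)
  have t': "t' \<in> Obj T" using assms(2) by auto
  have "x = (x \<bullet> p) \<bullet> i" using comp_assoc[OF ip(1,2) assms(4)] ip(3) comp_id_right[OF assms(4)] by simp
  then have "g \<bullet> x = (g \<bullet> (x \<bullet> p)) \<bullet> i"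
    using comp_assoc[OF ip(1) arr_comp[OF ip(2) assms(4)] assms(2)] by simp
  also have "\<dots> = zr X t'"
    using assms(3)[OF arr_comp[OF ip(2) assms(4)]] comp_zero_left[OF ip(1) t'] by simp
  finally show ?thesis .
qed

text \<open>Ghost lemma: a composite of \<open>n\<close> maps, each killing the maps from the given shifts of \<open>G\<close>,
  kills the maps from objects built in \<open>n\<close> steps. Each of the maps can be chosen with compact cone,
  the generators of the modules involved being killed one after the other.\<close>

lemma absorb:
  assumes "hom_finite t"
  shows "\<exists>t' g. compact_cone_map g t t' \<and> (\<forall>X \<in> building \<kappa> T {G} a b n. \<forall>x. arr x X t \<longrightarrow> g \<bullet> x
      = zr X t')"
proof -
  have base: "\<exists>t' g. compact_cone_map g t t' \<and> (\<forall>X \<in> building \<kappa> T {G} a b (Suc 0). \<forall>x. arr x X t \<longrightarrow> g \<bullet> x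
      = zr X t')"
    if t: "hom_finite t" for t
  proof -
    obtain t' g where g: "compact_cone_map g t t'"
      "\<forall>i\<in>{a..b}. \<forall>x. arr x (shift_pow T i G) t \<longrightarrow> g \<bullet> x = zr (shift_pow T i G) t'"
      using kill_shifts[of "{a..b}", OF _ t] by blast
    note ga = compact_cone_map_arr[OF g(1)]
    have t': "t' \<in> Obj T" using ga by auto
    have "g \<bullet> x = zr X t'" if X: "X \<in> building \<kappa> T {G} a b (Suc 0)" and x: "arr x X t" for X x
    proof -
      obtain I :: "'i set" and F \<iota> where c: "is_coproduct T I F X \<iota>"
        and F: "\<forall>l\<in>I. \<exists>i\<in>{a..b}. \<exists>s\<in>{G}. \<exists>A. summand T A s \<and> F l = shift_pow T i A"
        using X by auto
      show ?thesis
      proof (rule coproduct_eqI[OF c arr_comp[OF x ga] arr_zero])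
        show "X \<in> Obj T" "t' \<in> Obj T" using x t' by auto
        fix l assume l: "l \<in> I"
        obtain i B where i: "i \<in> {a..b}" "summand T B G" "F l = shift_pow T i B" using F l by blast
        have r: "retract (F l) (shift_pow T i G)"
            using summand_retract[OF summand_shift_pow[OF i(2)]] i(3) by simp
        note \<iota>l = coproduct_arr[OF c l]
        have "(g \<bullet> x) \<bullet> \<iota> l = g \<bullet> (x \<bullet> \<iota> l)" using comp_assoc[OF \<iota>l x ga] .
        also have "\<dots> = zr (F l) t'" using retract_kill[OF r ga _ arr_comp[OF \<iota>l x]] g(2) i(1) by blast
        also have "\<dots> = zr X t' \<bullet> \<iota> l" using comp_zero_left[OF \<iota>l t'] by simp
        finally show "(g \<bullet> x) \<bullet> \<iota> l = zr X t' \<bullet> \<iota> l" .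
      qed
    qed
    then show ?thesis using g(1) by blast
  qed
  show ?thesis
  proof (cases n)
    case 0
    then show ?thesis using compact_cone_map_id assms unfolding hom_finite_def by auto
  next
    case (Suc m)
    have "\<exists>t' g. compact_cone_map g t t' \<and> (\<forall>X \<in> building \<kappa> T {G} a b (Suc m). \<forall>x. arr x X t \<longrightarrow> g \<bullet> x
        = zr X t')"
      if "hom_finite t" for t
      using that
    proof (induction m arbitrary: t)
      case 0
      then show ?case by (rule base)
    next
      case (Suc m)
      obtain t1 g1 where g1: "compact_cone_map g1 t t1"
        "\<forall>X \<in> building \<kappa> T {G} a b (Suc 0). \<forall>x. arr x X t \<longrightarrow> g1 \<bullet> x = zr X t1" using base[OF Suc.prems]
          by blast
      obtain t2 g2 where g2: "compact_cone_map g2 t1 t2"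
        "\<forall>X \<in> building \<kappa> T {G} a b (Suc m). \<forall>x. arr x X t1 \<longrightarrow> g2 \<bullet> x = zr X t2"
        using Suc.IH[OF hom_finite_compact_cone[OF g1(1) Suc.prems]] by blast
      note ga1 = compact_cone_map_arr[OF g1(1)] and ga2 = compact_cone_map_arr[OF g2(1)]
      have t2: "t2 \<in> Obj T" using ga2 by auto
      have "(g2 \<bullet> g1) \<bullet> x = zr X t2" if X: "X \<in> building \<kappa> T {G} a b (Suc (Suc m))" and x: "arr x X t"
          for X x
      proof -
        obtain Y X' X'' f u h where Y: "summand T X Y" "Tri T X' Y X'' f u h"
          "X' \<in> building \<kappa> T {G} a b (Suc 0)" "X'' \<in> building \<kappa> T {G} a b (Suc m)"
          using X unfolding building.simps(3) by blast
        note arrs = Tri_arr[OF Y(2)]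
        have "(g2 \<bullet> g1) \<bullet> y = zr Y t2" if y: "arr y Y t" for y
        proof -
          \<comment> \<open>With the restriction to \<open>X'\<close> killed by \<open>g1\<close>,
            the map \<open>g1 \<bullet> y\<close> factors through \<open>X''\<close>, where
            \<open>g2\<close> acts.\<close>
          have "(g1 \<bullet> y) \<bullet> f = zr X' t1"
            using comp_assoc[OF arrs(1) y ga1] g1(2) Y(3) arr_comp[OF arrs(1) y] by simp
          then obtain w where w: "arr w X'' t1" "w \<bullet> u = g1 \<bullet> y"
            using weak_cokernel[OF Y(2) arr_comp[OF y ga1]] by blast
          have "(g2 \<bullet> g1) \<bullet> y = (g2 \<bullet> w) \<bullet> u"
            using comp_assoc[OF y ga1 ga2] comp_assoc[OF arrs(2) w(1) ga2] w(2) by simp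
          also have "\<dots> = zr Y t2" using g2(2) Y(4) w(1) comp_zero_left[OF arrs(2) t2] by simp
          finally show ?thesis .
        qed
        then show ?thesis using retract_kill[OF summand_retract[OF Y(1)] arr_comp[OF ga1 ga2]] x
            by blast
      qed
      then show ?case using compact_cone_map_comp[OF g1(1) g2(1)] by blast
    qed
    then show ?thesis using assms Suc by blast
  qed
qed

text \<open>The factorization through \<open>\<delta> M\<close> makes \<open>g\<close> vanish on the
  fibre of \<open>\<delta> M\<close>, without that fibre being described as a built object. In each
  step the map on \<open>E M\<close> is absorbed, and what results extends over the cone
  \<open>D (Suc M)\<close>.\<close>

lemma absorb_chain:
  assumes t: "hom_finite (D 0)" and tri: "\<And>n. Tri T (E n) (D n) (D (Suc n)) (e n) (d n) (h n)"
    and E: "\<And>n. E n \<in> building \<kappa> T {G} (a n) (b n) (s n)"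
    and \<delta>: "\<delta> 0 = Ident T (D 0)" "\<And>n. \<delta> (Suc n) = d n \<bullet> \<delta> n" "\<And>n. arr (\<delta> n) (D 0) (D n)"
  shows "\<exists>t' g q. compact_cone_map g (D 0) t' \<and> arr q (D M) t' \<and> g = q \<bullet> \<delta> M"
proof (induction M)
  case 0
  have "D 0 \<in> Obj T" using t by (simp add: hom_finite_def)
  then show ?case using compact_cone_map_id arr_id comp_id_left[OF arr_id] \<delta>(1) by metis
next
  case (Suc M)
  then obtain t1 g q where g: "compact_cone_map g (D 0) t1" and q: "arr q (D M) t1" "g = q \<bullet> \<delta> M"
      by blast
  note arrs = Tri_arr[OF tri]
  obtain t2 g2 where g2: "compact_cone_map g2 t1 t2"
    "\<forall>X \<in> building \<kappa> T {G} (a M) (b M) (s M). \<forall>x. arr x X t1 \<longrightarrow> g2 \<bullet> x = zr X t2"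
    using absorb[OF hom_finite_compact_cone[OF g t]] by blast
  note ga2 = compact_cone_map_arr[OF g2(1)]
  have "(g2 \<bullet> q) \<bullet> e M = zr (E M) t2"
    using comp_assoc[OF arrs(1) q(1) ga2] g2(2) E arr_comp[OF arrs(1) q(1)] by simp
  then obtain q' where q': "arr q' (D (Suc M)) t2" "q' \<bullet> d M = g2 \<bullet> q"
    using weak_cokernel[OF tri arr_comp[OF q(1) ga2]] by blast
  have "g2 \<bullet> g = q' \<bullet> \<delta> (Suc M)"
    using comp_assoc[OF \<delta>(3) q(1) ga2] comp_assoc[OF \<delta>(3) arrs(2) q'(1)] q'(2) q(2) \<delta>(2) by simp
  then show ?case using compact_cone_map_comp[OF g g2(1)] q'(1) by blast
qed

subsection \<open>Compact approximations\<close>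

text \<open>\<open>coaisle_iso \<iota> C' C\<close> is what is needed of a map whose cone lies in \<open>L 0\<close>.\<close>

definition coaisle_iso :: "'m \<Rightarrow> 'o \<Rightarrow> 'o \<Rightarrow> bool" where
  "coaisle_iso \<iota> C' C \<longleftrightarrow> arr \<iota> C' C \<and> (\<forall>Y \<in> R 1.
     (\<forall>\<phi>. arr \<phi> C Y \<longrightarrow> \<phi> \<bullet> \<iota> = zr C' Y \<longrightarrow> \<phi> = zr C Y) \<and>
     (\<forall>\<psi>. arr \<psi> (Shift T C') Y \<longrightarrow> (\<exists>\<phi>. arr \<phi> (Shift T C) Y \<and> \<phi> \<bullet> ShiftM T \<iota> = \<psi>)))"

lemma coaisle_iso_id: "C \<in> Obj T \<Longrightarrow> coaisle_iso (Ident T C) C C"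
  unfolding coaisle_iso_def using comp_id_right arr_id[of C] by (auto simp: ShiftM_Ident)

text \<open>Both halves of the condition compose by themselves, so no cone of a composite has to be
  formed.\<close>

lemma coaisle_iso_comp:
  assumes "coaisle_iso \<iota>' C'' C'" "coaisle_iso \<iota> C' C"
  shows "coaisle_iso (\<iota> \<bullet> \<iota>') C'' C"
proof -
  have a: "arr \<iota>' C'' C'" "arr \<iota> C' C" using assms by (auto simp: coaisle_iso_def)
  have "\<phi> = zr C Y" if Y: "Y \<in> R 1" and \<phi>: "arr \<phi> C Y" "\<phi> \<bullet> (\<iota> \<bullet> \<iota>') = zr C'' Y" for Y \<phi>
  proof -
    have "(\<phi> \<bullet> \<iota>) \<bullet> \<iota>' = zr C'' Y" using comp_assoc[OF a \<phi>(1)] \<phi>(2) by simp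
    then have "\<phi> \<bullet> \<iota> = zr C' Y" using assms(1) Y arr_comp[OF a(2) \<phi>(1)] unfolding coaisle_iso_def
        by blast
    then show ?thesis using assms(2) Y \<phi>(1) unfolding coaisle_iso_def by blast
  qed
  moreover have "\<exists>\<phi>. arr \<phi> (Shift T C) Y \<and> \<phi> \<bullet> ShiftM T (\<iota> \<bullet> \<iota>') = \<psi>"
    if Y: "Y \<in> R 1" and \<psi>: "arr \<psi> (Shift T C'') Y" for Y \<psi>
  proof -
    obtain \<phi>' where \<phi>': "arr \<phi>' (Shift T C') Y" "\<phi>' \<bullet> ShiftM T \<iota>' = \<psi>"
      using assms(1) Y \<psi> unfolding coaisle_iso_def by blast
    obtain \<phi> where \<phi>: "arr \<phi> (Shift T C) Y" "\<phi> \<bullet> ShiftM T \<iota> = \<phi>'"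
      using assms(2) Y \<phi>'(1) unfolding coaisle_iso_def by blast
    then show ?thesis
      using comp_assoc[OF arr_shift[OF a(1)] arr_shift[OF a(2)] \<phi>(1)] \<phi>'(2) ShiftM_comp[OF a] by auto
  qed
  ultimately show ?thesis using arr_comp[OF a] unfolding coaisle_iso_def by blast
qed

text \<open>Both halves are pieces of the long exact sequence of maps to \<open>Y\<close>, in which
  the terms at \<open>P\<close> vanish.\<close>

lemma coaisle_iso_fibre:
  assumes t: "Tri T C' C P \<iota> p h" and P: "P \<in> L 0"
  shows "coaisle_iso \<iota> C' C"
proof -
  note arrs = Tri_arr[OF t]
  have "\<phi> = zr C Y" if Y: "Y \<in> R 1" and \<phi>: "arr \<phi> C Y" "\<phi> \<bullet> \<iota> = zr C' Y" for Y \<phi>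
  proof -
    obtain v where v: "arr v P Y" "v \<bullet> p = \<phi>" using weak_cokernel[OF t \<phi>] by blast
    have "v = zr P Y" using hom_zeroD[OF orth[OF P Y] v(1)] by simp
    then show ?thesis using v(2) comp_zero_left[OF arrs(2) R_Obj[OF Y]] by simp
  qed
  moreover have "\<exists>\<phi>. arr \<phi> (Shift T C) Y \<and> \<phi> \<bullet> ShiftM T \<iota> = \<psi>"
    if Y: "Y \<in> R 1" and \<psi>: "arr \<psi> (Shift T C') Y" for Y \<psi>
  proof -
    have "\<psi> \<bullet> h = zr P Y" using hom_zeroD[OF orth[OF P Y]] arr_comp[OF arrs(3) \<psi>] by simp
    then show ?thesis using weak_cokernel3[OF t \<psi>] by blast
  qed
  ultimately show ?thesis using arrs(1) unfolding coaisle_iso_def by blast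
qed

text \<open>The bound on \<open>a\<close> places all shifts of \<open>G\<close> involved in
  \<open>L 0\<close>, so passing to the fibre of a map to one of them is allowed. Compactness leaves
  finitely many components of a map into a coproduct to be treated. For a triangle the composite to
  the right end is killed, then the map is lifted to the left end and killed there.\<close>

lemma kill_into_building:
  assumes "X \<in> building \<kappa> T {G} a b n" "int A \<le> a" "C \<in> Cpt" "arr x C X"
  shows "\<exists>C' \<iota>. C' \<in> Cpt \<and> coaisle_iso \<iota> C' C \<and> x \<bullet> \<iota> = zr C' X"
  using assms(1,3,4)
proof (induction arbitrary: C x rule: building_induct_Suc)
  case (coproduct I F X \<iota>)
  note c = \<open>is_coproduct T I F X \<iota>\<close>
  have CO: "C \<in> Obj T" and XO: "X \<in> Obj T" using coproduct.prems by auto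
  obtain J e where J: "finite J" "J \<subseteq> I" and e: "coproduct_part I F X \<iota> J e" "e \<bullet> x = x"
    using compact_part[OF coproduct.prems(1) coproduct.hyps(1) c coproduct.prems(2)] by blast
  have "\<exists>p. arr p X (F j) \<and> p \<bullet> \<iota> j = Ident T (F j) \<and> (\<forall>i\<in>I. i \<noteq> j \<longrightarrow> p \<bullet> \<iota> i = zr (F i) (F j))"
    if "j \<in> I" for j
    using coproduct_projection[OF c that] by metis
  then obtain p where p: "\<And>j. j \<in> I \<Longrightarrow> arr (p j) X (F j)" "\<And>j. j \<in> I \<Longrightarrow> p j \<bullet> \<iota> j = Ident T (F j)"
      "\<And>i j. \<lbrakk>i \<in> I; j \<in> I; i \<noteq> j\<rbrakk> \<Longrightarrow> p j \<bullet> \<iota> i = zr (F i) (F j)"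
    by metis
  have "\<exists>C' \<kappa>'. C' \<in> Cpt \<and> coaisle_iso \<kappa>' C' C \<and> (\<forall>j\<in>K. p j \<bullet> (x \<bullet> \<kappa>') = zr C' (F j))"
    if "finite K" "K \<subseteq> I" for K
    using that
  proof (induction K rule: finite_induct)
    case empty
    then show ?case using coaisle_iso_id[OF CO] coproduct.prems(1) by blast
  next
    case (insert l K)
    then obtain C1 u where u: "C1 \<in> Cpt" "coaisle_iso u C1 C" "\<forall>j\<in>K. p j \<bullet> (x \<bullet> u) = zr C1 (F j)"
        by blast
    have l: "l \<in> I" using insert.prems by simp
    obtain i B where i: "i \<in> {a..b}" "summand T B G" "F l = shift_pow T i B" using coproduct.hyps(3) l
        by blast
    obtain r s where rs: "arr r (F l) (shift_pow T i G)" "arr s (shift_pow T i G) (F l)"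
        "s \<bullet> r = Ident T (F l)"
      using summand_retract[OF summand_shift_pow[OF i(2), of i]] i(3) by (auto simp: retract_def)
    have ua: "arr u C1 C" using u(2) by (simp add: coaisle_iso_def)
    have xu: "arr (x \<bullet> u) C1 X" using arr_comp[OF ua coproduct.prems(2)] .
    have y: "arr (p l \<bullet> (x \<bullet> u)) C1 (F l)" using arr_comp[OF xu p(1)[OF l]] .
    \<comment> \<open>The target is the full shift of \<open>G\<close>, known to be compact and in
      the aisle, rather than its retract \<open>F l\<close>; composing with \<open>s\<close>
      afterwards recovers vanishing in \<open>F l\<close>.\<close>
    obtain C2 v h where v: "Tri T C2 C1 (shift_pow T i G) v (r \<bullet> (p l \<bullet> (x \<bullet> u))) h"
      using Tri_fibre[OF arr_comp[OF y rs(1)]] .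
    note va = Tri_arr(1)[OF v]
    have C2: "C2 \<in> Obj T" using va by auto
    have "tri C2 C1 (shift_pow T i G)" using v by (auto simp: tri_def)
    then have "C2 \<in> Cpt" using compact_fibre[OF _ u(1) G_shift_Cpt] by blast
    moreover have "shift_pow T i G \<in> L 0" using G_shift_L[of i 0] i(1) assms(2) by simp
    then have "coaisle_iso (u \<bullet> v) C2 C" using coaisle_iso_comp[OF coaisle_iso_fibre[OF v] u(2)]
        by blast
    moreover have "p j \<bullet> (x \<bullet> (u \<bullet> v)) = zr C2 (F j)" if j: "j \<in> insert l K" for j
    proof -
      have jI: "j \<in> I" using j insert.prems by blast
      have eq: "p j \<bullet> (x \<bullet> (u \<bullet> v)) = (p j \<bullet> (x \<bullet> u)) \<bullet> v"
        using comp_assoc[OF va ua coproduct.prems(2)] comp_assoc[OF va xu p(1)[OF jI]] by simp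
      show ?thesis
      proof (cases "j = l")
        case True
        let ?y = "p l \<bullet> (x \<bullet> u)"
        have "?y \<bullet> v = (s \<bullet> r) \<bullet> (?y \<bullet> v)" using rs(3) comp_id_left[OF arr_comp[OF va y]] by simp
        also have "\<dots> = s \<bullet> ((r \<bullet> ?y) \<bullet> v)"
          using comp_assoc[OF arr_comp[OF va y] rs(1,2)] comp_assoc[OF va y rs(1)] by simp
        also have "\<dots> = zr C2 (F l)" using Tri_comp_zero[OF v] comp_zero_right[OF rs(2) C2] by simp
        finally show ?thesis using eq True by simp
      next
        case False
        then have "p j \<bullet> (x \<bullet> u) = zr C1 (F j)" using j u(3) by simp
        moreover have "F j \<in> Obj T" using p(1)[OF jI] by auto
        ultimately show ?thesis using eq comp_zero_left[OF va] by simp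
      qed
    qed
    ultimately show ?case by blast
  qed
  then obtain C' u where u: "C' \<in> Cpt" "coaisle_iso u C' C" "\<forall>j\<in>J. p j \<bullet> (x \<bullet> u) = zr C' (F j)"
    using J by blast
  have ua: "arr u C' C" using u(2) by (simp add: coaisle_iso_def)
  have xu: "arr (x \<bullet> u) C' X" using arr_comp[OF ua coproduct.prems(2)] .
  have C'O: "C' \<in> Obj T" using ua by auto
  interpret CX: abelian_group "Hom T C' X" by (rule Hom_abelian_group[OF C'O XO])
  have ea: "arr e X X" using e by (simp add: coproduct_part_def)
  have ip: "arr (\<iota> j \<bullet> p j) X X" if "j \<in> J" for j using arr_comp[OF p(1) coproduct_arr[OF c]] J that
      by blast
  have e_eq: "e = (\<Oplus>\<^bsub>Hom T X X\<^esub>j\<in>J. \<iota> j \<bullet> p j)"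
    using J p by (intro coproduct_part_eq[OF c e(1)] coproduct_part_finsum[OF c J]) auto
  have "x \<bullet> u = e \<bullet> (x \<bullet> u)" using comp_assoc[OF ua coproduct.prems(2) ea] e(2) by simp
  also have "\<dots> = (\<Oplus>\<^bsub>Hom T C' X\<^esub>j\<in>J. (\<iota> j \<bullet> p j) \<bullet> (x \<bullet> u))"
    using linear_map_finsum[OF Hom_module[OF XO XO] Hom_module[OF C'O XO] precomp_linear_map[OF xu XO]
      J(1),
        of "\<lambda>j. \<iota> j \<bullet> p j"] ip e_eq by auto
  also have "\<dots> = zr C' X"
  proof (rule CX.add.finprod_one_eqI)
    fix j assume j: "j \<in> J"
    then have jI: "j \<in> I" using J by blast
    show "(\<iota> j \<bullet> p j) \<bullet> (x \<bullet> u) = zr C' X"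
      using comp_assoc[OF xu p(1)[OF jI] coproduct_arr[OF c jI]] u(3) j
        comp_zero_right[OF coproduct_arr[OF c jI] C'O] by simp
  qed
  finally show ?case using u by blast
next
  case (extension n X Y X' X'')
  obtain f g h where t: "Tri T X' Y X'' f g h" using extension.hyps(2) unfolding tri_def by blast
  note arrs = Tri_arr[OF t]
  obtain i p where ip: "arr i X Y" "arr p Y X" "p \<bullet> i = Ident T X"
    using summand_retract[OF extension.hyps(1)] by (auto simp: retract_def)
  have ix: "arr (i \<bullet> x) C Y" using arr_comp[OF extension.prems(2) ip(1)] .
  obtain C1 u where u: "C1 \<in> Cpt" "coaisle_iso u C1 C" "(g \<bullet> (i \<bullet> x)) \<bullet> u = zr C1 X''"
    using extension.IH(2)[OF extension.prems(1) arr_comp[OF ix arrs(2)]] by blast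
  have ua: "arr u C1 C" using u(2) by (simp add: coaisle_iso_def)
  have ixu: "arr ((i \<bullet> x) \<bullet> u) C1 Y" using arr_comp[OF ua ix] .
  have "g \<bullet> ((i \<bullet> x) \<bullet> u) = zr C1 X''" using comp_assoc[OF ua ix arrs(2)] u(3) by simp
  then obtain w where w: "arr w C1 X'" "f \<bullet> w = (i \<bullet> x) \<bullet> u" using weak_kernel[OF t ixu] by blast
  obtain C2 v where v: "C2 \<in> Cpt" "coaisle_iso v C2 C1" "w \<bullet> v = zr C2 X'"
    using extension.IH(1)[OF u(1) w(1)] by blast
  have va: "arr v C2 C1" using v(2) by (simp add: coaisle_iso_def)
  have C2: "C2 \<in> Obj T" using va by auto
  have uv: "arr (u \<bullet> v) C2 C" using arr_comp[OF va ua] .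
  have xuv: "arr (x \<bullet> (u \<bullet> v)) C2 X" using arr_comp[OF uv extension.prems(2)] .
  have "i \<bullet> (x \<bullet> (u \<bullet> v)) = ((i \<bullet> x) \<bullet> u) \<bullet> v"
    using comp_assoc[OF uv extension.prems(2) ip(1)] comp_assoc[OF va ua ix] by simp
  also have "\<dots> = f \<bullet> (w \<bullet> v)" using comp_assoc[OF va w(1) arrs(1)] w(2) by simp
  also have "\<dots> = zr C2 Y" using v(3) comp_zero_right[OF arrs(1) C2] by simp
  finally have 0: "i \<bullet> (x \<bullet> (u \<bullet> v)) = zr C2 Y" .
  have "x \<bullet> (u \<bullet> v) = p \<bullet> (i \<bullet> (x \<bullet> (u \<bullet> v)))"
    using comp_assoc[OF xuv ip(1,2)] ip(3) comp_id_left[OF xuv] by simp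
  also have "\<dots> = zr C2 X" unfolding 0 by (rule comp_zero_right[OF ip(2) C2])
  finally show ?case using v(1) coaisle_iso_comp[OF v(2) u(2)] by blast
qed

text \<open>With \<open>M = 2 A + 1\<close>, the fibre \<open>C\<close> of a suitable map out of \<open>t\<close> absorbs the fibre \<open>F\<close> of
  \<open>t \<rightarrow> D M\<close>. A compact \<open>C' \<rightarrow> C\<close> with cone in \<open>L 0\<close> maps back to \<open>F\<close>, and \<open>F \<in> L 0\<close> makes the
  map \<open>C' \<rightarrow> F \<rightarrow> C\<close> that is subtracted from \<open>C' \<rightarrow> C\<close> invisible to the coaisle. Its cone is the
  approximation.\<close>

lemma compact_approximation:
  assumes tL: "t \<in> L 0" and fin: "hom_finite t"
  shows "\<exists>K D. tri K t D \<and> K \<in> Cpt \<and> D \<in> L (- 1)"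
proof -
  \<comment> \<open>From \<open>2 * A\<close> on, the shifts of \<open>G\<close> in
    \<open>E n\<close> are of order at least \<open>A\<close>, as \<open>kill_into_building\<close>
    demands; positivity of \<open>M\<close> puts \<open>D M\<close> into
    \<open>L (- 1)\<close>.\<close>
  define M where "M = 2 * A + 1"
  obtain D E e d h where D0: "D 0 = t" and tr: "\<And>n. Tri T (E n) (D n) (D (Suc n)) (e n) (d n) (h n)"
    and D: "\<And>n. D n \<in> L (- int n)" and E: "\<And>n. E n \<in> building \<kappa> T {G} (int n - int A) (int n + int A) A"
    by (rule approximation_chain[OF tL]) (rule that)
  note arrs = Tri_arr[OF tr]
  obtain \<delta> where \<delta>: "\<delta> 0 = Ident T (D 0)" "\<And>n. \<delta> (Suc n) = d n \<bullet> \<delta> n" "\<And>n. arr (\<delta> n) (D 0) (D n)"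
    by (rule chain_composite[of d D, OF arrs(2)]) (rule that)
  have \<delta>a: "arr (\<delta> n) t (D n)" for n using \<delta>(3) D0 by simp
  obtain t' g q where g: "compact_cone_map g t t'" and q: "arr q (D M) t'" "g = q \<bullet> \<delta> M"
    using absorb_chain[of D E e d h, OF _ tr E \<delta>, of M] fin D0 by auto
  obtain Q a b where Q: "Q \<in> Cpt" "Tri T t t' Q g a b" using g unfolding compact_cone_map_def by blast
  obtain C where C: "C \<in> Obj T" "Q = Shift T C" using Shift_surj compact_Obj[OF Q(1)] by blast
  obtain f where f: "Tri T C t t' f g a" using Tri_unrotate[OF Q(2) C] by blast
  have CC: "C \<in> Cpt" using Q C compact_Shift_iff[of C \<kappa>] by simp
  note fa = Tri_arr(1)[OF f] and ga = Tri_arr(2)[OF f]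
  obtain F u l where F: "Tri T F t (D M) u (\<delta> M) l" using Tri_fibre[OF \<delta>a] .
  note ua = Tri_arr(1)[OF F]
  have FO: "F \<in> Obj T" and tO: "t \<in> Obj T" using ua by auto
  have "tri F t (D M)" using F by (auto simp: tri_def)
  moreover have "D M \<in> L (0 - 1)" using L_mono[OF _ D[of M], of "-1"] by (simp add: M_def)
  ultimately have FL: "F \<in> L 0" using L_fibre tL by blast
  have "g \<bullet> u = zr F t'"
    using q(2) comp_assoc[OF ua \<delta>a q(1)] Tri_comp_zero[OF F] comp_zero_right[OF q(1) FO] by simp
  then obtain v where v: "arr v F C" "f \<bullet> v = u" using weak_kernel[OF f ua] by blast
  \<comment> \<open>The descent starts at an index where \<open>C\<close> has no maps to the chain
    for reasons of depth; each step back towards \<open>M\<close> is paid for by changing the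
    source.\<close>
  obtain n0 where n0: "\<And>Y. Y \<in> L n0 \<Longrightarrow> hom_zero C Y" using compact_orth[OF CC] by blast
  define N where "N = max M (nat (- n0))"
  have "hom_zero C (D N)" by (rule n0, rule L_mono[OF _ D]) (simp add: N_def)
  then have N0: "\<delta> N \<bullet> f = zr C (D N)" using hom_zeroD arr_comp[OF fa \<delta>a] by blast
  have "\<exists>C' \<iota>. C' \<in> Cpt \<and> coaisle_iso \<iota> C' C \<and> (\<delta> n \<bullet> f) \<bullet> \<iota> = zr C' (D n)" if "M \<le> n" "n \<le> N" for n
    using that(2,1)
  proof (induction n rule: inc_induct)
    case base
    have "(\<delta> N \<bullet> f) \<bullet> Ident T C = zr C (D N)"
      unfolding comp_id_right[OF arr_comp[OF fa \<delta>a]] by (rule N0)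
    then show ?case using CC coaisle_iso_id[OF C(1)] by blast
  next
    case (step n)
    then obtain C1 \<iota> where \<iota>: "C1 \<in> Cpt" "coaisle_iso \<iota> C1 C" "(\<delta> (Suc n) \<bullet> f) \<bullet> \<iota> = zr C1 (D (Suc n))"
        by auto
    have \<iota>a: "arr \<iota> C1 C" using \<iota>(2) by (simp add: coaisle_iso_def)
    note x = arr_comp[OF \<iota>a arr_comp[OF fa \<delta>a[of n]]]
    have "d n \<bullet> ((\<delta> n \<bullet> f) \<bullet> \<iota>) = zr C1 (D (Suc n))"
      using comp_assoc[OF \<iota>a arr_comp[OF fa \<delta>a] arrs(2)] comp_assoc[OF fa \<delta>a arrs(2)] \<delta>(2) \<iota>(3) by simp
    then obtain y where y: "arr y C1 (E n)" "e n \<bullet> y = (\<delta> n \<bullet> f) \<bullet> \<iota>" using weak_kernel[OF tr x]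
        by blast
    have "int A \<le> int n - int A" using step.prems by (simp add: M_def)
    then obtain C2 \<iota>' where \<iota>': "C2 \<in> Cpt" "coaisle_iso \<iota>' C2 C1" "y \<bullet> \<iota>' = zr C2 (E n)"
      using kill_into_building[OF E _ \<iota>(1) y(1)] by blast
    have \<iota>'a: "arr \<iota>' C2 C1" using \<iota>'(2) by (simp add: coaisle_iso_def)
    have C2: "C2 \<in> Obj T" using \<iota>'a by auto
    have "(\<delta> n \<bullet> f) \<bullet> (\<iota> \<bullet> \<iota>') = e n \<bullet> (y \<bullet> \<iota>')"
      using comp_assoc[OF \<iota>'a \<iota>a arr_comp[OF fa \<delta>a]] comp_assoc[OF \<iota>'a y(1) arrs(1)] y(2) by simp
    also have "\<dots> = zr C2 (D n)" using \<iota>'(3) comp_zero_right[OF arrs(1) C2] by simp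
    finally show ?case using \<iota>'(1) coaisle_iso_comp[OF \<iota>'(2) \<iota>(2)] by blast
  qed
  moreover have "M \<le> N" by (simp add: N_def)
  ultimately obtain C' \<iota> where \<iota>: "C' \<in> Cpt" "coaisle_iso \<iota> C' C" "(\<delta> M \<bullet> f) \<bullet> \<iota> = zr C' (D M)"
    by blast
  have \<iota>a: "arr \<iota> C' C" using \<iota>(2) by (simp add: coaisle_iso_def)
  have "\<delta> M \<bullet> (f \<bullet> \<iota>) = zr C' (D M)" using comp_assoc[OF \<iota>a fa \<delta>a] \<iota>(3) by simp
  then obtain w where w: "arr w C' F" "u \<bullet> w = f \<bullet> \<iota>" using weak_kernel[OF F arr_comp[OF \<iota>a fa]]
      by blast
  note vw = arr_comp[OF w(1) v(1)]
  \<comment> \<open>\<open>f\<close> takes both \<open>\<iota>\<close> and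
    \<open>v \<bullet> w\<close> to the same map, so it kills the difference and extends over the
    cone \<open>K\<close>.\<close>
  define m where "m = \<iota> \<ominus>\<^bsub>Hom T C' C\<^esub> (v \<bullet> w)"
  have m: "arr m C' C" unfolding m_def using arr_minus[OF \<iota>a vw] .
  have "f \<bullet> (v \<bullet> w) = f \<bullet> \<iota>" using comp_assoc[OF w(1) v(1) fa] v(2) w(2) by simp
  then have fm: "f \<bullet> m = zr C' t"
    unfolding m_def using comp_minus_right[OF \<iota>a vw fa]
      minus_eq_zero_iff[OF arr_comp[OF \<iota>a fa] arr_comp[OF \<iota>a fa]] by simp
  obtain K p s where K: "Tri T C' C K m p s" using Tri_cone[OF m] .
  note Ka = Tri_arr[OF K]
  have KO: "K \<in> Obj T" and C'O: "C' \<in> Obj T" using Ka by auto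
  have "tri C' C K" using K by (auto simp: tri_def)
  then have KC: "K \<in> Cpt" using compact_cone \<iota>(1) CC by blast
  obtain r where r: "arr r K t" "r \<bullet> p = f" using weak_cokernel[OF K fa fm] by blast
  \<comment> \<open>Composed with maps from \<open>C\<close> to the coaisle, \<open>m\<close> has
    the same effect as \<open>\<iota>\<close>, because the correction passes through
    \<open>F\<close>; the same holds after a shift. The two halves of \<open>coaisle_iso\<close>
    then exclude nonzero maps from \<open>K\<close>.\<close>
  have "hom_zero K Y" if Y: "Y \<in> R 1" for Y
    unfolding hom_zero_def
  proof (intro allI impI)
    fix x assume x: "arr x K Y"
    have YO: "Y \<in> Obj T" using R_Obj[OF Y] .
    have xp: "arr (x \<bullet> p) C Y" using arr_comp[OF Ka(2) x] .
    have 0: "(x \<bullet> p) \<bullet> (v \<bullet> w) = zr C' Y"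
      using comp_assoc[OF w(1) v(1) xp] hom_zeroD[OF orth[OF FL Y] arr_comp[OF v(1) xp]]
        comp_zero_left[OF w(1) YO] by simp
    have "(x \<bullet> p) \<bullet> m = zr C' Y"
      using comp_assoc[OF m Ka(2) x] Tri_comp_zero[OF K] comp_zero_right[OF x C'O] by simp
    then have "(x \<bullet> p) \<bullet> \<iota> = zr C' Y"
      using comp_minus_right[OF \<iota>a vw xp] 0 minus_zero_right[OF arr_comp[OF \<iota>a xp]] by (simp add: m_def)
    then have "x \<bullet> p = zr C Y" using \<iota>(2) Y xp unfolding coaisle_iso_def by blast
    then obtain \<psi> where \<psi>: "arr \<psi> (Shift T C') Y" "\<psi> \<bullet> s = x" using weak_cokernel2[OF K x] by blast
    then obtain \<phi> where \<phi>: "arr \<phi> (Shift T C) Y" "\<phi> \<bullet> ShiftM T \<iota> = \<psi>" using \<iota>(2) Y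
        unfolding coaisle_iso_def by blast
    note sv = arr_shift[OF v(1)] and sw = arr_shift[OF w(1)]
    have "hom_zero (Shift T F) Y" using orth[OF L_Shift[OF FL] Y] by simp
    then have 1: "\<phi> \<bullet> (ShiftM T v \<bullet> ShiftM T w) = zr (Shift T C') Y"
      using comp_assoc[OF sw sv \<phi>(1)] hom_zeroD[OF _ arr_comp[OF sv \<phi>(1)]] comp_zero_left[OF sw YO]
        by simp
    have "\<phi> \<bullet> ShiftM T m = \<psi> \<ominus>\<^bsub>Hom T (Shift T C') Y\<^esub> (\<phi> \<bullet> (ShiftM T v \<bullet> ShiftM T w))"
      unfolding m_def
      using ShiftM_minus[OF \<iota>a vw] comp_minus_right[OF arr_shift[OF \<iota>a] arr_shift[OF vw] \<phi>(1)] \<phi>(2)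
        ShiftM_comp[OF w(1) v(1)] by simp
    then have "\<phi> \<bullet> ShiftM T m = \<psi>" using 1 minus_zero_right[OF \<psi>(1)] by simp
    then have "x = \<phi> \<bullet> (ShiftM T m \<bullet> s)" using \<psi>(2) comp_assoc[OF Ka(3) arr_shift[OF m] \<phi>(1)] by simp
    then show "x = zr K Y" using Tri_comp_zero'(2)[OF K] comp_zero_right[OF \<phi>(1) KO] by simp
  qed
  then have KL: "K \<in> L 0" using L_orth_iff[of K 0] KO by simp
  obtain D' c z where D': "Tri T K t D' r c z" using Tri_cone[OF r(1)] .
  note D'a = Tri_arr[OF D']
  \<comment> \<open>Since \<open>u\<close> factors through \<open>f\<close> and \<open>f\<close>
    through \<open>r\<close>, a map that kills \<open>r\<close> also kills \<open>u\<close> and so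
    factors through \<open>D M\<close>, which has no maps to \<open>Y\<close>. What remains factors
    through the shift of \<open>K\<close>.\<close>
  have "hom_zero D' Y" if Y: "Y \<in> R 0" for Y
    unfolding hom_zero_def
  proof (intro allI impI)
    fix x assume x: "arr x D' Y"
    have YO: "Y \<in> Obj T" using R_Obj[OF Y] .
    have xc: "arr (x \<bullet> c) t Y" using arr_comp[OF D'a(2) x] .
    have "(x \<bullet> c) \<bullet> r = zr K Y"
      using comp_assoc[OF r(1) D'a(2) x] Tri_comp_zero[OF D'] comp_zero_right[OF x KO] by simp
    then have "(x \<bullet> c) \<bullet> f = zr C Y"
      using comp_assoc[OF Ka(2) r(1) xc] r(2) comp_zero_left[OF Ka(2) YO] by simp
    then have "(x \<bullet> c) \<bullet> u = zr F Y"
      using comp_assoc[OF v(1) fa xc] v(2) comp_zero_left[OF v(1) YO] by simp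
    then obtain y where y: "arr y (D M) Y" "y \<bullet> \<delta> M = x \<bullet> c" using weak_cokernel[OF F xc] by blast
    have "hom_zero (D M) Y" using orth[OF D Y] by (simp add: M_def)
    then have "x \<bullet> c = zr t Y" using y comp_zero_left[OF \<delta>a YO] hom_zeroD[OF _ y(1)] by simp
    then obtain y' where y': "arr y' (Shift T K) Y" "y' \<bullet> z = x" using weak_cokernel2[OF D' x] by blast
    have "hom_zero (Shift T K) Y" using orth[OF L_Shift[OF KL] Y] by simp
    then show "x = zr D' Y" using y'(2) hom_zeroD[OF _ y'(1)] comp_zero_left[OF D'a(3) YO] by simp
  qed
  moreover have "D' \<in> Obj T" using D'a by auto
  ultimately have "D' \<in> L (- 1)" using L_orth_iff[of D' "-1"] by simp
  then show ?thesis using D' KC unfolding tri_def by blast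
qed

section \<open>Shifting and iterating the compact approximation\<close>

lemma fg_module_shift_iff:
  assumes "X \<in> Obj T" "Y \<in> Obj T"
  shows "fg_module k (Hom T (Shift T X) (Shift T Y)) \<longleftrightarrow> fg_module k (Hom T X Y)"
proof -
  have M: "module k (Hom T X Y)" and N: "module k (Hom T (Shift T X) (Shift T Y))"
    using Hom_module assms by auto
  note lin = ShiftM_linear_map[OF assms]
  have bij: "bij_betw (ShiftM T) (mor T X Y) (mor T (Shift T X) (Shift T Y))"
      by (rule ShiftM_bij[OF assms])
  interpret M: module k "Hom T X Y" by (rule M)
  show ?thesis
  proof
    assume fg: "fg_module k (Hom T (Shift T X) (Shift T Y))"
    \<comment> \<open>Injectivity of the shift is expressed as exactness with a zero map in front,
      which avoids constructing a linear inverse.\<close>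
    have zero': "linear_map k (Hom T (Shift T X) (Shift T Y)) (Hom T X Y) (\<lambda>_. zr X Y)"
      by (auto simp: linear_map_def)
    show "fg_module k (Hom T X Y)"
    proof (rule fg_module_exact[OF k_noetherian N M N zero' lin _ fg fg])
      fix y assume y: "y \<in> mor T X Y" "ShiftM T y = zr (Shift T X) (Shift T Y)"
      then have "y = zr X Y"
        using ShiftM_inj[of y X Y "zr X Y"] ShiftM_zero[OF assms] assms arr_zero[OF assms]
          by (simp add: arr_def)
      moreover have "zr (Shift T X) (Shift T Y) \<in> mor T (Shift T X) (Shift T Y)"
        using arr_zero assms by blast
      ultimately show "y \<in> (\<lambda>_. zr X Y) ` mor T (Shift T X) (Shift T Y)" by blast
    qed
  next
    assume "fg_module k (Hom T X Y)"
    then show "fg_module k (Hom T (Shift T X) (Shift T Y))"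
      using fg_module_surj[OF M N lin] bij by (simp add: bij_betw_def)
  qed
qed

lemma fg_module_shift_pow_iff:
  assumes "X \<in> Obj T" "Y \<in> Obj T"
  shows "fg_module k (Hom T (shift_pow T i X) (shift_pow T i Y)) \<longleftrightarrow> fg_module k (Hom T X Y)"
proof (induction i rule: int_induct[where k = 0])
  case (step1 i)
  then show ?case using assms by (simp add: shift_pow_Suc fg_module_shift_iff)
next
  case (step2 i)
  then show ?case
    using assms fg_module_shift_iff[of "shift_pow T (i - 1) X" "shift_pow T (i - 1) Y"]
      by (simp add: shift_pow_pred)
qed simp

lemma compact_approximations:
  assumes tL: "t \<in> L m" and fin: "hom_finite t"
  shows "\<exists>D g. compact_cone_map g t D \<and> D \<in> L (m - int n)"
proof (induction n)
  case 0
  show ?case using compact_cone_map_id[OF L_Obj[OF tL]] tL by auto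
next
  case (Suc n)
  then obtain D g where g: "compact_cone_map g t D" "D \<in> L (m - int n)" by blast
  let ?m = "m - int n"
  have DO: "D \<in> Obj T" using L_Obj[OF g(2)] .
  have finD: "hom_finite D" by (rule hom_finite_compact_cone[OF g(1) fin])
  \<comment> \<open>\<open>compact_approximation\<close> works at level 0, so \<open>D\<close> is
    moved there and the resulting triangle moved back.\<close>
  have "shift_pow T ?m D \<in> L 0" using g(2) DO by (simp add: L_shift)
  moreover have "hom_finite (shift_pow T ?m D)"
    unfolding hom_finite_def
  proof (intro conjI ballI)
    fix c assume c: "c \<in> Cpt"
    have cO: "c \<in> Obj T" using compact_Obj[OF c] .
    have "fg_module k (Hom T (shift_pow T (- ?m) c) D)"
      using finD compact_shift_pow_iff[OF cO] c unfolding hom_finite_def by blast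
    then show "fg_module k (Hom T c (shift_pow T ?m D))"
      using fg_module_shift_pow_iff[of "shift_pow T (- ?m) c" D ?m] cO DO by (simp add: shift_pow_add)
  qed (use DO in simp)
  ultimately obtain K D' where KD: "tri K (shift_pow T ?m D) D'" "K \<in> Cpt" "D' \<in> L (- 1)"
    using compact_approximation by blast
  have D'O: "D' \<in> Obj T" using L_Obj[OF KD(3)] .
  have KO: "K \<in> Obj T" using compact_Obj[OF KD(2)] .
  have "tri (shift_pow T (- ?m) K) D (shift_pow T (- ?m) D')"
    using tri_shift_pow[OF KD(1), of "- ?m"] DO by (simp add: shift_pow_add)
  then obtain u g' v where "Tri T (shift_pow T (- ?m) K) D (shift_pow T (- ?m) D') u g' v"
      unfolding tri_def by blast
  then have "Tri T D (shift_pow T (- ?m) D') (Shift T (shift_pow T (- ?m) K)) g' v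
      (\<ominus>\<^bsub>Hom T (Shift T (shift_pow T (- ?m) K)) (Shift T D)\<^esub> ShiftM T u)"
    by (rule Tri_rotate)
  moreover have "Shift T (shift_pow T (- ?m) K) \<in> Cpt"
    using KD(2) compact_Shift_iff[OF shift_pow_Obj[OF KO]] compact_shift_pow_iff[OF KO] by blast
  ultimately have "compact_cone_map g' D (shift_pow T (- ?m) D')" unfolding compact_cone_map_def
      by blast
  moreover have "shift_pow T (- ?m) D' \<in> L (m - int (Suc n))" using KD(3) D'O by (simp add: L_shift)
  ultimately show ?case using compact_cone_map_comp[OF g(1)] by blast
qed

lemma T_minus_cI:
  assumes tL: "t \<in> L m" and fin: "hom_finite t"
  shows "t \<in> T_minus_c \<kappa> T \<tau>"
  unfolding T_minus_c_def mem_Collect_eq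
proof (intro conjI allI impI)
  show "t \<in> Obj T" using L_Obj[OF tL] .
  fix n :: int assume "n > 0"
  \<comment> \<open>If \<open>m + n\<close> is negative, \<open>nat\<close> gives zero steps, but
    then \<open>m\<close> is already below \<open>- n\<close>; the level reached is at most
    \<open>- n\<close> in both cases.\<close>
  obtain D g where g: "compact_cone_map g t D" "D \<in> L (m - int (nat (m + n)))"
    using compact_approximations[OF tL fin] by blast
  obtain Q a b where Q: "Q \<in> Cpt" "Tri T t D Q g a b" using g(1) unfolding compact_cone_map_def by blast
  obtain K where K: "K \<in> Obj T" "Q = Shift T K" using Shift_surj compact_Obj[OF Q(1)] by blast
  obtain f where f: "Tri T K t D f g a" using Tri_unrotate[OF Q(2) K] by blast
  have "K \<in> Cpt" using Q(1) K compact_Shift_iff[of K \<kappa>] by simp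
  moreover have "D \<in> L (- n)" using L_mono[OF _ g(2)] by simp
  ultimately show "\<exists>E D f g h. Tri T E t D f g h \<and> E \<in> Cpt \<and> D \<in> L (- n)" using f by blast
qed

lemma T_b_c_iff:
  "t \<in> T_b_c \<kappa> T \<tau> \<longleftrightarrow>
    t \<in> Obj T \<and> (\<forall>c \<in> Cpt. fg_module k (direct_sum (UNIV :: int set) (\<lambda>i. Hom T c (shift_pow T i t))))"
proof
  assume t: "t \<in> T_b_c \<kappa> T \<tau>"
  have tO: "t \<in> Obj T" using t by (simp add: T_b_c_def T_minus_c_def)
  obtain m m' where m: "t \<in> L m" "t \<in> R m'"
    using t unfolding T_b_c_def t_bounded_def t_minus_def t_plus_def by blast
  have "fg_module k (direct_sum (UNIV :: int set) (\<lambda>i. Hom T c (shift_pow T i t)))" if c: "c \<in> Cpt"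
      for c
  proof (rule fg_direct_sum[OF k_cring])
    have cO: "c \<in> Obj T" using compact_Obj[OF c] .
    obtain N where N: "\<And>Y. Y \<in> L N \<Longrightarrow> hom_zero c Y" using compact_orth[OF c] by blast
    obtain p where p: "c \<in> L p" using compact_L[OF c] by blast
    show mod: "module k (Hom T c (shift_pow T i t))" for i using Hom_module cO tO by simp
    show "fg_module k (Hom T c (shift_pow T i t))" for i
    proof -
      have "\<exists>E D. tri E t D \<and> E \<in> Cpt \<and> D \<in> L (- n)" if "n > 0" for n
        using t that unfolding T_b_c_def T_minus_c_def tri_def by blast
      \<comment> \<open>\<open>D\<close> is taken so deep that its \<open>i\<close>-th shift lies in
        \<open>L N\<close>, out of reach of \<open>c\<close>; all maps from \<open>c\<close> to the
        shift of \<open>t\<close> then come from the shift of \<open>E\<close>. The maximum with 1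
        respects the positivity of the level in \<open>T_minus_c\<close>.\<close>
      moreover have "max 1 (- N - i) > 0" by simp
      ultimately obtain E D where ED: "tri E t D" "E \<in> Cpt" "D \<in> L (- max 1 (- N - i))" by blast
      obtain f g h where "Tri T (shift_pow T i E) (shift_pow T i t) (shift_pow T i D) f g h"
        using tri_shift_pow[OF ED(1)] unfolding tri_def by blast
      note tr = this and arrs = Tri_arr[OF this]
      have EO: "E \<in> Obj T" and DO: "D \<in> Obj T" using tri_Obj[OF ED(1)] by auto
      have "shift_pow T i D \<in> L N" using L_mono[OF _ ED(3), of "N + i"] DO by (simp add: L_shift)
      then have van: "hom_zero c (shift_pow T i D)" by (rule N)
      have EC: "shift_pow T i E \<in> Cpt" using ED(2) compact_shift_pow_iff[OF EO] by blast
      show ?thesis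
      proof (rule fg_module_surj[OF Hom_module[OF cO shift_pow_Obj[OF EO]] mod comp_linear_map[OF
          arrs(1) cO] _ compact_homs_fg[OF c EC]])
        show "mor T c (shift_pow T i t) \<subseteq> (\<lambda>x. f \<bullet> x) ` mor T c (shift_pow T i E)"
        proof
          fix x assume "x \<in> mor T c (shift_pow T i t)"
          then have x: "arr x c (shift_pow T i t)" using cO tO by (simp add: arr_def)
          have "g \<bullet> x = zr c (shift_pow T i D)" using hom_zeroD[OF van arr_comp[OF x arrs(2)]] .
          then obtain y where "arr y c (shift_pow T i E)" "f \<bullet> y = x" using weak_kernel[OF tr x]
              by blast
          then show "x \<in> (\<lambda>x. f \<bullet> x) ` mor T c (shift_pow T i E)" by auto
        qed
      qed
    qed
    have "{i \<in> UNIV. mor T c (shift_pow T i t) \<noteq> {zr c (shift_pow T i t)}} \<subseteq> {m' - p .. m - N}"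
    proof
      fix i assume i: "i \<in> {i \<in> UNIV. mor T c (shift_pow T i t) \<noteq> {zr c (shift_pow T i t)}}"
      then have nz: "\<not> hom_zero c (shift_pow T i t)" using hom_zero_iff cO tO by simp
      have "i \<le> m - N"
      proof (rule ccontr)
        assume "\<not> i \<le> m - N"
        then have "shift_pow T i t \<in> L N" using L_mono[OF _ m(1), of "N + i"] tO by (simp add: L_shift)
        then show False using nz N by blast
      qed
      moreover have "m' - p \<le> i"
      proof (rule ccontr)
        assume *: "\<not> m' - p \<le> i"
        have "shift_pow T i t \<in> R (m' - i)" using m(2) tO by (simp add: R_shift)
        then show False using nz orth[OF p] * by simp
      qed
      ultimately show "i \<in> {m' - p .. m - N}" by simp
    qed
    then show "finite {i \<in> UNIV. mor T c (shift_pow T i t) \<noteq> {zr c (shift_pow T i t)}}"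
      by (rule finite_subset) simp
  qed
  then show "t \<in> Obj T \<and> (\<forall>c \<in> Cpt. fg_module k (direct_sum (UNIV :: int set) (\<lambda>i. Hom T c (shift_pow T
      i t))))"
    using tO by blast
next
  assume *: "t \<in> Obj T \<and> (\<forall>c \<in> Cpt. fg_module k (direct_sum (UNIV :: int set) (\<lambda>i. Hom T c (shift_pow T
      i t))))"
  then have tO: "t \<in> Obj T" by blast
  have mod: "module k (Hom T c (shift_pow T i t))" if "c \<in> Cpt" for c i
    using Hom_module compact_Obj[OF that] tO by simp
  have fin: "hom_finite t"
    unfolding hom_finite_def
  proof (intro conjI ballI)
    fix c assume c: "c \<in> Cpt"
    have "fg_module k (Hom T c (shift_pow T 0 t))"
      using * c by (intro fg_direct_sum_component[OF k_cring mod[OF c], of "UNIV :: int set" "\<lambda>i. i"])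
        auto
    then show "fg_module k (Hom T c t)" by simp
  qed (rule tO)
  have "finite {i \<in> UNIV. mor T G (shift_pow T i t) \<noteq> {zr G (shift_pow T i t)}}" (is "finite ?S")
    using * G_Cpt by (intro fg_direct_sum_support[OF k_cring mod[OF G_Cpt], of "UNIV :: int set"
      "\<lambda>i. i"]) auto
  then have "bdd_above (abs ` ?S)" by simp
  then obtain B where B: "\<And>i. i \<in> ?S \<Longrightarrow> \<bar>i\<bar> \<le> B" unfolding bdd_above_def by blast
  have van: "hom_zero (shift_pow T i G) t" if "\<bar>i\<bar> > B" for i
  proof -
    have "- i \<notin> ?S" using B[of "- i"] that by auto
    then have "hom_zero G (shift_pow T (- i) t)" using hom_zero_iff G_Obj tO by simp
    then show ?thesis using hom_zero_shift_left G_Obj tO by simp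
  qed
  \<comment> \<open>The absolute value covers a negative \<open>B\<close>, which is possible if all
    the modules vanish.\<close>
  have tL: "t \<in> L (int A - (- \<bar>B\<bar> - 1))" using van by (intro detect_L[OF tO]) auto
  have tR: "t \<in> R (- (\<bar>B\<bar> + 1) - int A + 1)" using van by (intro detect_R[OF tO]) auto
  show "t \<in> T_b_c \<kappa> T \<tau>"
    using T_minus_cI[OF tL fin] tL tR unfolding T_b_c_def t_bounded_def t_minus_def t_plus_def by blast
qed

end

theorem lemma4p1:
  fixes k :: "('k, 'a) ring_scheme"
    and T :: "('o, 'm, 'k) tri_data"
    and \<kappa> :: "'i rel"
    and \<tau> :: "'o tstr"
  assumes "cring k" and "noetherian_ring k"
    and "linear_triangulated_category k T"
    and "smallness_cardinal \<kappa>"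
    and "has_small_coproducts \<kappa> T"
    and "locally_small \<kappa> T"
    and "approximable \<kappa> T"
    and "\<And>X Y. \<lbrakk>X \<in> compact_objects \<kappa> T; Y \<in> compact_objects \<kappa> T\<rbrakk> \<Longrightarrow> fg_module k (Hom T X Y)"
    and "preferred_t_structure \<kappa> T \<tau>"
  shows "T_b_c \<kappa> T \<tau> =
    {t \<in> Obj T. \<forall>c \<in> compact_objects \<kappa> T.
       fg_module k (direct_sum (UNIV :: int set) (\<lambda>i. Hom T c (shift_pow T i t)))}"
proof -
  interpret linear_triangulated_category k T by fact
  \<comment> \<open>Approximability does not present \<open>\<sigma>\<close> as generated by
    \<open>G\<close>, so the characterization is proved for \<open>\<sigma>\<close> and carried over
    to \<open>\<tau>\<close> by comparison.\<close>
  obtain G \<sigma> and A :: nat where gen: "compact_generator \<kappa> T G" and \<sigma>: "t_structure T \<sigma>"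
    and 1: "shift_pow T (int A) G \<in> t_le T \<sigma> 0"
    and 2: "\<And>E. E \<in> t_le T \<sigma> 0 \<Longrightarrow>
      mor T (shift_pow T (- int A) G) E = {\<zero>\<^bsub>Hom T (shift_pow T (- int A) G) E\<^esub>}"
    and 3: "\<And>F. F \<in> t_le T \<sigma> 0 \<Longrightarrow> \<exists>E D f g h. Tri T E F D f g h \<and> D \<in> t_le T \<sigma> (-1) \<and>
      E \<in> building \<kappa> T {G} (- int A) (int A) A"
    using assms(7) unfolding approximable_def by blast
  interpret t_structured k T \<sigma> by unfold_locales (rule \<sigma>)
  interpret approximable_category k T \<kappa> \<sigma> G A
  proof unfold_locales
    have "G \<in> Obj T" using gen compact_Obj by (auto simp: compact_generator_def)
    then show "hom_zero (shift_pow T (- int A) G) E" if "E \<in> t_le T \<sigma> 0" for E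
      using 2[OF that] hom_zero_iff L_Obj[OF that] by simp
    show "\<exists>E D. tri E F D \<and> D \<in> t_le T \<sigma> (-1) \<and> E \<in> building \<kappa> T {G} (- int A) (int A) A"
      if "F \<in> t_le T \<sigma> 0" for F
      using 3[OF that] unfolding tri_def by blast
  qed (fact assms gen 1)+
  interpret noetherian_approximable_category k T \<kappa> \<sigma> G A
    by (intro noetherian_approximable_category.intro noetherian_approximable_category_axioms.intro
        approximable_category_axioms assms)
  show ?thesis using T_b_c_preferred[OF assms(9)] T_b_c_iff by blast
qed

end
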